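(* Let $Z$ be a metric space, $d\ge1$, $l\ge0$ an integer, $\alpha>0$, and let $f:Z\times[0,1]^d\to\mathbb{R}$ be such that $f(\cdot,x)$ is continuous on $Z$ for each $x\in[0,1]^d$, $f(z,\cdot)$ is $l$ times continuously differentiable on $[0,1]^d$ for each $z\in Z$, and there is a constant $C_f>0$ independent of $z$ with \[ \Bigl|\frac{\partial^r f(z,x)}{\partial x_{s_1}\cdots\partial x_{s_r}}\Bigr|\le C_f,\quad x\in[0,1]^d, \] for all $0\le r\le l$, $s_1,\dots,s_r\in\{1,\dots,d\}$, and \[ \Bigl|\frac{\partial^l f(z,x^{(1)})}{\partial x_{s_1}\cdots\partial x_{s_l}}-\frac{\partial^l f(z,x^{(2)})}{\partial x_{s_1}\cdots\partial x_{s_l}}\Bigr|\le C_f|x^{(1)}-x^{(2)}|^\alpha \] for all $x^{(1)},x^{(2)}\in[0,1]^d$, $z\in Z$, $s_1,\dots,s_l\in\{1,\dots,d\}$. Let $\mu$ be a stochastic measure on the Borel subsets of $[0,1]^d$ and $\eta(z)=\int_{[0,1]^d}f(z,x)\,d\mu(x)$, $z\in Z$. If $l+\alpha>d/2$, then $\eta$ has the version \[ \tilde\eta(z)=\int_{[0,1]^d}S^{(d)}_1(f(z,\cdot),x)\,d\mu(x)+\sum_{k=1}^\infty\int_{[0,1]^d}\bigl(S^{(d)}_{2^k}(f(z,\cdot),x)-S^{(d)}_{2^{k-1}}(f(z,\cdot),x)\bigr)\,d\mu(x), \] and this version has continuous paths on $Z$ a.s.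
   Context: Let $(\Omega,\mathcal F,\mathsf P)$ be a complete probability space and $L_0$ the set of all real random variables on it, with convergence in probability. A stochastic measure (SM) on a measurable space $(X,\mathcal B)$ is a $\sigma$-additive map $\mu:\mathcal B\to L_0$ (finitely additive, and $\mu(A_n)\to0$ in probability whenever $A_n\downarrow\emptyset$). Every bounded measurable deterministic function $g$ is integrable w.r.t. $\mu$ (integral $\int g\,d\mu\in L_0$, with $\int\sum_ic_i\mathbf 1_{A_i}d\mu=\sum_ic_i\mu(A_i)$ for simple functions, and an analogue of the dominated convergence theorem in probability). In the series defining $\tilde\eta$ all integrands are simple functions, and a single fixed version of $\mu$ is used for all values of $\mu$ appearing. One-dimensional Haar functions on $[0,1]$: $\chi_1\equiv1$; for $n=2^j+i$, $1\le i\le2^j$, $j\ge0$, put $\Delta_n^+=((i-1)2^{-j},(2i-1)2^{-j-1})$, $\Delta_n^-=((2i-1)2^{-j-1},i2^{-j})$, $\chi_n=2^{j/2}$ on $\Delta_n^+$, $-2^{j/2}$ on $\Delta_n^-$, $0$ outside $[(i-1)2^{-j},i2^{-j}]$; at discontinuity points in $(0,1)$ $\chi_n$ equals the average of its one-sided limits, $\chi_n(0)=\chi_n(0+)$, $\chi_n(1)=\chi_n(1-)$. Multivariate Haar functions $\chi^{(d)}_{n_1,\dots,n_d}(x)=\prod_{s=1}^d\chi_{n_s}(x_s)$, coefficients $c^{(d)}_{n_1,\dots,n_d}(g)=\int_{[0,1]^d}g\,\chi^{(d)}_{n_1,\dots,n_d}\,dx$, partial sums $S^{(d)}_{2^k}(g,x)=\sum_{(n_1,\dots,n_d)\in\{1,\dots,2^k\}^d}c^{(d)}_{n_1,\dots,n_d}(g)\chi^{(d)}_{n_1,\dots,n_d}(x)$.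 *)

theory Defs
  imports "HOL-Probability.Probability"
begin

definition unit_cube :: "(real^'n) set" where
  "unit_cube = cbox 0 One"

definition cube_borel :: "(real^'n) set set" where
  "cube_borel = {A. A \<in> sets borel \<and> A \<subseteq> unit_cube}"

definition conv_in_prob :: "'w measure \<Rightarrow> (nat \<Rightarrow> 'w \<Rightarrow> real) \<Rightarrow> ('w \<Rightarrow> real) \<Rightarrow> bool" where
  "conv_in_prob M Y Y0 \<longleftrightarrow>
     (\<forall>e>0. (\<lambda>n. measure M {w \<in> space M. \<bar>Y n w - Y0 w\<bar> > e}) \<longlonglongrightarrow> 0)"

text \<open>A stochastic measure (a fixed version of it): sigma-additive map from the Borel
  subsets of the cube to L0, i.e. finitely additive (a.s.) and continuous at the empty set
  in probability.\<close>
definition stochastic_measure :: "'w measure \<Rightarrow> ((real^'n) set \<Rightarrow> 'w \<Rightarrow> real) \<Rightarrow> bool" where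
  "stochastic_measure M \<mu> \<longleftrightarrow>
     (\<forall>A\<in>cube_borel. \<mu> A \<in> borel_measurable M) \<and>
     (\<forall>A\<in>cube_borel. \<forall>B\<in>cube_borel. A \<inter> B = {} \<longrightarrow>
         (AE w in M. \<mu> (A \<union> B) w = \<mu> A w + \<mu> B w)) \<and>
     (\<forall>As. (\<forall>n. As n \<in> cube_borel) \<longrightarrow> decseq As \<longrightarrow> (\<Inter>n. As n) = {} \<longrightarrow>
         conv_in_prob M (\<lambda>n. \<mu> (As n)) (\<lambda>w. 0))"

definition cube_simple :: "(real^'n \<Rightarrow> real) \<Rightarrow> bool" where
  "cube_simple g \<longleftrightarrow> finite (g ` unit_cube) \<and> (\<forall>c. g -` {c} \<inter> unit_cube \<in> sets borel)"

definition sm_simple_int :: "((real^'n) set \<Rightarrow> 'w \<Rightarrow> real) \<Rightarrow> (real^'n \<Rightarrow> real) \<Rightarrow> 'w \<Rightarrow> real" where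
  "sm_simple_int \<mu> g w = (\<Sum>c \<in> g ` unit_cube. c * \<mu> (g -` {c} \<inter> unit_cube) w)"

definition sm_integral :: "'w measure \<Rightarrow> ((real^'n) set \<Rightarrow> 'w \<Rightarrow> real) \<Rightarrow> (real^'n \<Rightarrow> real)
      \<Rightarrow> ('w \<Rightarrow> real) \<Rightarrow> bool" where
  "sm_integral M \<mu> g \<xi> \<longleftrightarrow> \<xi> \<in> borel_measurable M \<and>
     (\<forall>gs. (\<forall>n. cube_simple (gs n)) \<longrightarrow>
           (\<forall>e>0. \<exists>N. \<forall>n\<ge>N. \<forall>x\<in>unit_cube. \<bar>gs n x - g x\<bar> < e) \<longrightarrow>
           conv_in_prob M (\<lambda>n. sm_simple_int \<mu> (gs n)) \<xi>)"

text \<open>For \<open>n = 2^j + i\<close>, \<open>1 \<le> i \<le> 2^j\<close>: level j and position i.\<close>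
definition haar_level :: "nat \<Rightarrow> nat" where
  "haar_level n = (LEAST j. n \<le> 2 ^ (j + 1))"

definition haar :: "nat \<Rightarrow> real \<Rightarrow> real" where
  "haar n x =
    (if n = 1 then 1
     else if n = 0 then 0
     else (let j = haar_level n; i = n - 2 ^ j;
               a = (real i - 1) / 2 ^ j; m = (2 * real i - 1) / 2 ^ (j + 1); b = real i / 2 ^ j;
               h = sqrt (2 ^ j)
           in if a < x \<and> x < m then h
              else if m < x \<and> x < b then - h
              else if x = m then 0
              else if x = a then (if a = 0 then h else h / 2)
              else if x = b then (if b = 1 then - h else - h / 2)
              else 0))"

definition haar_d :: "('n::finite \<Rightarrow> nat) \<Rightarrow> real^'n \<Rightarrow> real" where
  "haar_d ns x = (\<Prod>s\<in>UNIV. haar (ns s) (x $ s))"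

definition haar_coeff :: "('n::finite \<Rightarrow> nat) \<Rightarrow> (real^'n \<Rightarrow> real) \<Rightarrow> real" where
  "haar_coeff ns g = integral unit_cube (\<lambda>x. g x * haar_d ns x)"

definition haar_partial :: "(real^'n::finite \<Rightarrow> real) \<Rightarrow> nat \<Rightarrow> real^'n \<Rightarrow> real" where
  "haar_partial g k x =
     (\<Sum>ns \<in> Pi\<^sub>E UNIV (\<lambda>_. {1..2 ^ k}). haar_coeff ns g * haar_d ns x)"

text \<open>The series defining \<open>\<tilde>\<eta>\<close>; the term with index k corresponds to k+1 in the paper.\<close>
definition haar_series_term :: "((real^'n::finite) set \<Rightarrow> 'w \<Rightarrow> real) \<Rightarrow> (real^'n \<Rightarrow> real) \<Rightarrow> nat \<Rightarrow> 'w \<Rightarrow> real" where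
  "haar_series_term \<mu> g k w =
     sm_simple_int \<mu> (\<lambda>x. haar_partial g (Suc k) x - haar_partial g k x) w"

definition haar_version :: "((real^'n::finite) set \<Rightarrow> 'w \<Rightarrow> real) \<Rightarrow> (real^'n \<Rightarrow> real) \<Rightarrow> 'w \<Rightarrow> real" where
  "haar_version \<mu> g w = sm_simple_int \<mu> (haar_partial g 0) w + (\<Sum>k. haar_series_term \<mu> g k w)"

definition partial_on_cube :: "(real^'n::finite \<Rightarrow> real) \<Rightarrow> 'n \<Rightarrow> (real^'n \<Rightarrow> real) \<Rightarrow> bool" where
  "partial_on_cube g s g' \<longleftrightarrow>
     (\<forall>x\<in>unit_cube. ((\<lambda>t. g (x + t *\<^sub>R axis s 1)) has_real_derivative g' x)
                      (at 0 within {t. x + t *\<^sub>R axis s 1 \<in> unit_cube}))"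

end

theory Submission
  imports Defs
begin

text \<open>The terms of the series are finite sums of Haar coefficients of \<open>f z\<close> times integrals of Haar
  functions. After dividing a Haar function of levels \<open>j\<close> by \<open>2\<close> to the power \<open>(1/2 + \<epsilon>) |j|\<close>, the
  integrals are almost surely square summable, and the coefficients, multiplied by the same factor, are square
  summable uniformly in \<open>z\<close> because \<open>l + \<alpha> > d/2\<close>; Cauchy--Schwarz and the Weierstrass test
  give continuity. Square summability of the integrals follows from the boundedness in probability of the integrals of
  all simple functions bounded by 1, by applying the Paley--Zygmund inequality to random subsums.

  That boundedness is a theorem of Talagrand and of Kalton, Peck and Roberts. The range of an additive, exhaustive,
  \<open>L0\<close>-valued set function is bounded: if it is not, splitting sets repeatedly produces a binary tree
  whose nodes carry the events on which the set function is still unbounded, and for each point the siblings of its path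
  are disjoint and large. A sparse random set of leaves loses little of the event of unboundedness but contains a set of
  large charge with probability bounded below; removing such sets one after the other contradicts exhaustivity.
  Boundedness passes from sets to convex combinations by randomized rounding.\<close>

section \<open>Random subsets of a finite set\<close>

text \<open>The obstacle is that \<open>L0\<close> is not locally convex: boundedness in probability
  passes to convex hulls by no norm argument, and integrals of Haar functions need have neither
  moments nor orthogonality. Estimates are therefore made by averaging over random finite sets: a
  moment bound at a fixed sample point says that a fixed fraction of all sets is good there, and
  integrating over the sample point yields one set that is good with comparable probability. The
  exponents balance as follows. Let |j| be the sum of the levels of a multivariate Haar function.
  The functions with given levels number about 2^|j|, and their absolute values add up to about
  2^(|j|/2), so the factor 2^(-(1/2 + \<epsilon>) |j|) makes the sum over all levels uniformly
  bounded. A coefficient is O(2^(-(1/2 + \<theta>) |j|)) with \<theta> =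
  \<open>decay_exponent\<close>; rescaled and squared it is O(2^(-2 (\<theta> - \<epsilon>) |j|)),
  which is summable against 2^|j| when \<theta> - \<epsilon> > 1/2. For \<alpha> \<le> 1, \<theta>
  is the minimum of 1 and (l + \<alpha>)/d, so l + \<alpha> > d/2 leaves room for
  \<epsilon>.\<close>

text \<open>The expectation of \<open>F S\<close> when each \<open>i\<close> belongs to
  \<open>S\<close> independently with probability \<open>p i\<close>. As a finite weighted sum it
  needs no product space and commutes with integration over the sample space by linearity.\<close>

definition bern :: "('i \<Rightarrow> real) \<Rightarrow> 'i set \<Rightarrow> ('i set \<Rightarrow> real) \<Rightarrow> real" where
  "bern p I F = (\<Sum>S\<in>Pow I. (\<Prod>i\<in>S. p i) * (\<Prod>i\<in>I - S. 1 - p i) * F S)"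

lemma bern_empty [simp]: "bern p {} F = F {}"
  by (simp add: bern_def)

text \<open>Conditioning on whether \<open>i\<close> is chosen; the moments below are computed by
  induction on the index set through this identity.\<close>

lemma bern_insert:
  assumes "finite I" "i \<notin> I"
  shows "bern p (insert i I) F = p i * bern p I (\<lambda>S. F (insert i S)) + (1 - p i) * bern p I F"
proof -
  let ?w = "\<lambda>I S. (\<Prod>i\<in>S. p i) * (\<Prod>i\<in>I - S. 1 - p i)"
  have inj: "inj_on (insert i) (Pow I)"
    using assms by (auto simp: inj_on_def)
  have "bern p (insert i I) F = (\<Sum>S\<in>Pow I. ?w (insert i I) S * F S)
      + (\<Sum>S\<in>insert i ` Pow I. ?w (insert i I) S * F S)"
    unfolding bern_def Pow_insert using assms
    by (intro sum.union_disjoint) auto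
  also have "(\<Sum>S\<in>Pow I. ?w (insert i I) S * F S) = (1 - p i) * bern p I F"
    unfolding bern_def sum_distrib_left
  proof (intro sum.cong refl)
    fix S assume S: "S \<in> Pow I"
    then have "insert i I - S = insert i (I - S)" "i \<notin> I - S" using assms by auto
    then show "?w (insert i I) S * F S = (1 - p i) * (?w I S * F S)"
      using assms by simp
  qed
  also have "(\<Sum>S\<in>insert i ` Pow I. ?w (insert i I) S * F S)
      = p i * bern p I (\<lambda>S. F (insert i S))"
    unfolding bern_def sum_distrib_left sum.reindex[OF inj] comp_def
  proof (intro sum.cong refl)
    fix S assume S: "S \<in> Pow I"
    then have "insert i I - insert i S = I - S" "i \<notin> S" "finite S"
      using assms by (auto intro: finite_subset)
    then show "?w (insert i I) (insert i S) * F (insert i S) = p i * (?w I S * F (insert i S))"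
      by simp
  qed
  finally show ?thesis by simp
qed

lemma bern_const [simp]: "finite I \<Longrightarrow> bern p I (\<lambda>_. c) = c"
  by (induction I rule: finite_induct) (auto simp: bern_insert algebra_simps)

lemma bern_add: "bern p I (\<lambda>S. F S + G S) = bern p I F + bern p I G"
  by (simp add: bern_def sum.distrib algebra_simps)

lemma bern_diff: "bern p I (\<lambda>S. F S - G S) = bern p I F - bern p I G"
  by (simp add: bern_def sum_subtractf algebra_simps)

lemma bern_cmult: "bern p I (\<lambda>S. c * F S) = c * bern p I F"
  by (simp add: bern_def sum_distrib_left algebra_simps)

lemma bern_mono:
  assumes "\<And>i. i \<in> I \<Longrightarrow> 0 \<le> p i \<and> p i \<le> 1" "\<And>S. S \<subseteq> I \<Longrightarrow> F S \<le> G S"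
  shows "bern p I F \<le> bern p I G"
  unfolding bern_def
proof (intro sum_mono mult_left_mono mult_nonneg_nonneg prod_nonneg)
  fix S assume S: "S \<in> Pow I"
  show "F S \<le> G S" using assms S by auto
  show "0 \<le> p i" if "i \<in> S" for i using assms(1)[of i] that S by auto
  show "0 \<le> 1 - p i" if "i \<in> I - S" for i using assms(1)[of i] that by auto
qed

lemma bern_cong: "(\<And>S. S \<subseteq> I \<Longrightarrow> F S = G S) \<Longrightarrow> bern p I F = bern p I G"
  unfolding bern_def by (intro sum.cong) auto

lemma bern_le_const:
  assumes "finite I" "\<And>i. i \<in> I \<Longrightarrow> 0 \<le> p i \<and> p i \<le> 1" "\<And>S. S \<subseteq> I \<Longrightarrow> F S \<le> c"
  shows "bern p I F \<le> c"
  using bern_mono[of I p F "\<lambda>_. c"] assms by simp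

text \<open>The first moment method: it turns an averaged estimate into a deterministic choice of a
  set.\<close>

lemma ex_ge_bern:
  fixes F :: "'i set \<Rightarrow> real"
  assumes "finite I" "\<And>i. i \<in> I \<Longrightarrow> 0 \<le> p i \<and> p i \<le> 1"
  obtains S where "S \<subseteq> I" "bern p I F \<le> F S"
proof -
  have fin: "finite (F ` Pow I)" and ne: "F ` Pow I \<noteq> {}" using assms by auto
  have "bern p I F \<le> Max (F ` Pow I)"
    by (intro bern_le_const assms Max_ge fin) auto
  moreover have "Max (F ` Pow I) \<in> F ` Pow I" using fin ne by (rule Max_in)
  ultimately show ?thesis using that by auto
qed

lemma bern_sum_mean:
  assumes "finite I"
  shows "bern p I (\<lambda>S. \<Sum>i\<in>S. x i) = (\<Sum>i\<in>I. p i * x i)"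
  using assms
proof (induction I rule: finite_induct)
  case (insert i I)
  have "bern p I (\<lambda>S. \<Sum>i\<in>insert i S. x i) = bern p I (\<lambda>S. x i + (\<Sum>i\<in>S. x i))"
    using insert by (intro bern_cong) (auto dest: finite_subset intro!: sum.insert)
  then show ?case using insert by (simp add: bern_insert bern_add algebra_simps)
qed simp

lemma bern_avoid:
  assumes "finite I"
  shows "bern (\<lambda>_. t) I (\<lambda>S. of_bool (S \<inter> J = {})) = (1 - t) ^ card (I \<inter> J)"
  using assms
proof (induction I rule: finite_induct)
  case (insert i I)
  show ?case
  proof (cases "i \<in> J")
    case True
    then have "bern (\<lambda>_. t) I (\<lambda>S. of_bool (insert i S \<inter> J = {})) = bern (\<lambda>_. t) I (\<lambda>_. 0)"
      by (intro bern_cong) auto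
    moreover have "insert i I \<inter> J = insert i (I \<inter> J)" "i \<notin> I \<inter> J" using True insert by auto
    ultimately show ?thesis using insert by (simp add: bern_insert)
  next
    case False
    then show ?thesis using insert by (simp add: bern_insert algebra_simps)
  qed
qed simp

section \<open>Moments of random subsums and Paley--Zygmund bounds\<close>

context
  fixes p x :: "'i \<Rightarrow> real"
begin

definition bmean where "bmean I = (\<Sum>i\<in>I. p i * x i)"
definition bvar where "bvar I = (\<Sum>i\<in>I. p i * (1 - p i) * (x i)\<^sup>2)"
definition bdev where "bdev I S = (\<Sum>i\<in>S. x i) - bmean I"

lemma bdev_insert:
  assumes "finite I" "i \<notin> I" "S \<subseteq> I"
  shows "bdev (insert i I) (insert i S) = bdev I S + (1 - p i) * x i"
    and "bdev (insert i I) S = bdev I S + (- p i * x i)"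
proof -
  have "finite S" "i \<notin> S" using assms finite_subset by auto
  then show "bdev (insert i I) (insert i S) = bdev I S + (1 - p i) * x i"
    and "bdev (insert i I) S = bdev I S + (- p i * x i)"
    using assms by (auto simp: bdev_def bmean_def algebra_simps)
qed

lemma bern_bdev: "finite I \<Longrightarrow> bern p I (bdev I) = 0"
proof (induction I rule: finite_induct)
  case empty show ?case by (simp add: bdev_def bmean_def)
next
  case (insert i I)
  have "bern p (insert i I) (bdev (insert i I))
    = p i * bern p I (\<lambda>S. bdev I S + (1 - p i) * x i) + (1 - p i) * bern p I (\<lambda>S. bdev I S + (- p i * x i))"
    unfolding bern_insert[OF insert.hyps(1,2)]
    using insert by (intro arg_cong2[where f="(+)"] arg_cong2[where f="(*)"] bern_cong bdev_insert refl)
  then show ?case using insert by (simp only: bern_add bern_const) (simp add: algebra_simps)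
qed

lemma bern_bdev2: "finite I \<Longrightarrow> bern p I (\<lambda>S. (bdev I S)\<^sup>2) = bvar I"
proof (induction I rule: finite_induct)
  case empty show ?case by (simp add: bdev_def bmean_def bvar_def)
next
  case (insert i I)
  have exp: "bern p I (\<lambda>S. (bdev I S + a)\<^sup>2) = bvar I + a\<^sup>2" for a
  proof -
    have "bern p I (\<lambda>S. (bdev I S + a)\<^sup>2) = bern p I (\<lambda>S. (bdev I S)\<^sup>2 + (2 * a) * bdev I S + a\<^sup>2)"
      by (intro bern_cong) (simp add: power2_sum)
    then show ?thesis using insert by (simp add: bern_add bern_cmult bern_bdev)
  qed
  have "bern p (insert i I) (\<lambda>S. (bdev (insert i I) S)\<^sup>2)
    = p i * bern p I (\<lambda>S. (bdev I S + (1 - p i) * x i)\<^sup>2) + (1 - p i) * bern p I (\<lambda>S. (bdev I S + (- p i * x i))\<^sup>2)"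
    unfolding bern_insert[OF insert.hyps(1,2)] using insert
    by (intro arg_cong2[where f="(+)"] arg_cong2[where f="(*)"] bern_cong arg_cong[where f="\<lambda>z. z\<^sup>2"] bdev_insert refl)
  also have "\<dots> = bvar (insert i I)"
    unfolding exp using insert by (simp add: bvar_def power2_eq_square algebra_simps)
  finally show ?case .
qed

lemma bvar_nonneg: "(\<And>i. i \<in> I \<Longrightarrow> 0 \<le> p i \<and> p i \<le> 1) \<Longrightarrow> 0 \<le> bvar I"
  unfolding bvar_def by (intro sum_nonneg mult_nonneg_nonneg) auto

text \<open>A new index adds an independent centred summand, so all terms linear in one of the two
  centred variables drop out. The mixed term 6 v u is absorbed by passing from 3 v^2 to 3 (v + u)^2;
  3 is the Gaussian constant.\<close>

lemma bern_bdev4: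
  assumes "finite I" "\<And>i. i \<in> I \<Longrightarrow> 0 \<le> p i \<and> p i \<le> 1"
  shows "bern p I (\<lambda>S. (bdev I S)^4) \<le> 3 * (bvar I)\<^sup>2 + (\<Sum>i\<in>I. p i * (1 - p i) * (x i)^4)"
  using assms
proof (induction I rule: finite_induct)
  case empty show ?case by (simp add: bdev_def bmean_def bvar_def)
next
  case (insert i I)
  let ?p = "p i" and ?x = "x i" and ?v = "bvar I"
  have p: "0 \<le> ?p" "?p \<le> 1" using insert.prems by auto
  define m4 where "m4 = bern p I (\<lambda>S. (bdev I S)^4)"
  define m3 where "m3 = bern p I (\<lambda>S. (bdev I S)^3)"
  have exp: "bern p I (\<lambda>S. (bdev I S + a)^4) = m4 + 4 * a * m3 + 6 * a\<^sup>2 * ?v + a^4" for a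
  proof -
    have "bern p I (\<lambda>S. (bdev I S + a)^4) = bern p I (\<lambda>S. (bdev I S)^4 + (4 * a) * (bdev I S)^3
        + (6 * a\<^sup>2) * (bdev I S)\<^sup>2 + (4 * a^3) * bdev I S + a^4)"
      by (intro bern_cong) (simp add: power4_eq_xxxx power3_eq_cube power2_eq_square algebra_simps)
    then show ?thesis using insert
      by (simp add: bern_add bern_cmult bern_bdev bern_bdev2 m4_def m3_def)
  qed
  have "bern p (insert i I) (\<lambda>S. (bdev (insert i I) S)^4)
    = ?p * bern p I (\<lambda>S. (bdev I S + (1 - ?p) * ?x)^4) + (1 - ?p) * bern p I (\<lambda>S. (bdev I S + (- ?p * ?x))^4)"
    unfolding bern_insert[OF insert.hyps(1,2)] using insert
    by (intro arg_cong2[where f="(+)"] arg_cong2[where f="(*)"] bern_cong arg_cong[where f="\<lambda>z. z^4"] bdev_insert refl)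
  also have "\<dots> = m4 + 6 * ?v * (?p * (1 - ?p) * ?x\<^sup>2) + ?p * (1 - ?p) * ?x^4 * ((1 - ?p)^3 + ?p^3)"
    unfolding exp by (simp add: power4_eq_xxxx power3_eq_cube power2_eq_square algebra_simps)
  also have "\<dots> \<le> m4 + 6 * ?v * (?p * (1 - ?p) * ?x\<^sup>2) + ?p * (1 - ?p) * ?x^4 * 1"
  proof -
    have "(1 - ?p)^3 \<le> 1 - ?p" "?p^3 \<le> ?p"
      using p power_decreasing[of 1 3 "?p"] power_decreasing[of 1 3 "1 - ?p"] by auto
    then have "(1 - ?p)^3 + ?p^3 \<le> 1" by linarith
    then show ?thesis using p by (intro add_left_mono mult_left_mono) auto
  qed
  also have "\<dots> \<le> 3 * (bvar (insert i I))\<^sup>2 + (\<Sum>i\<in>insert i I. p i * (1 - p i) * (x i)^4)"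
  proof -
    let ?u = "?p * (1 - ?p) * ?x\<^sup>2"
    have "bvar (insert i I) = ?v + ?u" using insert by (simp add: bvar_def)
    moreover have "m4 \<le> 3 * ?v\<^sup>2 + (\<Sum>i\<in>I. p i * (1 - p i) * (x i)^4)"
      using insert unfolding m4_def by auto
    moreover have "3 * ?v\<^sup>2 + 6 * ?v * ?u \<le> 3 * (?v + ?u)\<^sup>2"
      by (simp add: power2_sum)
    moreover have "(\<Sum>i\<in>insert i I. p i * (1 - p i) * (x i)^4) = ?p * (1 - ?p) * ?x^4 + (\<Sum>i\<in>I. p i * (1 - p i) * (x i)^4)"
      using insert by simp
    ultimately show ?thesis by simp
  qed
  finally show ?case .
qed

text \<open>Paley--Zygmund, in the form of the pointwise bound
  \<open>Z \<le> a/4 + Z\<^sup>2/(128 a) + 32 a \<cdot> [a/4 \<le> Z]\<close> for the square \<open>Z\<close> of the sum.\<close>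
lemma bern_paley_zygmund:
  assumes fin: "finite I" and p: "\<And>i. i \<in> I \<Longrightarrow> 0 \<le> p i \<and> p i \<le> 1"
    and pos: "(bmean I)\<^sup>2 + bvar I > 0"
    and four: "(\<Sum>i\<in>I. p i * (1 - p i) * (x i)^4) \<le> 4 * ((bmean I)\<^sup>2 + bvar I)\<^sup>2"
  shows "1 / 128 \<le> bern p I (\<lambda>S. of_bool (((bmean I)\<^sup>2 + bvar I) / 4 \<le> (\<Sum>i\<in>S. x i)\<^sup>2))"
proof -
  let ?m = "bmean I" and ?v = "bvar I"
  define a where "a = ?m\<^sup>2 + ?v"
  have a: "a > 0" using pos a_def by simp
  define W where "W S = (\<Sum>i\<in>S. x i)" for S
  have v0: "0 \<le> ?v" using bvar_nonneg p by blast
  have Wd: "W S = bdev I S + ?m" for S by (simp add: W_def bdev_def)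
  have W2: "bern p I (\<lambda>S. (W S)\<^sup>2) = a"
  proof -
    have "bern p I (\<lambda>S. (W S)\<^sup>2) = bern p I (\<lambda>S. (bdev I S)\<^sup>2 + (2 * ?m) * bdev I S + ?m\<^sup>2)"
      by (intro bern_cong) (simp add: Wd power2_sum)
    then show ?thesis using fin by (simp add: bern_add bern_cmult bern_bdev bern_bdev2 a_def)
  qed
  have W4: "bern p I (\<lambda>S. (W S)^4) \<le> 64 * a\<^sup>2"
  proof -
    have sq: "(u + w)^4 \<le> 8 * u^4 + 8 * w^4" for u w :: real
    proof -
      have "(u + w)\<^sup>2 \<le> 2 * (u\<^sup>2 + w\<^sup>2)" using sum_squares_bound[of u w] by (simp add: power2_sum)
      then have "((u + w)\<^sup>2)\<^sup>2 \<le> (2 * (u\<^sup>2 + w\<^sup>2))\<^sup>2" by (intro power_mono) auto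
      also have "\<dots> = 4 * ((u\<^sup>2)\<^sup>2 + (w\<^sup>2)\<^sup>2 + 2 * u\<^sup>2 * w\<^sup>2)" by (simp add: power2_eq_square algebra_simps)
      also have "\<dots> \<le> 8 * (u\<^sup>2)\<^sup>2 + 8 * (w\<^sup>2)\<^sup>2" using sum_squares_bound[of "u\<^sup>2" "w\<^sup>2"] by simp
      finally show ?thesis by simp
    qed
    have "bern p I (\<lambda>S. (W S)^4) \<le> bern p I (\<lambda>S. 8 * (bdev I S)^4 + 8 * ?m^4)"
      using p by (intro bern_mono) (auto simp: Wd sq)
    also have "\<dots> = 8 * bern p I (\<lambda>S. (bdev I S)^4) + 8 * ?m^4"
      using fin by (simp add: bern_add bern_cmult)
    also have "\<dots> \<le> 8 * (3 * ?v\<^sup>2 + 4 * a\<^sup>2) + 8 * (?m\<^sup>2)\<^sup>2"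
      using bern_bdev4[OF fin p] four by (simp add: a_def)
    \<comment> \<open>Since v^2 + m^4 is at most a^2, the left side is at most 56 a^2; 64 is a round
      upper bound.\<close>
    also have "\<dots> \<le> 64 * a\<^sup>2"
    proof -
      have "a\<^sup>2 = (?m\<^sup>2)\<^sup>2 + ?v\<^sup>2 + 2 * (?m\<^sup>2 * ?v)" by (simp add: a_def power2_sum)
      moreover have "0 \<le> ?m\<^sup>2 * ?v" "0 \<le> ?v\<^sup>2" "0 \<le> (?m\<^sup>2)\<^sup>2" using v0 by simp_all
      moreover have "8 * (3 * ?v\<^sup>2 + 4 * a\<^sup>2) + 8 * (?m\<^sup>2)\<^sup>2 = 24 * ?v\<^sup>2 + 32 * a\<^sup>2 + 8 * (?m\<^sup>2)\<^sup>2" by simp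
      ultimately show ?thesis by linarith
    qed
    finally show ?thesis .
  qed
  define P where "P = bern p I (\<lambda>S. of_bool (a / 4 \<le> (W S)\<^sup>2))"
  have "a = bern p I (\<lambda>S. (W S)\<^sup>2)" by (simp add: W2)
  also have "\<dots> \<le> bern p I (\<lambda>S. a / 4 + (1 / (128 * a)) * (W S)^4 + (32 * a) * of_bool (a / 4 \<le> (W S)\<^sup>2))"
  proof (rule bern_mono[OF p])
    fix S
    let ?Z = "(W S)\<^sup>2"
    \<comment> \<open>Completing the square bounds \<open>Z\<close> where it is at least a/4. The
      factor 1/(128 a) lets a fourth moment of 64 a^2 contribute only a/2. Small values contribute
      a/4, so a/4 is left for the event, with coefficient 32 a; hence 1/128.\<close>
    have "0 \<le> (?Z - 64 * a)\<^sup>2 / (128 * a)" using a by simp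
    also have "\<dots> = ?Z\<^sup>2 / (128 * a) - ?Z + 32 * a"
      using a by (simp add: power2_eq_square field_simps)
    finally have "?Z \<le> (W S)^4 / (128 * a) + 32 * a" by simp
    moreover have "0 \<le> (W S)^4 / (128 * a)" using a by simp
    ultimately show "?Z \<le> a / 4 + (1 / (128 * a)) * (W S)^4 + (32 * a) * of_bool (a / 4 \<le> ?Z)"
    proof (cases "a / 4 \<le> ?Z")
      case True
      then have "of_bool (a / 4 \<le> ?Z) = (1::real)" by simp
      then show ?thesis using \<open>?Z \<le> (W S)^4 / (128 * a) + 32 * a\<close> a by simp
    next
      case False
      then have "of_bool (a / 4 \<le> ?Z) = (0::real)" by simp
      then show ?thesis using False \<open>0 \<le> (W S)^4 / (128 * a)\<close> by simp
    qed
  qed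
  also have "\<dots> = a / 4 + (1 / (128 * a)) * bern p I (\<lambda>S. (W S)^4) + 32 * a * P"
    unfolding P_def bern_add bern_cmult using fin by simp
  also have "\<dots> \<le> a / 4 + (1 / (128 * a)) * (64 * a\<^sup>2) + 32 * a * P"
    using W4 a by (intro add_mono mult_left_mono) auto
  also have "\<dots> = a * (3 / 4 + 32 * P)" using a by (simp add: power2_eq_square field_simps)
  finally have "1 / 128 \<le> P" using a by simp
  then show ?thesis by (simp add: P_def W_def a_def)
qed

lemma bern_chebyshev:
  assumes fin: "finite I" and p: "\<And>i. i \<in> I \<Longrightarrow> 0 \<le> p i \<and> p i \<le> 1" and K: "K > 0"
  shows "bern p I (\<lambda>S. of_bool (K < \<bar>(\<Sum>i\<in>S. x i) - bmean I\<bar>)) \<le> bvar I / K\<^sup>2"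
proof -
  have "bern p I (\<lambda>S. of_bool (K < \<bar>(\<Sum>i\<in>S. x i) - bmean I\<bar>)) \<le> bern p I (\<lambda>S. (1 / K\<^sup>2) * (bdev I S)\<^sup>2)"
  proof (rule bern_mono[OF p])
    fix S
    have "K < \<bar>bdev I S\<bar> \<Longrightarrow> K\<^sup>2 \<le> (bdev I S)\<^sup>2"
      using K power_mono[of K "\<bar>bdev I S\<bar>" 2] by simp
    then show "of_bool (K < \<bar>(\<Sum>i\<in>S. x i) - bmean I\<bar>) \<le> (1 / K\<^sup>2) * (bdev I S)\<^sup>2"
      using K by (auto simp: bdev_def field_simps)
  qed
  then show ?thesis unfolding bern_cmult bern_bdev2[OF fin] by simp
qed

end

text \<open>A Khinchine-type lower bound. With fair coins the variance is a quarter of the square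
  sum, so whatever the mean is, the second moment is at least 4 K^2, and Paley--Zygmund keeps a
  quarter of it. The fourth moment condition holds because the sum of the fourth powers is at most
  the square of the sum of squares.\<close>

lemma bern_half_square_function:
  fixes x :: "'i \<Rightarrow> real"
  assumes fin: "finite I" and K: "K > 0" and Q: "16 * K\<^sup>2 \<le> (\<Sum>i\<in>I. (x i)\<^sup>2)"
  shows "1 / 128 \<le> bern (\<lambda>_. 1/2) I (\<lambda>S. of_bool (K \<le> \<bar>\<Sum>i\<in>S. x i\<bar>))"
proof -
  let ?p = "\<lambda>_::'i. 1/2 :: real" and ?Q = "\<Sum>i\<in>I. (x i)\<^sup>2"
  have v: "bvar ?p x I = ?Q / 4" unfolding bvar_def by (simp add: sum_divide_distrib)
  have m: "0 \<le> (bmean ?p x I)\<^sup>2" by simp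
  have K2: "0 < K\<^sup>2" using K by simp
  let ?a = "(bmean ?p x I)\<^sup>2 + bvar ?p x I"
  have a1: "?Q / 4 \<le> ?a" using m unfolding v by linarith
  have "16 * k \<le> q \<Longrightarrow> q / 4 \<le> b \<Longrightarrow> k \<le> b / 4" for k q b :: real by linarith
  from this[OF Q a1] have a2: "K\<^sup>2 \<le> ?a / 4" .
  note a = a1 a2
  have "(\<Sum>i\<in>I. (x i)^4) \<le> (\<Sum>i\<in>I. (x i)\<^sup>2 * ?Q)"
  proof (intro sum_mono)
    fix i assume "i \<in> I"
    then have "(x i)\<^sup>2 \<le> ?Q" using fin by (intro member_le_sum) auto
    then have "(x i)\<^sup>2 * (x i)\<^sup>2 \<le> (x i)\<^sup>2 * ?Q" by (intro mult_left_mono) auto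
    then show "(x i)^4 \<le> (x i)\<^sup>2 * ?Q" by (simp add: power4_eq_xxxx power2_eq_square algebra_simps)
  qed
  also have "\<dots> = ?Q\<^sup>2" by (simp add: sum_distrib_right[symmetric] power2_eq_square)
  also have "\<dots> = 16 * (?Q / 4)\<^sup>2" by (simp add: power2_eq_square)
  also have "\<dots> \<le> 16 * ?a\<^sup>2" using a by (intro mult_left_mono power_mono) (auto intro: sum_nonneg)
  finally have four: "(\<Sum>i\<in>I. ?p i * (1 - ?p i) * (x i)^4) \<le> 4 * ?a\<^sup>2"
    by (simp add: sum_divide_distrib[symmetric])
  have "1 / 128 \<le> bern ?p I (\<lambda>S. of_bool (?a / 4 \<le> (\<Sum>i\<in>S. x i)\<^sup>2))"
  proof (intro bern_paley_zygmund fin four)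
    have "0 < k \<Longrightarrow> k \<le> b / 4 \<Longrightarrow> 0 < b" for k b :: real by linarith
    from this[OF K2 a2] show "0 < ?a" .
  qed auto
  also have "\<dots> \<le> bern ?p I (\<lambda>S. of_bool (K \<le> \<bar>\<Sum>i\<in>S. x i\<bar>))"
  proof (intro bern_mono)
    fix S
    have "K \<le> \<bar>\<Sum>i\<in>S. x i\<bar>" if "?a / 4 \<le> (\<Sum>i\<in>S. x i)\<^sup>2"
    proof -
      have "K\<^sup>2 \<le> \<bar>\<Sum>i\<in>S. x i\<bar>\<^sup>2" using order_trans[OF a2 that] by simp
      then show ?thesis by (rule power2_le_imp_le) simp
    qed
    then show "of_bool (?a / 4 \<le> (\<Sum>i\<in>S. x i)\<^sup>2) \<le> (of_bool (K \<le> \<bar>\<Sum>i\<in>S. x i\<bar>) :: real)"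
      by auto
  qed auto
  finally show ?thesis .
qed

text \<open>Thinning with probability \<open>t\<close> multiplies the mean by \<open>t\<close>. A
  total of at least 2/t thus leaves a mean of modulus at least 2 and a second moment of at least 4,
  a quarter of which is 1. The bound 1 on the summands controls the fourth powers by the
  variance.\<close>

lemma bern_sparse_sum:
  fixes x :: "'i \<Rightarrow> real"
  assumes fin: "finite I" and t: "0 < t" "t \<le> 1" and x: "\<And>i. i \<in> I \<Longrightarrow> \<bar>x i\<bar> \<le> 1"
    and L: "2 / t \<le> \<bar>\<Sum>i\<in>I. x i\<bar>"
  shows "1 / 128 \<le> bern (\<lambda>_. t) I (\<lambda>S. of_bool (1 \<le> \<bar>\<Sum>i\<in>S. x i\<bar>))"
proof -
  let ?p = "\<lambda>_::'i. t"
  let ?a = "(bmean ?p x I)\<^sup>2 + bvar ?p x I"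
  have v: "0 \<le> bvar ?p x I" by (rule bvar_nonneg) (use t in auto)
  have "2 \<le> t * \<bar>\<Sum>i\<in>I. x i\<bar>" using L t by (simp add: field_simps)
  also have "\<dots> = \<bar>bmean ?p x I\<bar>" using t by (simp add: bmean_def sum_distrib_left[symmetric] abs_mult)
  finally have "2\<^sup>2 \<le> \<bar>bmean ?p x I\<bar>\<^sup>2" by (intro power_mono) auto
  then have a: "4 \<le> ?a" using v by simp
  have "(\<Sum>i\<in>I. ?p i * (1 - ?p i) * (x i)^4) \<le> bvar ?p x I"
    unfolding bvar_def
  proof (intro sum_mono mult_left_mono)
    fix i assume "i \<in> I"
    then have "(x i)\<^sup>2 \<le> 1" using x[of i] by (simp add: abs_square_le_1)
    then have "(x i)\<^sup>2 * (x i)\<^sup>2 \<le> (x i)\<^sup>2 * 1" by (intro mult_left_mono) auto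
    then show "(x i)^4 \<le> (x i)\<^sup>2" by (simp add: power4_eq_xxxx power2_eq_square algebra_simps)
  qed (use t in auto)
  also have "\<dots> \<le> ?a * 1" by simp
  also have "\<dots> \<le> ?a * (4 * ?a)" 
  proof (intro mult_left_mono)
    have "4 \<le> b \<Longrightarrow> 1 \<le> 4 * b \<and> 0 \<le> b" for b :: real by linarith
    from this[OF a] show "1 \<le> 4 * ?a" "0 \<le> ?a" by blast+
  qed
  also have "\<dots> = 4 * ?a\<^sup>2" unfolding power2_eq_square[of ?a] by (rule mult.left_commute)
  finally have four: "(\<Sum>i\<in>I. ?p i * (1 - ?p i) * (x i)^4) \<le> 4 * ?a\<^sup>2" .
  have "1 / 128 \<le> bern ?p I (\<lambda>S. of_bool (?a / 4 \<le> (\<Sum>i\<in>S. x i)\<^sup>2))"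
  proof (intro bern_paley_zygmund fin four)
    have "4 \<le> b \<Longrightarrow> 0 < b" for b :: real by linarith
    from this[OF a] show "0 < ?a" .
  qed (use t in auto)
  also have "\<dots> \<le> bern ?p I (\<lambda>S. of_bool (1 \<le> \<bar>\<Sum>i\<in>S. x i\<bar>))"
  proof (intro bern_mono)
    fix S
    have "1 \<le> \<bar>\<Sum>i\<in>S. x i\<bar>" if "?a / 4 \<le> (\<Sum>i\<in>S. x i)\<^sup>2"
    proof -
      have "4 \<le> b \<Longrightarrow> b / 4 \<le> c \<Longrightarrow> 1 \<le> c" for b c :: real by linarith
      from this[OF a that] have "1\<^sup>2 \<le> \<bar>\<Sum>i\<in>S. x i\<bar>\<^sup>2" by simp
      then show ?thesis by (rule power2_le_imp_le) simp
    qed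
    then show "of_bool (?a / 4 \<le> (\<Sum>i\<in>S. x i)\<^sup>2) \<le> (of_bool (1 \<le> \<bar>\<Sum>i\<in>S. x i\<bar>) :: real)"
      by auto
  qed (use t in auto)
  finally show ?thesis .
qed

text \<open>Toggling a single index whose value is at least \<open>2 L\<close> moves the sum out of \<open>(-L, L)\<close>.\<close>
lemma bern_coin:
  assumes fin: "finite I" and i: "i \<in> I" "2 * L \<le> \<bar>x i :: real\<bar>"
  shows "1 / 2 \<le> bern (\<lambda>_. 1/2) I (\<lambda>S. of_bool (L \<le> \<bar>\<Sum>i\<in>S. x i\<bar>))"
proof -
  define J where "J = I - {i}"
  have J: "I = insert i J" "finite J" "i \<notin> J" using i fin by (auto simp: J_def)
  let ?W = "\<lambda>S. \<Sum>i\<in>S. x i"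
  have "(1::real) = bern (\<lambda>_. 1/2) J (\<lambda>_. 1)" using J by simp
  also have "\<dots> \<le> bern (\<lambda>_. 1/2) J (\<lambda>S. of_bool (L \<le> \<bar>?W (insert i S)\<bar>) + of_bool (L \<le> \<bar>?W S\<bar>))"
  proof (intro bern_mono)
    fix S assume "S \<subseteq> J"
    then have "?W (insert i S) = x i + ?W S" using J by (intro sum.insert) (auto dest: finite_subset)
    then have "L \<le> \<bar>?W (insert i S)\<bar> \<or> L \<le> \<bar>?W S\<bar>" using i by linarith
    then show "(1::real) \<le> of_bool (L \<le> \<bar>?W (insert i S)\<bar>) + of_bool (L \<le> \<bar>?W S\<bar>)" by auto
  qed auto
  finally show ?thesis unfolding J(1) bern_insert[OF J(2,3)] bern_add by simp
qed

text \<open>Fubini for a finite average: pointwise lower bounds for the fraction of sets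
  \<open>S\<close> with \<open>w\<close> in \<open>A S\<close> integrate to a lower bound for the
  average probability. Together with \<open>ex_ge_bern\<close> this gives one \<open>S\<close> that
  works.\<close>

lemma (in prob_space) bern_prob_ge:
  assumes fin: "finite I" and p: "\<And>i. i \<in> I \<Longrightarrow> 0 \<le> p i \<and> p i \<le> 1"
    and A: "\<And>S. S \<subseteq> I \<Longrightarrow> A S \<in> events" and G: "G \<in> events" and th: "0 \<le> \<theta>"
    and ge: "AE w in M. w \<in> G \<longrightarrow> \<theta> \<le> bern p I (\<lambda>S. indicator (A S) w)"
  shows "\<theta> * prob G \<le> bern p I (\<lambda>S. prob (A S))"
proof -
  have "\<theta> * prob G = (\<integral>w. \<theta> * indicator G w \<partial>M)" using G by simp
  also have "\<dots> \<le> (\<integral>w. bern p I (\<lambda>S. indicator (A S) w) \<partial>M)"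
  proof (intro integral_mono_AE)
    show "integrable M (\<lambda>w. bern p I (\<lambda>S. indicator (A S) w))"
      unfolding bern_def using A
      by (intro Bochner_Integration.integrable_sum integrable_mult_right integrable_real_indicator)
        (auto simp: emeasure_eq_measure)
    show "AE w in M. \<theta> * indicator G w \<le> bern p I (\<lambda>S. indicator (A S) w)"
      using ge
    proof eventually_elim
      case (elim w)
      have "0 \<le> bern p I (\<lambda>S. indicator (A S) w)"
        using bern_mono[of I p "\<lambda>_. 0" "\<lambda>S. indicator (A S) w"] p fin by simp
      then show ?case using elim by (auto simp: indicator_def)
    qed
  qed (use G in \<open>auto simp: emeasure_eq_measure\<close>)
  also have "\<dots> = bern p I (\<lambda>S. prob (A S))"
    unfolding bern_def using A
  proof (subst Bochner_Integration.integral_sum)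
    fix S assume "S \<in> Pow I"
    then show "integrable M (\<lambda>w. (\<Prod>i\<in>S. p i) * (\<Prod>i\<in>I - S. 1 - p i) * indicator (A S) w)"
      using A by (intro integrable_mult_right integrable_real_indicator) (auto simp: emeasure_eq_measure)
  qed (use A in \<open>auto intro!: sum.cong\<close>)
  finally show ?thesis .
qed

section \<open>Boundedness of the range of an exhaustive charge\<close>

text \<open>Greedy exhaustion. Each step adds a disjoint member with at least half of the largest
  probability still available. The probabilities added tend to 0, so nothing of positive probability
  is left over. Only finite disjoint unions are formed inside the class, which matters because
  boundedness with one constant is not preserved by countable unions.\<close>

lemma (in prob_space) exhausting_sequence:
  assumes ev: "\<C> \<subseteq> events" and emp: "{} \<in> \<C>"
    and un: "\<And>A B. A \<in> \<C> \<Longrightarrow> B \<in> \<C> \<Longrightarrow> A \<inter> B = {} \<Longrightarrow> A \<union> B \<in> \<C>"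
  obtains C :: "nat \<Rightarrow> 'a set" where "incseq C" "\<And>n. C n \<in> \<C>"
    "\<And>D. D \<in> \<C> \<Longrightarrow> D \<inter> (\<Union>n. C n) = {} \<Longrightarrow> prob D = 0"
proof -
  define best where "best A D \<longleftrightarrow> D \<in> \<C> \<and> D \<inter> A = {} \<and> (\<forall>D'\<in>\<C>. D' \<inter> A = {} \<longrightarrow> prob D' \<le> 2 * prob D)" for A D
  have ex: "\<exists>D. best A D" for A
  proof (cases "\<exists>D\<in>\<C>. D \<inter> A = {} \<and> prob D > 0")
    case False
    then have "best A {}" unfolding best_def using emp by (auto simp: not_less)
    then show ?thesis ..
  next
    case True
    then obtain D0 where D0: "D0 \<in> \<C>" "D0 \<inter> A = {}" "prob D0 > 0" by blast
    let ?X = "prob ` {D \<in> \<C>. D \<inter> A = {}}"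
    have bdd: "bdd_above ?X" by (rule bdd_aboveI[of _ 1]) auto
    have "prob D0 \<le> Sup ?X" using D0 bdd by (intro cSup_upper) auto
    \<comment> \<open>The supremum need not be attained, so the greedy choice settles for more than
      half of it.\<close>
    then have "Sup ?X / 2 < Sup ?X" using D0 by linarith
    then obtain D where D: "D \<in> \<C>" "D \<inter> A = {}" "Sup ?X / 2 < prob D"
      using D0 bdd by (subst (asm) less_cSup_iff) auto
    have "prob D' \<le> 2 * prob D" if "D' \<in> \<C>" "D' \<inter> A = {}" for D'
    proof -
      have "prob D' \<le> Sup ?X" using that bdd by (intro cSup_upper) auto
      then show ?thesis using D by linarith
    qed
    then show ?thesis using D by (auto simp: best_def)
  qed
  define pick where "pick A = (SOME D. best A D)" for A
  have pick: "best A (pick A)" for A unfolding pick_def by (rule someI_ex[OF ex])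
  define C where "C = rec_nat {} (\<lambda>_ A. A \<union> pick A)"
  have C0: "C 0 = {}" and CS: "C (Suc n) = C n \<union> pick (C n)" for n by (auto simp: C_def)
  have CC: "C n \<in> \<C>" for n
  proof (induction n)
    case (Suc n)
    then show ?case unfolding CS using pick[of "C n"] by (intro un) (auto simp: best_def)
  qed (simp add: C0 emp)
  have inc: "incseq C" by (rule incseq_SucI) (auto simp: CS)
  have pr: "prob (C (Suc n)) = prob (C n) + prob (pick (C n))" for n
    unfolding CS using pick[of "C n"] CC[of n] ev
    by (intro finite_measure_Union) (auto simp: best_def)
  have lim: "(\<lambda>n. prob (C n)) \<longlonglongrightarrow> prob (\<Union>n. C n)"
    using CC ev inc by (intro finite_Lim_measure_incseq) auto
  have "(\<lambda>n. prob (C (Suc n)) - prob (C n)) \<longlonglongrightarrow> 0"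
    using tendsto_diff[OF LIMSEQ_Suc[OF lim] lim] by simp
  then have p0: "(\<lambda>n. 2 * prob (pick (C n))) \<longlonglongrightarrow> 0" unfolding pr using tendsto_mult_right_zero by auto
  show ?thesis
  proof (rule that[OF inc CC])
    fix D assume D: "D \<in> \<C>" "D \<inter> (\<Union>n. C n) = {}"
    have "prob D \<le> 2 * prob (pick (C n))" for n
    proof -
      have "D \<inter> C n = {}" using D(2) by blast
      then show ?thesis using pick[of "C n"] D(1) unfolding best_def by blast
    qed
    then have "prob D \<le> 0" by (intro LIMSEQ_le_const[OF p0]) blast
    then show "prob D = 0" using measure_nonneg[of M D] by linarith
  qed
qed

section \<open>Additive set functions with values in L0\<close>

text \<open>Additivity holds only almost surely, with a null set depending on the pair of sets.
  Identities are therefore applied to finite families, whose null sets can be united.\<close>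

locale L0_charge = prob_space M + algebra X R for M :: "'w measure" and X :: "'x set" and R +
  fixes \<mu> :: "'x set \<Rightarrow> 'w \<Rightarrow> real"
  assumes measurable [measurable]: "A \<in> R \<Longrightarrow> \<mu> A \<in> borel_measurable M"
    and additive: "A \<in> R \<Longrightarrow> B \<in> R \<Longrightarrow> A \<inter> B = {} \<Longrightarrow> AE w in M. \<mu> (A \<union> B) w = \<mu> A w + \<mu> B w"
begin

definition big :: "'x set \<Rightarrow> real \<Rightarrow> 'w set" where
  "big A K = {w \<in> space M. K \<le> \<bar>\<mu> A w\<bar>}"

lemma big_events [measurable, simp]: "A \<in> R \<Longrightarrow> big A K \<in> events"
  unfolding big_def by measurable

lemma big_antimono: "K \<le> K' \<Longrightarrow> big A K' \<subseteq> big A K"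
  by (auto simp: big_def)

lemma tight1:
  assumes A: "A \<in> R" and e: "e > 0"
  obtains K where "prob (big A K) \<le> e"
proof -
  have "(\<lambda>n::nat. prob (big A (real n))) \<longlonglongrightarrow> prob (\<Inter>n::nat. big A (real n))"
    using A by (intro finite_Lim_measure_decseq) (auto simp: decseq_def big_def)
  moreover have "(\<Inter>n::nat. big A (real n)) = {}"
  proof -
    have "\<exists>n::nat. \<not> real n \<le> \<bar>\<mu> A w\<bar>" for w
      using reals_Archimedean2[of "\<bar>\<mu> A w\<bar>"] by (auto simp: not_le)
    then show ?thesis by (auto simp: big_def)
  qed
  ultimately have "(\<lambda>n::nat. prob (big A (real n))) \<longlonglongrightarrow> 0" by simp
  then have "eventually (\<lambda>n. prob (big A (real n)) < e) sequentially"
    using e by (rule order_tendstoD)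
  then show ?thesis using that by (auto simp: eventually_sequentially intro: less_imp_le)
qed

lemma mu_empty: "AE w in M. \<mu> {} w = 0"
  using additive[of "{}" "{}"] by simp

text \<open>A finite family has finitely many subfamilies, so one null set serves all
  \<open>S\<close> at once. Averaging over \<open>S\<close> at a fixed sample point requires exactly
  this.\<close>

lemma additive_family:
  assumes fin: "finite I" and A: "\<And>i. i \<in> I \<Longrightarrow> A i \<in> R" and d: "disjoint_family_on A I"
  shows "AE w in M. \<forall>S\<subseteq>I. \<mu> (\<Union>i\<in>S. A i) w = (\<Sum>i\<in>S. \<mu> (A i) w)"
proof -
  have "AE w in M. \<mu> (\<Union>i\<in>S. A i) w = (\<Sum>i\<in>S. \<mu> (A i) w)" if "S \<subseteq> I" for S
  proof -
    have "finite S" using fin that finite_subset by blast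
    then show ?thesis using that
    proof (induction S rule: finite_induct)
      case empty then show ?case using mu_empty by simp
    next
      case (insert i S)
      have "AE w in M. \<mu> (A i \<union> (\<Union>i\<in>S. A i)) w = \<mu> (A i) w + \<mu> (\<Union>i\<in>S. A i) w"
      proof (rule additive)
        show "(\<Union>i\<in>S. A i) \<in> R" using insert A by (intro finite_UN) auto
        show "A i \<inter> (\<Union>i\<in>S. A i) = {}" using insert d by (fastforce simp: disjoint_family_on_def)
      qed (use insert A in auto)
      moreover have "AE w in M. \<mu> (\<Union>i\<in>S. A i) w = (\<Sum>i\<in>S. \<mu> (A i) w)" using insert by auto
      ultimately show ?case by eventually_elim (use insert in simp)
    qed
  qed
  then have "AE w in M. \<forall>S\<in>Pow I. \<mu> (\<Union>i\<in>S. A i) w = (\<Sum>i\<in>S. \<mu> (A i) w)"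
    using fin by (subst AE_ball_countable) (auto intro: countable_finite)
  then show ?thesis by eventually_elim auto
qed

text \<open>Boundedness in \<open>L0\<close>, that is, tightness uniform in the set, localized to an
  event: the range may be bounded over one part of the sample space and unbounded over
  another.\<close>

definition bounded_on :: "'x set \<Rightarrow> 'w set \<Rightarrow> bool" where
  "bounded_on E V \<longleftrightarrow> (\<forall>e>0. \<exists>K. \<forall>B\<in>R. B \<subseteq> E \<longrightarrow> prob (V \<inter> big B K) \<le> e)"

text \<open>The number \<open>m\<close> of sets must not depend on the level \<open>K\<close>: the algebra generated by \<open>m\<close> sets has
  at most \<open>2 ^ m\<close> atoms, so one of the atoms is as large as \<open>K / 2 ^ m\<close>.\<close>
definition unbounded_on :: "'x set \<Rightarrow> 'w set \<Rightarrow> bool" where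
  "unbounded_on E V \<longleftrightarrow> V \<in> events \<and> (\<forall>e>0. \<exists>m::nat. \<forall>K. \<exists>F. finite F \<and> card F \<le> m \<and> F \<subseteq> R \<and>
     (\<forall>B\<in>F. B \<subseteq> E) \<and> prob (V - (\<Union>B\<in>F. big B K)) \<le> e)"

lemma unbounded_on_events: "unbounded_on E V \<Longrightarrow> V \<in> events"
  by (simp add: unbounded_on_def)

lemma UN_big_events [simp]: "finite F \<Longrightarrow> F \<subseteq> R \<Longrightarrow> (\<Union>B\<in>F. big B K) \<in> events"
  by (intro sets.finite_UN) auto

lemma unbounded_on_mono:
  assumes "unbounded_on E V" "V' \<subseteq> V" "V' \<in> events" "E \<subseteq> E'"
  shows "unbounded_on E' V'"
  unfolding unbounded_on_def
proof (intro conjI allI impI)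
  fix e :: real assume "e > 0"
  then obtain m where m: "\<forall>K. \<exists>F. finite F \<and> card F \<le> m \<and> F \<subseteq> R \<and>
     (\<forall>B\<in>F. B \<subseteq> E) \<and> prob (V - (\<Union>B\<in>F. big B K)) \<le> e"
    using assms(1) unfolding unbounded_on_def by blast
  show "\<exists>m. \<forall>K. \<exists>F. finite F \<and> card F \<le> m \<and> F \<subseteq> R \<and>
     (\<forall>B\<in>F. B \<subseteq> E') \<and> prob (V' - (\<Union>B\<in>F. big B K)) \<le> e"
  proof (intro exI[of _ m] allI)
    fix K
    obtain F where F: "finite F" "card F \<le> m" "F \<subseteq> R" "\<forall>B\<in>F. B \<subseteq> E"
      "prob (V - (\<Union>B\<in>F. big B K)) \<le> e" using m by blast
    have "prob (V' - (\<Union>B\<in>F. big B K)) \<le> prob (V - (\<Union>B\<in>F. big B K))"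
      using assms F unbounded_on_events by (intro finite_measure_mono) auto
    then show "\<exists>F. finite F \<and> card F \<le> m \<and> F \<subseteq> R \<and> (\<forall>B\<in>F. B \<subseteq> E') \<and> prob (V' - (\<Union>B\<in>F. big B K)) \<le> e"
      using F assms(4) by (intro exI[of _ F]) auto
  qed
qed fact

lemma unbounded_on_empty: "unbounded_on E {}"
  unfolding unbounded_on_def by (auto intro!: exI[of _ "{}"])

lemma unbounded_on_Un:
  assumes "unbounded_on E V1" "unbounded_on E V2"
  shows "unbounded_on E (V1 \<union> V2)"
  unfolding unbounded_on_def
proof (intro conjI allI impI)
  show "V1 \<union> V2 \<in> events" using assms unbounded_on_events by auto
  fix e :: real assume e: "e > 0"
  then have e2: "e / 2 > 0" by simp
  obtain m1 where m1: "\<forall>K. \<exists>F. finite F \<and> card F \<le> m1 \<and> F \<subseteq> R \<and>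
     (\<forall>B\<in>F. B \<subseteq> E) \<and> prob (V1 - (\<Union>B\<in>F. big B K)) \<le> e / 2"
    using assms(1) e2 unfolding unbounded_on_def by blast
  obtain m2 where m2: "\<forall>K. \<exists>F. finite F \<and> card F \<le> m2 \<and> F \<subseteq> R \<and>
     (\<forall>B\<in>F. B \<subseteq> E) \<and> prob (V2 - (\<Union>B\<in>F. big B K)) \<le> e / 2"
    using assms(2) e2 unfolding unbounded_on_def by blast
  show "\<exists>m. \<forall>K. \<exists>F. finite F \<and> card F \<le> m \<and> F \<subseteq> R \<and>
     (\<forall>B\<in>F. B \<subseteq> E) \<and> prob (V1 \<union> V2 - (\<Union>B\<in>F. big B K)) \<le> e"
  proof (intro exI[of _ "m1 + m2"] allI)
    fix K
    obtain F1 where F1: "finite F1" "card F1 \<le> m1" "F1 \<subseteq> R" "\<forall>B\<in>F1. B \<subseteq> E"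
      "prob (V1 - (\<Union>B\<in>F1. big B K)) \<le> e / 2" using m1 by blast
    obtain F2 where F2: "finite F2" "card F2 \<le> m2" "F2 \<subseteq> R" "\<forall>B\<in>F2. B \<subseteq> E"
      "prob (V2 - (\<Union>B\<in>F2. big B K)) \<le> e / 2" using m2 by blast
    have V: "V1 \<in> events" "V2 \<in> events" using assms unbounded_on_events by auto
    have "prob (V1 \<union> V2 - (\<Union>B\<in>F1 \<union> F2. big B K))
      \<le> prob ((V1 - (\<Union>B\<in>F1. big B K)) \<union> (V2 - (\<Union>B\<in>F2. big B K)))"
      using F1 F2 V by (intro finite_measure_mono sets.Un sets.Diff) auto
    also have "\<dots> \<le> prob (V1 - (\<Union>B\<in>F1. big B K)) + prob (V2 - (\<Union>B\<in>F2. big B K))"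
      using F1 F2 V by (intro measure_Un_le sets.Diff) auto
    also have "\<dots> \<le> e" using F1 F2 by simp
    finally show "\<exists>F. finite F \<and> card F \<le> m1 + m2 \<and> F \<subseteq> R \<and> (\<forall>B\<in>F. B \<subseteq> E) \<and>
       prob (V1 \<union> V2 - (\<Union>B\<in>F. big B K)) \<le> e"
      using F1 F2 card_Un_le[of F1 F2] by (intro exI[of _ "F1 \<union> F2"]) auto
  qed
qed

lemma unbounded_on_UN:
  assumes "finite I" "\<And>i. i \<in> I \<Longrightarrow> unbounded_on E (V i)"
  shows "unbounded_on E (\<Union>i\<in>I. V i)"
  using assms by (induction I rule: finite_induct) (auto intro: unbounded_on_Un unbounded_on_empty)

lemma unbounded_on_incseq:
  assumes "incseq C" "\<And>n. unbounded_on E (C n)"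
  shows "unbounded_on E (\<Union>n::nat. C n)"
  unfolding unbounded_on_def
proof (intro conjI allI impI)
  have Cev: "C n \<in> events" for n using assms unbounded_on_events by auto
  then show U: "(\<Union>n. C n) \<in> events" by auto
  fix e :: real assume e: "e > 0"
  then have e2: "e / 2 > 0" by simp
  have "(\<lambda>n. prob (C n)) \<longlonglongrightarrow> prob (\<Union>n. C n)"
    using Cev assms(1) by (intro finite_Lim_measure_incseq) auto
  then have "eventually (\<lambda>n. prob (C n) > prob (\<Union>n. C n) - e / 2) sequentially"
    using e2 by (intro order_tendstoD) auto
  then obtain n where n: "prob (C n) > prob (\<Union>n. C n) - e / 2" by (auto simp: eventually_sequentially)
  obtain m where m: "\<forall>K. \<exists>F. finite F \<and> card F \<le> m \<and> F \<subseteq> R \<and>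
     (\<forall>B\<in>F. B \<subseteq> E) \<and> prob (C n - (\<Union>B\<in>F. big B K)) \<le> e / 2"
    using assms(2)[of n] e2 unfolding unbounded_on_def by blast
  show "\<exists>m. \<forall>K. \<exists>F. finite F \<and> card F \<le> m \<and> F \<subseteq> R \<and>
     (\<forall>B\<in>F. B \<subseteq> E) \<and> prob ((\<Union>n. C n) - (\<Union>B\<in>F. big B K)) \<le> e"
  proof (intro exI[of _ m] allI)
    fix K
    obtain F where F: "finite F" "card F \<le> m" "F \<subseteq> R" "\<forall>B\<in>F. B \<subseteq> E"
      "prob (C n - (\<Union>B\<in>F. big B K)) \<le> e / 2" using m by blast
    have "prob ((\<Union>n. C n) - (\<Union>B\<in>F. big B K))
      \<le> prob (((\<Union>n. C n) - C n) \<union> (C n - (\<Union>B\<in>F. big B K)))"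
      using F Cev U by (intro finite_measure_mono sets.Un sets.Diff) auto
    also have "\<dots> \<le> prob ((\<Union>n. C n) - C n) + prob (C n - (\<Union>B\<in>F. big B K))"
      using F Cev U by (intro measure_Un_le) auto
    also have "prob ((\<Union>n. C n) - C n) = prob (\<Union>n. C n) - prob (C n)"
      using Cev U by (intro finite_measure_Diff) auto
    finally show "\<exists>F. finite F \<and> card F \<le> m \<and> F \<subseteq> R \<and> (\<forall>B\<in>F. B \<subseteq> E) \<and>
       prob ((\<Union>n. C n) - (\<Union>B\<in>F. big B K)) \<le> e"
      using F n by (intro exI[of _ "F"]) auto
  qed
qed

text \<open>Greedy covering: every new set covers more than the fraction \<delta> of what is still
  uncovered, so \<open>m\<close> sets leave at most (1 - \<delta>)^m. This number of sets depends on
  \<delta> and \<open>e\<close> but not on \<open>K\<close>.\<close>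

lemma unbounded_onI:
  assumes W: "W \<in> events" and \<delta>: "0 < \<delta>" "\<delta> \<le> 1"
    and ex: "\<And>V K. V \<subseteq> W \<Longrightarrow> V \<in> events \<Longrightarrow> prob V > 0 \<Longrightarrow> \<exists>A\<in>R. A \<subseteq> E \<and> \<delta> * prob V < prob (V \<inter> big A K)"
  shows "unbounded_on E W"
  unfolding unbounded_on_def
proof (intro conjI allI impI W)
  fix e :: real assume e: "e > 0"
  have "(\<lambda>m. (1 - \<delta>) ^ m) \<longlonglongrightarrow> 0" using \<delta> by (intro LIMSEQ_realpow_zero) auto
  then have "eventually (\<lambda>m. (1 - \<delta>) ^ m < e) sequentially" using e by (rule order_tendstoD)
  then obtain m where m: "(1 - \<delta>) ^ m < e" by (auto simp: eventually_sequentially)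
  show "\<exists>m. \<forall>K. \<exists>F. finite F \<and> card F \<le> m \<and> F \<subseteq> R \<and>
     (\<forall>B\<in>F. B \<subseteq> E) \<and> prob (W - (\<Union>B\<in>F. big B K)) \<le> e"
  proof (intro exI[of _ m] allI)
    fix K
    have "\<exists>F. finite F \<and> card F \<le> n \<and> F \<subseteq> R \<and> (\<forall>B\<in>F. B \<subseteq> E) \<and>
       prob (W - (\<Union>B\<in>F. big B K)) \<le> (1 - \<delta>) ^ n" for n
    proof (induction n)
      case 0
      then show ?case by (intro exI[of _ "{}"]) auto
    next
      case (Suc n)
      then obtain F where F: "finite F" "card F \<le> n" "F \<subseteq> R" "\<forall>B\<in>F. B \<subseteq> E"
        "prob (W - (\<Union>B\<in>F. big B K)) \<le> (1 - \<delta>) ^ n" by blast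
      let ?V = "W - (\<Union>B\<in>F. big B K)"
      have Vev: "?V \<in> events" using F W by auto
      show ?case
      proof (cases "prob ?V > 0")
        case False
        then have "prob ?V \<le> (1 - \<delta>) ^ Suc n" using \<delta> zero_le_power[of "1 - \<delta>" "Suc n"] by linarith
        then show ?thesis using F by (intro exI[of _ F]) auto
      next
        case True
        then obtain A where A: "A \<in> R" "A \<subseteq> E" "\<delta> * prob ?V < prob (?V \<inter> big A K)"
          using ex[of ?V K] Vev by auto
        have "W - (\<Union>B\<in>insert A F. big B K) = ?V - (?V \<inter> big A K)" by auto
        then have "prob (W - (\<Union>B\<in>insert A F. big B K)) = prob ?V - prob (?V \<inter> big A K)"
          using Vev A by (simp add: finite_measure_Diff del: Diff_Diff_Int)
        also have "\<dots> \<le> (1 - \<delta>) * prob ?V" using A by (simp add: algebra_simps)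
        also have "\<dots> \<le> (1 - \<delta>) * (1 - \<delta>) ^ n" using F \<delta> by (intro mult_left_mono) auto
        finally have "prob (W - (\<Union>B\<in>insert A F. big B K)) \<le> (1 - \<delta>) ^ Suc n" by simp
        moreover have "card (insert A F) \<le> Suc n" using F card_insert_le_m1[of "Suc n" F A] by auto
        ultimately show ?thesis using F A by (intro exI[of _ "insert A F"]) auto
      qed
    qed
    from this[of m] m show "\<exists>F. finite F \<and> card F \<le> m \<and> F \<subseteq> R \<and> (\<forall>B\<in>F. B \<subseteq> E) \<and>
       prob (W - (\<Union>B\<in>F. big B K)) \<le> e" by (meson less_imp_le order_trans)
  qed
qed

text \<open>Exhaust \<open>W\<close> by events on which, for some \<open>K\<close>, no set captures
  more than the fraction \<delta>. No event of positive probability in the remainder has this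
  property, so the remainder is unbounded by \<open>unbounded_onI\<close> and null by assumption.
  One member of the exhausting sequence then fills \<open>W\<close> up to e/2, and its
  \<open>K\<close> costs at most \<delta> \<le> e/2 more.\<close>

lemma bounded_onI:
  assumes W: "W \<in> events"
    and null: "\<And>V. V \<subseteq> W \<Longrightarrow> unbounded_on E V \<Longrightarrow> prob V = 0"
  shows "bounded_on E W"
  unfolding bounded_on_def
proof (intro allI impI)
  fix e :: real assume e: "e > 0"
  define \<delta> where "\<delta> = min (e / 2) 1"
  have \<delta>: "0 < \<delta>" "\<delta> \<le> 1" "\<delta> \<le> e / 2" using e by (auto simp: \<delta>_def)
  define \<C> where "\<C> = {V \<in> events. V \<subseteq> W \<and> (\<exists>K. \<forall>A\<in>R. A \<subseteq> E \<longrightarrow> prob (V \<inter> big A K) \<le> \<delta> * prob V)}"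
  obtain C where C: "incseq C" "\<And>n. C n \<in> \<C>"
    "\<And>D. D \<in> \<C> \<Longrightarrow> D \<inter> (\<Union>n. C n) = {} \<Longrightarrow> prob D = 0"
  proof (rule exhausting_sequence[of \<C>])
    show "\<C> \<subseteq> events" "{} \<in> \<C>" by (auto simp: \<C>_def)
    fix V1 V2 assume V: "V1 \<in> \<C>" "V2 \<in> \<C>" "V1 \<inter> V2 = {}"
    then obtain K1 K2 where K: "\<forall>A\<in>R. A \<subseteq> E \<longrightarrow> prob (V1 \<inter> big A K1) \<le> \<delta> * prob V1"
      "\<forall>A\<in>R. A \<subseteq> E \<longrightarrow> prob (V2 \<inter> big A K2) \<le> \<delta> * prob V2" by (auto simp: \<C>_def)
    have ev: "V1 \<in> events" "V2 \<in> events" using V by (auto simp: \<C>_def)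
    have "prob ((V1 \<union> V2) \<inter> big A (max K1 K2)) \<le> \<delta> * prob (V1 \<union> V2)" if A: "A \<in> R" "A \<subseteq> E" for A
    proof -
      have "prob ((V1 \<union> V2) \<inter> big A (max K1 K2)) \<le> prob ((V1 \<inter> big A K1) \<union> (V2 \<inter> big A K2))"
        using ev A by (intro finite_measure_mono) (auto simp: big_def)
      also have "\<dots> \<le> prob (V1 \<inter> big A K1) + prob (V2 \<inter> big A K2)"
        using ev A by (intro measure_Un_le) auto
      also have "\<dots> \<le> \<delta> * prob V1 + \<delta> * prob V2" using K A by (intro add_mono) auto
      also have "\<dots> = \<delta> * prob (V1 \<union> V2)"
        using finite_measure_Union[OF ev V(3)] by (simp add: algebra_simps)
      finally show ?thesis .
    qed
    then show "V1 \<union> V2 \<in> \<C>" using V ev by (auto simp: \<C>_def intro!: exI[of _ "max K1 K2"])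
  qed blast
  let ?U = "\<Union>n. C n"
  have Cev: "C n \<in> events" "C n \<subseteq> W" for n using C(2)[of n] by (auto simp: \<C>_def)
  then have Uev: "?U \<in> events" by auto
  have "unbounded_on E (W - ?U)"
  proof (rule unbounded_onI[OF _ \<delta>(1,2)])
    show "W - ?U \<in> events" using W Uev by auto
    fix V K assume V: "V \<subseteq> W - ?U" "V \<in> events" "0 < prob V"
    show "\<exists>A\<in>R. A \<subseteq> E \<and> \<delta> * prob V < prob (V \<inter> big A K)"
    proof (rule ccontr)
      assume "\<not> ?thesis"
      then have "V \<in> \<C>" using V by (auto simp: \<C>_def not_less)
      then have "prob V = 0" using V by (intro C(3)) auto
      then show False using V by simp
    qed
  qed
  then have rest: "prob (W - ?U) = 0" by (intro null) auto
  have "(\<lambda>n. prob (C n)) \<longlonglongrightarrow> prob ?U"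
    using Cev C(1) by (intro finite_Lim_measure_incseq) auto
  then have "eventually (\<lambda>n. prob (C n) > prob ?U - e / 2) sequentially"
    using e by (intro order_tendstoD) auto
  then obtain n where n: "prob (C n) > prob ?U - e / 2" by (auto simp: eventually_sequentially)
  obtain K where K: "\<forall>A\<in>R. A \<subseteq> E \<longrightarrow> prob (C n \<inter> big A K) \<le> \<delta> * prob (C n)"
    using C(2)[of n] by (auto simp: \<C>_def)
  show "\<exists>K. \<forall>B\<in>R. B \<subseteq> E \<longrightarrow> prob (W \<inter> big B K) \<le> e"
  proof (intro exI[of _ K] ballI impI)
    fix A assume A: "A \<in> R" "A \<subseteq> E"
    have "prob (W \<inter> big A K) \<le> prob ((W - ?U) \<union> ((?U - C n) \<union> (C n \<inter> big A K)))"
      using W A Uev Cev by (intro finite_measure_mono sets.Un sets.Diff sets.Int) auto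
    also have "\<dots> \<le> prob (W - ?U) + prob ((?U - C n) \<union> (C n \<inter> big A K))"
      using W A Uev Cev by (intro measure_Un_le sets.Un sets.Diff sets.Int) auto
    also have "prob ((?U - C n) \<union> (C n \<inter> big A K)) \<le> prob (?U - C n) + prob (C n \<inter> big A K)"
      using W A Uev Cev by (intro measure_Un_le sets.Un sets.Diff sets.Int) auto
    also have "prob (?U - C n) = prob ?U - prob (C n)"
      using Cev Uev by (intro finite_measure_Diff) auto
    also have "prob (C n \<inter> big A K) \<le> e / 2"
    proof -
      have "\<delta> * prob (C n) \<le> \<delta> * 1" using \<delta> by (intro mult_left_mono) auto
      moreover have "prob (C n \<inter> big A K) \<le> \<delta> * prob (C n)" using K A by blast
      ultimately show ?thesis using \<delta>(3) by linarith
    qed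
    finally show "prob (W \<inter> big A K) \<le> e" using rest n by simp
  qed
qed

text \<open>An essentially largest unbounded part exists by exhaustion; outside it every unbounded
  event is null, so \<open>bounded_onI\<close> applies.\<close>

lemma bounded_unbounded_decomposition:
  assumes V: "V \<in> events"
  obtains V1 where "V1 \<subseteq> V" "unbounded_on E V1" "bounded_on E (V - V1)"
proof -
  define \<C> where "\<C> = {V1. V1 \<subseteq> V \<and> unbounded_on E V1}"
  obtain C where C: "incseq C" "\<And>n. C n \<in> \<C>"
    "\<And>D. D \<in> \<C> \<Longrightarrow> D \<inter> (\<Union>n. C n) = {} \<Longrightarrow> prob D = 0"
    by (rule exhausting_sequence[of \<C>])
      (auto simp: \<C>_def unbounded_on_events unbounded_on_empty intro!: unbounded_on_Un)
  let ?U = "\<Union>n. C n"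
  have U: "unbounded_on E ?U" using C by (intro unbounded_on_incseq) (auto simp: \<C>_def)
  have "bounded_on E (V - ?U)"
  proof (rule bounded_onI)
    show "V - ?U \<in> events" using V unbounded_on_events[OF U] by auto
    fix V' assume "V' \<subseteq> V - ?U" "unbounded_on E V'"
    then show "prob V' = 0" by (intro C(3)) (auto simp: \<C>_def)
  qed
  moreover have "?U \<subseteq> V" using C(2) by (auto simp: \<C>_def)
  ultimately show ?thesis using that U by blast
qed

lemma mu_Diff:
  assumes "B \<in> R" "C \<in> R"
  shows "AE w in M. \<mu> C w = \<mu> (C - B) w + \<mu> (C \<inter> B) w"
proof -
  have "(C - B) \<union> (C \<inter> B) = C" by auto
  then show ?thesis using additive[of "C - B" "C \<inter> B"] assms by auto
qed

text \<open>Give to \<open>B\<close> the part of \<open>V\<close> on which the charge is unbounded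
  inside \<open>B\<close>. On the rest the traces on \<open>B\<close> are bounded, so a set of
  charge \<open>K + K0\<close> must owe at least \<open>K\<close> to its part outside
  \<open>B\<close>.\<close>

lemma unbounded_on_split:
  assumes E: "E \<in> R" and V: "unbounded_on E V" and B: "B \<in> R" "B \<subseteq> E"
  obtains V1 where "V1 \<subseteq> V" "unbounded_on B V1" "unbounded_on (E - B) (V - V1)"
proof -
  have Vev: "V \<in> events" by (rule unbounded_on_events[OF V])
  obtain V1 where V1: "V1 \<subseteq> V" "unbounded_on B V1" "bounded_on B (V - V1)"
    by (rule bounded_unbounded_decomposition[OF Vev])
  define W where "W = V - V1"
  have Wev: "W \<in> events" using Vev unbounded_on_events[OF V1(2)] by (auto simp: W_def)
  have W: "unbounded_on E W" by (rule unbounded_on_mono[OF V _ Wev]) (auto simp: W_def)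
  have "unbounded_on (E - B) W"
    unfolding unbounded_on_def
  proof (intro conjI allI impI Wev)
    fix e :: real assume e: "e > 0"
    then have e2: "e / 2 > 0" by simp
    obtain m where m: "\<forall>K. \<exists>F. finite F \<and> card F \<le> m \<and> F \<subseteq> R \<and>
       (\<forall>B\<in>F. B \<subseteq> E) \<and> prob (W - (\<Union>B\<in>F. big B K)) \<le> e / 2"
      using W e2 unfolding unbounded_on_def by blast
    \<comment> \<open>The order of choices is essential: \<open>m\<close> is fixed first, then
      \<open>K0\<close> for the error e/(2 (m + 1)) per set, and only afterwards the at most
      \<open>m\<close> sets for level \<open>K + K0\<close>.\<close>
    have "e / (2 * (real m + 1)) > 0" using e by simp
    then obtain K0 where K0: "\<forall>A\<in>R. A \<subseteq> B \<longrightarrow> prob (W \<inter> big A K0) \<le> e / (2 * (real m + 1))"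
      using V1(3) unfolding bounded_on_def W_def by blast
    show "\<exists>m. \<forall>K. \<exists>F. finite F \<and> card F \<le> m \<and> F \<subseteq> R \<and>
       (\<forall>A\<in>F. A \<subseteq> E - B) \<and> prob (W - (\<Union>B\<in>F. big B K)) \<le> e"
    proof (intro exI[of _ m] allI)
      fix K
      obtain F where F: "finite F" "card F \<le> m" "F \<subseteq> R" "\<forall>A\<in>F. A \<subseteq> E"
        "prob (W - (\<Union>B\<in>F. big B (K + K0))) \<le> e / 2" using m by blast
      define F' where "F' = (\<lambda>A. A - B) ` F"
      have F': "finite F'" "card F' \<le> m" "F' \<subseteq> R" "\<forall>A\<in>F'. A \<subseteq> E - B"
        using F B card_image_le[OF F(1), of "\<lambda>A. A - B"] by (auto simp: F'_def)
      have FB: "A \<inter> B \<in> R" if "A \<in> F" for A using F B that by blast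
      have "AE w in M. \<forall>C\<in>F. \<mu> C w = \<mu> (C - B) w + \<mu> (C \<inter> B) w"
        using F B by (subst AE_ball_countable) (auto intro!: mu_Diff countable_finite)
      then have "AE w in M. w \<in> W - (\<Union>A\<in>F'. big A K) \<longrightarrow>
          w \<in> (W - (\<Union>A\<in>F. big A (K + K0))) \<union> (\<Union>A\<in>F. W \<inter> big (A \<inter> B) K0)"
      proof eventually_elim
        case (elim w)
        show ?case
        proof (intro impI, rule ccontr)
          assume w: "w \<in> W - (\<Union>A\<in>F'. big A K)"
            and n: "w \<notin> (W - (\<Union>A\<in>F. big A (K + K0))) \<union> (\<Union>A\<in>F. W \<inter> big (A \<inter> B) K0)"
          then obtain A where A: "A \<in> F" "w \<in> big A (K + K0)" by auto
          have "w \<notin> big (A \<inter> B) K0" using n w A by auto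
          moreover have "w \<notin> big (A - B) K" using w A by (auto simp: F'_def)
          moreover have "w \<in> space M" using A by (auto simp: big_def)
          ultimately show False using A elim by (fastforce simp: big_def)
        qed
      qed
      then have "prob (W - (\<Union>A\<in>F'. big A K))
          \<le> prob ((W - (\<Union>A\<in>F. big A (K + K0))) \<union> (\<Union>A\<in>F. W \<inter> big (A \<inter> B) K0))"
        using Wev F B by (intro finite_measure_mono_AE sets.Un sets.Diff sets.finite_UN sets.Int big_events FB) auto
      also have "\<dots> \<le> prob (W - (\<Union>A\<in>F. big A (K + K0))) + prob (\<Union>A\<in>F. W \<inter> big (A \<inter> B) K0)"
        using Wev F B by (intro measure_Un_le sets.Diff sets.finite_UN sets.Int big_events FB) auto
      also have "prob (\<Union>A\<in>F. W \<inter> big (A \<inter> B) K0) \<le> (\<Sum>A\<in>F. prob (W \<inter> big (A \<inter> B) K0))"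
        using Wev F B by (intro measure_UNION_le sets.Int big_events FB) auto
      also have "\<dots> \<le> (\<Sum>A\<in>F. e / (2 * (real m + 1)))"
        using K0 FB by (intro sum_mono) blast
      also have "\<dots> \<le> (real m + 1) * (e / (2 * (real m + 1)))"
        using F e by (simp add: mult_right_mono divide_right_mono del: times_divide_eq_right)
      also have "\<dots> = e / 2" by (simp add: field_simps)
      finally have "prob (W - (\<Union>A\<in>F'. big A K)) \<le> e" using F by simp
      then show "\<exists>F. finite F \<and> card F \<le> m \<and> F \<subseteq> R \<and>
         (\<forall>A\<in>F. A \<subseteq> E - B) \<and> prob (W - (\<Union>B\<in>F. big B K)) \<le> e"
        using F' by (intro exI[of _ F']) auto
    qed
  qed
  then show ?thesis using that V1 unfolding W_def by blast
qed

section \<open>Splitting a set into two large pieces\<close>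

text \<open>Which of the disjoint sets is large depends on the sample point. By
  \<open>bern_coin\<close> half of all unions are large at each such point, so a single union is
  large on half of the event; the price is a factor 2 in charge and in probability.\<close>

lemma large_union:
  assumes fin: "finite I" and A: "\<And>i. i \<in> I \<Longrightarrow> A i \<in> R" and d: "disjoint_family_on A I"
    and V: "V \<in> events"
  obtains S where "S \<subseteq> I" "prob (V \<inter> (\<Union>i\<in>I. big (A i) (2 * L))) \<le> 2 * prob (V \<inter> big (\<Union>i\<in>S. A i) L)"
proof -
  let ?G = "V \<inter> (\<Union>i\<in>I. big (A i) (2 * L))"
  let ?E = "\<lambda>S. V \<inter> big (\<Union>i\<in>S. A i) L"
  have UR: "(\<Union>i\<in>S. A i) \<in> R" if "S \<subseteq> I" for S
    using that fin A by (intro finite_UN) (auto dest: finite_subset)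
  have Gev: "?G \<in> events" using V fin A by (intro sets.Int sets.finite_UN) auto
  have "(1/2) * prob ?G \<le> bern (\<lambda>_. 1/2) I (\<lambda>S. prob (?E S))"
  proof (rule bern_prob_ge[OF fin])
    show "AE w in M. w \<in> ?G \<longrightarrow> 1/2 \<le> bern (\<lambda>_. 1/2) I (\<lambda>S. indicator (?E S) w)"
      using additive_family[of I A, OF fin A d, simplified]
    proof eventually_elim
      case (elim w)
      show ?case
      proof
        assume w: "w \<in> ?G"
        then obtain i where i: "i \<in> I" "2 * L \<le> \<bar>\<mu> (A i) w\<bar>" and sp: "w \<in> space M" by (auto simp: big_def)
        have "1/2 \<le> bern (\<lambda>_. 1/2) I (\<lambda>S. of_bool (L \<le> \<bar>\<Sum>i\<in>S. \<mu> (A i) w\<bar>))"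
          by (rule bern_coin[where x="\<lambda>i. \<mu> (A i) w", OF fin i])
        also have "\<dots> = bern (\<lambda>_. 1/2) I (\<lambda>S. indicator (?E S) w)"
        proof (rule bern_cong)
          fix S assume "S \<subseteq> I"
          then have "\<mu> (\<Union>i\<in>S. A i) w = (\<Sum>i\<in>S. \<mu> (A i) w)" using elim by auto
          then show "of_bool (L \<le> \<bar>\<Sum>i\<in>S. \<mu> (A i) w\<bar>) = (indicator (?E S) w :: real)"
            using w sp by (auto simp: big_def indicator_def)
        qed
        finally show "1/2 \<le> bern (\<lambda>_. 1/2) I (\<lambda>S. indicator (?E S) w)" .
      qed
    qed
  qed (use V UR Gev in auto)
  moreover obtain S where "S \<subseteq> I" "bern (\<lambda>_. 1/2) I (\<lambda>S. prob (?E S)) \<le> prob (?E S)"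
    using ex_ge_bern[of I "\<lambda>_. 1/2" "\<lambda>S. prob (?E S)", OF fin] by auto
  ultimately show ?thesis by (intro that[of S]) linarith+
qed

text \<open>A new generator \<open>C\<close> splits every old piece in two and adds the part of
  \<open>C\<close> outside them, so q pieces become at most 2 q + 1. The region outside all
  generators is left out, whence the bound 2^n - 1.\<close>

lemma generated_partition:
  assumes "finite F" "F \<subseteq> R" "\<forall>B\<in>F. B \<subseteq> E"
  shows "\<exists>Q. finite Q \<and> card Q + 1 \<le> 2 ^ card F \<and> Q \<subseteq> R \<and> disjoint Q \<and> (\<forall>A\<in>Q. A \<subseteq> E) \<and>
     (\<forall>B\<in>F. B = \<Union>{A\<in>Q. A \<subseteq> B})"
  using assms
proof (induction F rule: finite_induct)
  case empty
  show ?case by (rule exI[of _ "{}"]) (auto simp: disjoint_def)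
next
  case (insert C F)
  then obtain Q where Q: "finite Q" "card Q + 1 \<le> 2 ^ card F" "Q \<subseteq> R" "disjoint Q" "\<forall>A\<in>Q. A \<subseteq> E"
    "\<And>B. B \<in> F \<Longrightarrow> B = \<Union>{A\<in>Q. A \<subseteq> B}" by auto
  define Q' where "Q' = (\<lambda>A. A \<inter> C) ` Q \<union> (\<lambda>A. A - C) ` Q \<union> {C - \<Union>Q}"
  have "card Q' \<le> card ((\<lambda>A. A \<inter> C) ` Q) + card ((\<lambda>A. A - C) ` Q) + card {C - \<Union>Q}"
    unfolding Q'_def by (intro order_trans[OF card_Un_le] add_mono card_Un_le) auto
  also have "\<dots> \<le> card Q + card Q + 1"
    by (intro add_mono card_image_le Q) auto
  finally have card: "card Q' + 1 \<le> 2 ^ card (insert C F)" using Q(2) insert by simp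
  have "\<Union>Q \<in> R" using Q by auto
  then have R: "Q' \<subseteq> R" using Q insert.prems by (auto simp: Q'_def)
  have disj: "disjoint Q'"
    unfolding disjoint_def
  proof (intro ballI impI, rule ccontr)
    fix P P' assume P: "P \<in> Q'" "P' \<in> Q'" "P \<noteq> P'" "P \<inter> P' \<noteq> {}"
    then obtain y where y: "y \<in> P" "y \<in> P'" by auto
    have uniq: "A = A'" if "A \<in> Q" "A' \<in> Q" "y \<in> A" "y \<in> A'" for A A'
      using Q(4) that by (auto simp: disjoint_def)
    have "P = P'"
    proof (cases "\<exists>A\<in>Q. y \<in> A")
      case True
      then obtain A where A: "A \<in> Q" "y \<in> A" by blast
      have "T = (if y \<in> C then A \<inter> C else A - C)" if "T \<in> Q'" "y \<in> T" for T
        using that(1) unfolding Q'_def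
      proof (elim UnE imageE)
        fix A' assume "T = A' \<inter> C" "A' \<in> Q"
        then show ?thesis using that(2) uniq[OF A(1) _ A(2)] by auto
      next
        fix A' assume "T = A' - C" "A' \<in> Q"
        then show ?thesis using that(2) uniq[OF A(1) _ A(2)] by auto
      next
        assume "T \<in> {C - \<Union>Q}"
        then show ?thesis using that(2) A by auto
      qed
      from this[OF P(1) y(1)] this[OF P(2) y(2)] show ?thesis by simp
    next
      case False
      have "T = C - \<Union>Q" if "T \<in> Q'" "y \<in> T" for T
        using that False unfolding Q'_def by blast
      from this[OF P(1) y(1)] this[OF P(2) y(2)] show ?thesis by simp
    qed
    then show False using P by simp
  qed
  have "B = \<Union>{A\<in>Q'. A \<subseteq> B}" if "B \<in> insert C F" for B
  proof (intro equalityI subsetI)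
    fix y assume y: "y \<in> B"
    show "y \<in> \<Union>{A\<in>Q'. A \<subseteq> B}"
    proof (cases "\<exists>A\<in>Q. A \<subseteq> B \<and> y \<in> A")
      case True
      then obtain A where "A \<in> Q" "A \<subseteq> B" "y \<in> A" by auto
      then show ?thesis by (cases "y \<in> C") (auto simp: Q'_def)
    next
      case False
      then have "B = C" using that y Q(6)[of B] by auto
      then show ?thesis using y by (cases "y \<in> \<Union>Q") (auto simp: Q'_def)
    qed
  qed auto
  then show ?case using card R disj Q insert.prems
    by (intro exI[of _ Q']) (auto simp: Q'_def)
qed

text \<open>On 3/4 of \<open>V\<close> some piece of a generated partition has charge at least 2 (L
  + K1), and \<open>large_union\<close> gives one \<open>B\<close> of charge at least L + K1 on 3/8
  of \<open>V\<close>. Where the charge of \<open>E\<close> is below \<open>K1\<close>, which fails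
  with probability at most 1/8 of that of \<open>V\<close>, the complement of \<open>B\<close> also
  has charge at least \<open>L\<close>. This leaves 3/8 - 1/8 = 1/4.\<close>

lemma unbounded_on_large_pair:
  assumes E: "E \<in> R" and V: "unbounded_on E V" and L: "0 \<le> L"
  obtains B where "B \<in> R" "B \<subseteq> E" "prob V / 4 \<le> prob (V \<inter> big B L \<inter> big (E - B) L)"
proof (cases "prob V = 0")
  case True
  then show ?thesis using that[of "{}"] by simp
next
  case False
  then have pV: "prob V > 0" using measure_nonneg[of M V] by linarith
  have Vev: "V \<in> events" by (rule unbounded_on_events[OF V])
  obtain m where m: "\<And>K. \<exists>F. finite F \<and> card F \<le> m \<and> F \<subseteq> R \<and>
     (\<forall>B\<in>F. B \<subseteq> E) \<and> prob (V - (\<Union>B\<in>F. big B K)) \<le> prob V / 4"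
  proof -
    have "prob V / 4 > 0" using pV by simp
    with V have "\<exists>m. \<forall>K. \<exists>F. finite F \<and> card F \<le> m \<and> F \<subseteq> R \<and>
     (\<forall>B\<in>F. B \<subseteq> E) \<and> prob (V - (\<Union>B\<in>F. big B K)) \<le> prob V / 4"
      unfolding unbounded_on_def by blast
    then show ?thesis using that by blast
  qed
  obtain K0 where "prob (big E K0) \<le> prob V / 8" using pV by (auto intro: tight1[OF E, of "prob V / 8"])
  \<comment> \<open>The maximum with 1 makes the threshold positive, so that 2 (L + K1) is positive
    even for L = 0.\<close>
  then have K0: "prob (big E (max K0 1)) \<le> prob V / 8"
    using finite_measure_mono[OF big_antimono[of K0 "max K0 1" E] big_events[OF E]] by simp
  define K1 where "K1 = max K0 1"
  \<comment> \<open>Fewer than 2^m pieces make up a set of charge \<open>K\<close>, so one of them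
    carries at least 2 (L + K1); the factor 2 is what \<open>large_union\<close> consumes.\<close>
  define K where "K = 2 ^ m * (2 * (L + K1))"
  have K1: "0 < K1" by (simp add: K1_def)
  obtain F where F: "finite F" "card F \<le> m" "F \<subseteq> R" "\<forall>B\<in>F. B \<subseteq> E"
    "prob (V - (\<Union>B\<in>F. big B K)) \<le> prob V / 4" using m by blast
  obtain Q where Q: "finite Q" "card Q + 1 \<le> 2 ^ card F" "Q \<subseteq> R" "disjoint Q" "\<forall>A\<in>Q. A \<subseteq> E"
    "\<And>B. B \<in> F \<Longrightarrow> B = \<Union>{A\<in>Q. A \<subseteq> B}" using generated_partition[OF F(1,3,4)] by auto
  have dQ: "disjoint_family_on (\<lambda>A. A) Q" using Q(4) by (auto simp: disjoint_family_on_def disjoint_def)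
  have cQ: "real (card Q) \<le> 2 ^ m"
  proof -
    have "card Q \<le> 2 ^ card F" using Q(2) by simp
    also have "\<dots> \<le> 2 ^ m" using F(2) by (intro power_increasing) auto
    finally show ?thesis by (simp flip: of_nat_le_iff)
  qed
  let ?G = "V \<inter> (\<Union>A\<in>Q. big A (2 * (L + K1)))"
  have Gev: "?G \<in> events" using Vev Q by (intro sets.Int sets.finite_UN) auto
  have addQ: "AE w in M. \<forall>S\<subseteq>Q. \<mu> (\<Union>A\<in>S. A) w = (\<Sum>A\<in>S. \<mu> A w)"
    using Q by (intro additive_family dQ) auto
  have "AE w in M. w \<in> V \<longrightarrow> w \<in> (V - (\<Union>B\<in>F. big B K)) \<union> ?G"
    using addQ
  proof eventually_elim
    case (elim w)
    show ?case
    proof (intro impI, rule ccontr)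
      assume w: "w \<in> V" and n: "w \<notin> (V - (\<Union>B\<in>F. big B K)) \<union> ?G"
      then obtain B where B: "B \<in> F" "w \<in> big B K" by auto
      have sp: "w \<in> space M" using B by (simp add: big_def)
      let ?S = "{A\<in>Q. A \<subseteq> B}"
      have "\<bar>\<mu> A w\<bar> < 2 * (L + K1)" if "A \<in> Q" for A
        using n w sp that by (auto simp: big_def not_le)
      then have lt: "(\<Sum>A\<in>?S. \<bar>\<mu> A w\<bar>) \<le> (\<Sum>A\<in>?S. 2 * (L + K1))" by (intro sum_mono) (auto intro: less_imp_le)
      have "\<mu> (\<Union>A\<in>?S. A) w = (\<Sum>A\<in>?S. \<mu> A w)"
        using elim by (auto simp del: Union_iff)
      moreover have "(\<Union>A\<in>?S. A) = B" using Q(6)[OF B(1)] by simp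
      ultimately have "\<bar>\<mu> B w\<bar> \<le> (\<Sum>A\<in>?S. \<bar>\<mu> A w\<bar>)" by (metis sum_abs)
      also have "\<dots> \<le> card ?S * (2 * (L + K1))" using lt by simp
      finally have 1: "\<bar>\<mu> B w\<bar> \<le> card ?S * (2 * (L + K1))" .
      \<comment> \<open>The \<open>+ 1\<close> in the bound for the partition makes this strict,
        which contradicts \<open>big B K\<close> also in the case of equality.\<close>
      have "card ?S < 2 ^ m"
      proof -
        have "card ?S \<le> card Q" using Q(1) by (intro card_mono) auto
        also have "card Q < 2 ^ card F" using Q(2) by simp
        also have "\<dots> \<le> 2 ^ m" using F(2) by (intro power_increasing) auto
        finally show ?thesis .
      qed
      then have c: "real (card ?S) + 1 \<le> 2 ^ m"
        by (metis Suc_leI of_nat_Suc of_nat_le_iff of_nat_numeral of_nat_power add.commute)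
      have "0 < L + K1" using K1 L by linarith
      then have pos: "0 < 2 * (L + K1)" by simp
      have "real (card ?S) < 2 ^ m" using c by linarith
      then have "card ?S * (2 * (L + K1)) < 2 ^ m * (2 * (L + K1))"
        using pos by (rule mult_strict_right_mono)
      then show False using 1 B by (auto simp: big_def K_def)
    qed
  qed
  then have "prob V \<le> prob ((V - (\<Union>B\<in>F. big B K)) \<union> ?G)"
    using Vev Gev F by (intro finite_measure_mono_AE sets.Un sets.Diff) auto
  also have "\<dots> \<le> prob (V - (\<Union>B\<in>F. big B K)) + prob ?G"
    using Vev Gev F by (intro measure_Un_le sets.Diff) auto
  finally have G: "3/4 * prob V \<le> prob ?G" using F(5) by simp
  obtain S where S: "S \<subseteq> Q" "prob ?G \<le> 2 * prob (V \<inter> big (\<Union>A\<in>S. A) (L + K1))"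
    using large_union[OF Q(1) _ dQ Vev, of "L + K1"] Q by auto
  let ?B = "\<Union>A\<in>S. A"
  have B: "?B \<in> R" "?B \<subseteq> E" using S Q by (auto intro!: finite_UN dest: finite_subset)
  have "AE w in M. w \<in> V \<inter> big ?B (L + K1) \<longrightarrow> w \<in> (V \<inter> big ?B L \<inter> big (E - ?B) L) \<union> big E K1"
    using mu_Diff[OF B(1) E]
  proof eventually_elim
    case (elim w)
    have "E \<inter> ?B = ?B" using B by auto
    then show ?case using elim K1 by (auto simp: big_def)
  qed
  then have "prob (V \<inter> big ?B (L + K1)) \<le> prob ((V \<inter> big ?B L \<inter> big (E - ?B) L) \<union> big E K1)"
    using Vev B E by (intro finite_measure_mono_AE sets.Un sets.Int big_events Diff) auto
  also have "\<dots> \<le> prob (V \<inter> big ?B L \<inter> big (E - ?B) L) + prob (big E K1)"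
    using Vev B E by (intro measure_Un_le sets.Int big_events Diff) auto
  finally show ?thesis using that[OF B] G S K0[folded K1_def] by simp
qed

end

section \<open>Binary trees of sets\<close>

text \<open>Words carry the latest branching at the head, so the children of \<open>u\<close> are
  \<open>b # u\<close>, its descendants are \<open>v @ u\<close>, and ancestors are
  suffixes.\<close>

locale dyadic_tree =
  fixes T :: "bool list \<Rightarrow> 'y set"
  assumes children: "T (True # u) \<union> T (False # u) = T u" "T (True # u) \<inter> T (False # u) = {}"
begin

lemma child_subset: "T (b # u) \<subseteq> T u"
  using children[of u] by (cases b) auto

lemma append_subset: "T (v @ u) \<subseteq> T u"
  by (induction v) (use child_subset in fastforce)+

lemma sibling_disjoint: "T (b # u) \<inter> T ((\<not> b) # u) = {}"
  using children[of u] by (cases b) auto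

lemma disjoint_words: "length u = length u' \<Longrightarrow> u \<noteq> u' \<Longrightarrow> T u \<inter> T u' = {}"
proof (induction u u' rule: list_induct2)
  case (Cons b u b' u')
  show ?case
  proof (cases "u = u'")
    case True
    then have "b' = (\<not> b)" using Cons by auto
    then show ?thesis using sibling_disjoint True by auto
  next
    case False
    then show ?thesis using Cons child_subset[of b u] child_subset[of b' u'] by blast
  qed
qed simp

lemma UN_words: "(\<Union>v\<in>{v. length v = n}. T (v @ u)) = T u"
proof (induction n)
  case (Suc n)
  have "(\<Union>v\<in>{v. length v = Suc n}. T (v @ u)) = (\<Union>v\<in>{v. length v = n}. T (True # v @ u) \<union> T (False # v @ u))"
  proof (intro equalityI subsetI)
    fix y assume "y \<in> (\<Union>v\<in>{v. length v = Suc n}. T (v @ u))"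
    then obtain v where v: "length v = Suc n" "y \<in> T (v @ u)" by auto
    then obtain b v' where "v = b # v'" "length v' = n" by (auto simp: length_Suc_conv)
    then show "y \<in> (\<Union>v\<in>{v. length v = n}. T (True # v @ u) \<union> T (False # v @ u))"
      using v by (cases b) auto
  next
    fix y assume "y \<in> (\<Union>v\<in>{v. length v = n}. T (True # v @ u) \<union> T (False # v @ u))"
    then obtain v b where "length v = n" "y \<in> T ((b # v) @ u)" by auto
    then show "y \<in> (\<Union>v\<in>{v. length v = Suc n}. T (v @ u))" by (intro UN_I[of "b # v"]) auto
  qed
  then show ?case using Suc children by auto
qed simp

lemma disjoint_family_words: "disjoint_family_on T {u. length u = n}"
  using disjoint_words by (auto simp: disjoint_family_on_def)

end

lemma finite_words: "finite {u :: bool list. length u = n}"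
  using finite_lists_length_eq[of "UNIV :: bool set" n] by simp

context L0_charge
begin

text \<open>The same \<open>B\<close> serves two purposes: both halves are large on a quarter of the
  event, and \<open>unbounded_on_split\<close> shares the event out between the halves so that the
  construction can continue in each. Events and sets thus form parallel trees.\<close>

lemma unbounded_tree:
  assumes E: "E \<in> R" and V: "unbounded_on E V" and L: "0 \<le> L"
  obtains Ec Vc where "Ec [] = E" "Vc [] = V" "dyadic_tree Ec" "dyadic_tree Vc"
    "\<And>u. Ec u \<in> R" "\<And>u. unbounded_on (Ec u) (Vc u)"
    "\<And>u. prob (Vc u) / 4 \<le> prob (Vc u \<inter> big (Ec (True # u)) L \<inter> big (Ec (False # u)) L)"
proof -
  let ?ok = "\<lambda>E V B V1. B \<in> R \<and> B \<subseteq> E \<and> V1 \<subseteq> V \<and> unbounded_on B V1 \<and> unbounded_on (E - B) (V - V1) \<and>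
     prob V / 4 \<le> prob (V \<inter> big B L \<inter> big (E - B) L)"
  have ex: "\<exists>p. ?ok E V (fst p) (snd p)" if EV: "E \<in> R" "unbounded_on E V" for E V
  proof -
    obtain B where B: "B \<in> R" "B \<subseteq> E" "prob V / 4 \<le> prob (V \<inter> big B L \<inter> big (E - B) L)"
      by (rule unbounded_on_large_pair[OF EV L])
    obtain V1 where "V1 \<subseteq> V" "unbounded_on B V1" "unbounded_on (E - B) (V - V1)"
      by (rule unbounded_on_split[OF EV B(1,2)])
    then show ?thesis using B by (intro exI[of _ "(B, V1)"]) simp
  qed
  define f where "f E V = (SOME p. ?ok E V (fst p) (snd p))" for E V
  have f: "?ok E V (fst (f E V)) (snd (f E V))" if "E \<in> R" "unbounded_on E V" for E V
    unfolding f_def by (rule someI_ex[OF ex[OF that]])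
  define nxt where "nxt b p = (if b then f (fst p) (snd p)
     else (fst p - fst (f (fst p) (snd p)), snd p - snd (f (fst p) (snd p))))" for b and p :: "'x set \<times> 'w set"
  define node where "node u = foldr nxt u (E, V)" for u
  have nc: "node [] = (E, V)" "node (b # u) = nxt b (node u)" for b u by (auto simp: node_def)
  have inv: "fst (node u) \<in> R \<and> unbounded_on (fst (node u)) (snd (node u))" for u
  proof (induction u)
    case (Cons b u)
    then show ?case using f[of "fst (node u)" "snd (node u)"] by (cases b) (simp_all add: nc nxt_def Diff)
  qed (use E V nc in simp)
  have ok: "?ok (fst (node u)) (snd (node u)) (fst (node (True # u))) (snd (node (True # u)))" for u
    using f[of "fst (node u)" "snd (node u)"] inv[of u] by (simp add: nc nxt_def)
  have node_False: "fst (node (False # u)) = fst (node u) - fst (node (True # u))"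
    "snd (node (False # u)) = snd (node u) - snd (node (True # u))" for u
    by (simp_all add: nc nxt_def)
  show ?thesis
  proof (rule that[of "\<lambda>u. fst (node u)" "\<lambda>u. snd (node u)"])
    show "prob (snd (node u)) / 4 \<le> prob (snd (node u) \<inter> big (fst (node (True # u))) L \<inter> big (fst (node (False # u))) L)" for u
      using ok[of u] unfolding node_False by blast
    show "dyadic_tree (\<lambda>u. fst (node u))" "dyadic_tree (\<lambda>u. snd (node u))"
      using ok unfolding dyadic_tree_def node_False by blast+
  qed (simp_all add: inv nc)
qed

text \<open>A family of index sets such that, for \<open>w\<close> in an event \<open>G\<close> of probability at least \<open>prob (Vc []) / 16\<close>, a random subset \<open>S\<close> of the leaves
  meets some member \<open>J\<close> of the family in a set \<open>S \<inter> J\<close> of large charge.  Along the path of a point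
  there are \<open>N\<close> disjoint siblings of charge at least \<open>L\<close>.  Either on many levels the sibling contains a leaf of charge at least 1,
  and then \<open>S\<close> hits one of these leaves, or on some level all leaves are small, and then the
  Paley--Zygmund inequality applies to the sum over the sibling.\<close>
lemma leaves_dichotomy:
  assumes t: "0 < t" "t \<le> 1" and L: "2 / t \<le> L" and N: "N = 16 * n" "0 < n" "(1 - t) ^ n \<le> 1 / 2"
    and dE: "dyadic_tree Ec" and dV: "dyadic_tree Vc" and R: "\<And>u. Ec u \<in> R"
    and V: "\<And>u. Vc u \<in> events"
    and pr: "\<And>u. prob (Vc u) / 4 \<le> prob (Vc u \<inter> big (Ec (True # u)) L \<inter> big (Ec (False # u)) L)"
  defines "I \<equiv> {u. length u = N}"
  obtains \<J> G where "finite \<J>" "disjoint \<J>" "\<And>J. J \<in> \<J> \<Longrightarrow> J \<subseteq> I" "G \<in> events" "prob (Vc []) / 16 \<le> prob G"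
    "AE w in M. w \<in> G \<longrightarrow> 1 / 128 \<le> bern (\<lambda>_. t) I (\<lambda>S. indicator (\<Union>J\<in>\<J>. big (\<Union>i\<in>S \<inter> J. Ec i) 1) w)"
proof -
  interpret E: dyadic_tree Ec by fact
  interpret V: dyadic_tree Vc by fact
  let ?c = "prob (Vc [])"
  define leaves where "leaves u = (\<lambda>v. v @ u) ` {v. length v = N - length u}" for u :: "bool list"
  have finI: "finite I" unfolding I_def by (rule finite_words)
  have dI: "disjoint_family_on Ec I" unfolding I_def by (rule E.disjoint_family_words)
  have leavesI: "leaves u \<subseteq> I" if "length u \<le> N" for u using that by (auto simp: leaves_def I_def)
  have UN_leaves: "(\<Union>i\<in>leaves u. Ec i) = Ec u" for u
    using E.UN_words[where u=u] by (simp add: leaves_def)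
  have leaves_disj: "leaves u \<inter> leaves u' = {}" if "length u = length u'" "u \<noteq> u'" for u u'
    using that by (auto simp: leaves_def)
  have addI: "AE w in M. \<forall>S\<subseteq>I. \<mu> (\<Union>i\<in>S. Ec i) w = (\<Sum>i\<in>S. \<mu> (Ec i) w)"
    using finI R dI by (intro additive_family) auto
  define H where "H u = Vc u \<inter> big (Ec (True # u)) L \<inter> big (Ec (False # u)) L" for u
  have Hev: "H u \<in> events" for u using V R by (auto simp: H_def)
  define G where "G k = (\<Union>u\<in>{u. length u = k}. H u)" for k
  have Gev: "G k \<in> events" for k unfolding G_def using Hev by (intro sets.finite_UN finite_words) auto
  have pG: "?c / 4 \<le> prob (G k)" for k
  proof -
    have d: "disjoint_family_on H {u. length u = k}"
      using V.disjoint_family_words[of k] by (auto simp: disjoint_family_on_def H_def)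
    have "?c = prob (\<Union>u\<in>{u. length u = k}. Vc u)" using V.UN_words[where n=k and u="[]"] by simp
    also have "\<dots> = (\<Sum>u\<in>{u. length u = k}. prob (Vc u))"
      using V V.disjoint_family_words by (intro finite_measure_finite_Union finite_words) auto
    also have "\<dots> / 4 \<le> (\<Sum>u\<in>{u. length u = k}. prob (H u))"
      unfolding sum_divide_distrib H_def by (intro sum_mono pr)
    also have "\<dots> = prob (G k)" unfolding G_def
      using Hev d by (intro finite_measure_finite_Union[symmetric] finite_words) auto
    finally show ?thesis by simp
  qed
  \<comment> \<open>At \<open>w\<close> in \<open>A k\<close> the path of \<open>w\<close> runs
    through \<open>b # u\<close>, and a leaf below the other child of \<open>u\<close> is large.
    Leaves found in this way lie off the path of \<open>w\<close>.\<close>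
  define A where "A k = (\<Union>(b, u)\<in>UNIV \<times> {u. length u = k}. Vc (b # u) \<inter> (\<Union>i\<in>leaves ((\<not> b) # u). big (Ec i) 1))" for k
  have Aev: "A k \<in> events" for k unfolding A_def
    using V R by (intro sets.finite_UN finite_cartesian_product finite_words)
      (auto intro!: sets.Int sets.finite_UN simp: leaves_def finite_words)
  have AG: "?c / 4 \<le> prob (A k) + prob (G k - A k)" for k
  proof -
    have "prob (G k) \<le> prob (A k \<union> (G k - A k))" using Aev Gev by (intro finite_measure_mono) auto
    also have "\<dots> \<le> prob (A k) + prob (G k - A k)" using Aev Gev by (intro measure_Un_le) auto
    finally show ?thesis using pG[of k] by linarith
  qed
  show ?thesis
  \<comment> \<open>Either some level has a substantial event on which the sibling is large although
    all its leaves are small, or every level \<open>k < N\<close> has \<open>A k\<close> of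
    probability at least c/8.\<close>
  proof (cases "\<exists>k<N. ?c / 8 \<le> prob (G k - A k)")
    case True
    then obtain k where k: "k < N" "?c / 8 \<le> prob (G k - A k)" by blast
    let ?J = "leaves ` {u. length u = Suc k}"
    show ?thesis
    proof (rule that[of ?J "G k - A k"])
      show "finite ?J" by (intro finite_imageI finite_words)
      show "disjoint ?J"
        unfolding disjoint_def
      proof (intro ballI impI)
        fix J J' assume J: "J \<in> ?J" "J' \<in> ?J" "J \<noteq> J'"
        obtain u where u: "J = leaves u" "length u = Suc k" using J(1) by blast
        obtain u' where u': "J' = leaves u'" "length u' = Suc k" using J(2) by blast
        have "u \<noteq> u'" using J(3) u u' by metis
        then show "J \<inter> J' = {}" using leaves_disj[of u u'] u u' by simp
      qed
      show "J \<subseteq> I" if J: "J \<in> ?J" for J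
      proof -
        obtain u where "J = leaves u" "length u = Suc k" using J by blast
        then show ?thesis using leavesI[of u] k by simp
      qed
      show "G k - A k \<in> events" using Gev Aev by auto
      show "?c / 16 \<le> prob (G k - A k)" using k(2) measure_nonneg[of M "Vc []"] by linarith
      show "AE w in M. w \<in> G k - A k \<longrightarrow>
         1 / 128 \<le> bern (\<lambda>_. t) I (\<lambda>S. indicator (\<Union>J\<in>?J. big (\<Union>i\<in>S \<inter> J. Ec i) 1) w)"
        using addI
      proof eventually_elim
        case (elim w)
        show ?case
        proof
          assume w: "w \<in> G k - A k"
          then obtain u where u: "length u = k" "w \<in> Vc u" "w \<in> big (Ec (True # u)) L" "w \<in> big (Ec (False # u)) L"
            by (auto simp: G_def H_def)
          have sp: "w \<in> space M" using u(3) by (simp add: big_def)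
          obtain b where b: "w \<in> Vc (b # u)" using u(2) V.children(1)[of u] by blast
          define s where "s = (\<not> b) # u"
          have ls: "length s = Suc k" by (simp add: s_def u)
          have sI: "leaves s \<subseteq> I" using ls k by (intro leavesI) auto
          have sL: "L \<le> \<bar>\<mu> (Ec s) w\<bar>" using u(3,4) by (cases b) (auto simp: s_def big_def)
          have small: "\<bar>\<mu> (Ec i) w\<bar> \<le> 1" if "i \<in> leaves s" for i
          proof (rule ccontr)
            assume "\<not> ?thesis"
            then have "w \<in> big (Ec i) 1" using sp by (auto simp: big_def)
            then have "w \<in> A k" using b that u(1) unfolding A_def s_def by force
            then show False using w by simp
          qed
          \<comment> \<open>Extension by 0 to all leaves: the random set \<open>S\<close> is drawn
            from \<open>I\<close>, while only its trace on the sibling matters for the given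
            \<open>w\<close>.\<close>
          define x where "x i = (if i \<in> leaves s then \<mu> (Ec i) w else 0)" for i
          have sumx: "(\<Sum>i\<in>S. x i) = \<mu> (\<Union>i\<in>S \<inter> leaves s. Ec i) w" if S: "S \<subseteq> I" for S
          proof -
            have "finite S" using S finI by (rule finite_subset)
            then have "(\<Sum>i\<in>S. x i) = (\<Sum>i\<in>S \<inter> leaves s. \<mu> (Ec i) w)"
              unfolding x_def by (simp add: sum.inter_restrict)
            also have "\<dots> = \<mu> (\<Union>i\<in>S \<inter> leaves s. Ec i) w"
              using elim[rule_format, of "S \<inter> leaves s"] S by (metis le_infI1)
            finally show ?thesis .
          qed
          have "1 / 128 \<le> bern (\<lambda>_. t) I (\<lambda>S. of_bool (1 \<le> \<bar>\<Sum>i\<in>S. x i\<bar>))"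
          proof (rule bern_sparse_sum[OF finI t])
            show "\<bar>x i\<bar> \<le> 1" for i using small by (auto simp: x_def)
            have "I \<inter> leaves s = leaves s" using sI by auto
            then have "(\<Sum>i\<in>I. x i) = \<mu> (Ec s) w" using sumx[OF order_refl] UN_leaves[of s] by simp
            then show "2 / t \<le> \<bar>\<Sum>i\<in>I. x i\<bar>" using sL L by simp
          qed
          also have "\<dots> \<le> bern (\<lambda>_. t) I (\<lambda>S. indicator (\<Union>J\<in>?J. big (\<Union>i\<in>S \<inter> J. Ec i) 1) w)"
          proof (rule bern_mono)
            fix S assume "S \<subseteq> I"
            then have "w \<in> (\<Union>J\<in>?J. big (\<Union>i\<in>S \<inter> J. Ec i) 1)" if "1 \<le> \<bar>\<Sum>i\<in>S. x i\<bar>"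
              using that sumx[of S] ls sp by (auto simp: big_def)
            then show "of_bool (1 \<le> \<bar>\<Sum>i\<in>S. x i\<bar>) \<le> (indicator (\<Union>J\<in>?J. big (\<Union>i\<in>S \<inter> J. Ec i) 1) w :: real)"
              by (auto simp: indicator_def)
          qed (use t in auto)
          finally show "1 / 128 \<le> bern (\<lambda>_. t) I (\<lambda>S. indicator (\<Union>J\<in>?J. big (\<Union>i\<in>S \<inter> J. Ec i) 1) w)" .
        qed
      qed
    qed
  next
    case False
    then have pA: "?c / 8 \<le> prob (A k)" if "k < N" for k using AG[of k] that by force
    define cnt where "cnt w = (\<Sum>k<N. indicator (A k) w :: real)" for w
    have cntm [measurable]: "cnt \<in> borel_measurable M" unfolding cnt_def using Aev by measurable
    define G' where "G' = {w \<in> space M. real n \<le> cnt w}"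
    have G'ev: "G' \<in> events" unfolding G'_def by measurable
    have AV: "A k \<subseteq> Vc []" for k
    proof -
      have "Vc (b # u) \<subseteq> Vc []" for b u using V.append_subset[of "b # u" "[]"] by simp
      then show ?thesis unfolding A_def by blast
    qed
    \<comment> \<open>Counting the levels \<open>k\<close> with \<open>w\<close> in
      \<open>A k\<close>: the expected count is at least N c/8 = 2 n c. It is at most
      \<open>N\<close> on \<open>G'\<close>, below \<open>n\<close> elsewhere on the root event, and
      0 outside. Hence 16 n P(G') \<ge> n c, which is why N = 16 n.\<close>
    have "real N * (?c / 8) \<le> (\<Sum>k<N. prob (A k))"
      using sum_mono[of "{..<N}" "\<lambda>_. ?c / 8" "\<lambda>k. prob (A k)"] pA by simp
    also have "\<dots> = (\<integral>w. cnt w \<partial>M)" unfolding cnt_def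
      using Aev by (subst Bochner_Integration.integral_sum) (auto simp: emeasure_eq_measure)
    also have "\<dots> \<le> (\<integral>w. real N * indicator G' w + real n * indicator (Vc []) w \<partial>M)"
    proof (rule integral_mono)
      show "integrable M cnt" unfolding cnt_def
        using Aev by (intro Bochner_Integration.integrable_sum) (auto simp: emeasure_eq_measure)
      show "integrable M (\<lambda>w. real N * indicator G' w + real n * indicator (Vc []) w)"
        using G'ev V[of "[]"] by (intro Bochner_Integration.integrable_add integrable_mult_right integrable_real_indicator)
          (auto simp: emeasure_eq_measure)
      fix w assume w: "w \<in> space M"
      have c1: "cnt w \<le> real N"
        unfolding cnt_def using sum_mono[of "{..<N}" "\<lambda>k. indicator (A k) w" "\<lambda>_. 1 :: real"] by (simp add: indicator_def)
      have c2: "cnt w = 0" if "w \<notin> Vc []" using AV that unfolding cnt_def by (intro sum.neutral) (auto simp: indicator_def)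
      show "cnt w \<le> real N * indicator G' w + real n * indicator (Vc []) w"
        using c1 c2 w by (auto simp: G'_def indicator_def)
    qed
    also have "\<dots> = real N * prob G' + real n * ?c"
      using G'ev V[of "[]"]
      by (subst Bochner_Integration.integral_add) (auto simp: emeasure_eq_measure)
    finally have "16 * real n * (?c / 8) \<le> 16 * real n * prob G' + real n * ?c" using N by simp
    then have "real n * (2 * ?c) \<le> real n * (16 * prob G' + ?c)" by (simp add: algebra_simps)
    then have pG': "?c / 16 \<le> prob G'" using N by simp
    let ?J = "(\<lambda>i. {i}) ` I"
    show ?thesis
    proof (rule that[of ?J G'])
      show "finite ?J" using finI by simp
      show "disjoint ?J" by (auto simp: disjoint_def)
      show "\<And>J. J \<in> ?J \<Longrightarrow> J \<subseteq> I" by auto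
      show "AE w in M. w \<in> G' \<longrightarrow> 1 / 128 \<le> bern (\<lambda>_. t) I (\<lambda>S. indicator (\<Union>J\<in>?J. big (\<Union>i\<in>S \<inter> J. Ec i) 1) w)"
      proof (intro AE_I2 impI)
        fix w assume w: "w \<in> space M" "w \<in> G'"
        define B where "B = {i \<in> I. w \<in> big (Ec i) 1}"
        define K where "K = {k. k < N \<and> w \<in> A k}"
        have fK: "finite K" by (simp add: K_def)
        have "cnt w = real (card K)"
          unfolding cnt_def K_def by (simp add: indicator_def sum.If_cases lessThan_def Collect_conj_eq)
        then have nK: "n \<le> card K" using w by (simp add: G'_def)
        have "\<forall>k\<in>K. \<exists>b u i. length u = k \<and> w \<in> Vc (b # u) \<and> i \<in> leaves ((\<not> b) # u) \<and> w \<in> big (Ec i) 1"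
          unfolding K_def A_def by blast
        then obtain b u i where bui: "\<And>k. k \<in> K \<Longrightarrow> length (u k) = k \<and> w \<in> Vc (b k # u k)
            \<and> i k \<in> leaves ((\<not> b k) # u k) \<and> w \<in> big (Ec (i k)) 1" by metis
        \<comment> \<open>Leaves from different levels leave the path of \<open>w\<close> at
          different heights. If they coincided, the longer path would pass through the sibling at
          height \<open>k\<close>, whose event is disjoint from the event of the child containing
          \<open>w\<close>.\<close>
        have ne: "i k \<noteq> i k'" if k: "k \<in> K" "k' \<in> K" "k < k'" for k k'
        proof
          assume eq: "i k = i k'"
          obtain v where v: "i k = v @ (\<not> b k) # u k" using bui[OF k(1)] by (auto simp: leaves_def)
          obtain v' where v': "i k' = v' @ (\<not> b k') # u k'" using bui[OF k(2)] by (auto simp: leaves_def)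
          have lu: "length (u k) = k" "length (u k') = k'" using bui k by auto
          \<comment> \<open>The ancestor of \<open>u k'\<close> at depth \<open>Suc k\<close>, read
            off as a suffix.\<close>
          define q where "q = drop (k' - Suc k) (u k')"
          have lq: "length q = Suc k" using lu k by (simp add: q_def)
          have uq: "u k' = take (k' - Suc k) (u k') @ q" by (simp add: q_def)
          have "i k = (v' @ (\<not> b k') # take (k' - Suc k) (u k')) @ q" using eq v' uq by simp
          moreover have "i k = v @ ((\<not> b k) # u k)" by (rule v)
          ultimately have "q = (\<not> b k) # u k" using lq lu by (metis append_eq_append_conv length_Cons)
          then have "w \<in> Vc ((\<not> b k) # u k)"
            using bui[OF k(2)] V.append_subset[of "b k' # take (k' - Suc k) (u k')" q] uq by auto
          moreover have "w \<in> Vc (b k # u k)" using bui[OF k(1)] by auto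
          ultimately show False using V.sibling_disjoint[of "b k" "u k"] by auto
        qed
        have "inj_on i K"
        proof (rule inj_onI, rule ccontr)
          fix k k' assume "k \<in> K" "k' \<in> K" "i k = i k'" "k \<noteq> k'"
          then show False using ne[of k k'] ne[of k' k] by (cases "k < k'") auto
        qed
        moreover have "i ` K \<subseteq> B"
        proof
          fix j assume "j \<in> i ` K"
          then obtain k where k: "k \<in> K" "j = i k" by auto
          then have "leaves ((\<not> b k) # u k) \<subseteq> I" using bui[OF k(1)] by (intro leavesI) (auto simp: K_def)
          then show "j \<in> B" using bui[OF k(1)] k by (auto simp: B_def)
        qed
        moreover have fB: "finite B" using finI by (simp add: B_def)
        ultimately have "card K \<le> card B" by (metis card_image card_mono)
        then have nB: "n \<le> card (I \<inter> B)" using nK by (simp add: B_def Int_absorb1 subset_iff Collect_conj_eq[symmetric] inf.absorb2)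
        \<comment> \<open>At least \<open>n\<close> leaves are large at \<open>w\<close>, and the
          thinned set misses them all with probability at most (1 - t)^n \<le> 1/2.\<close>
        have "1 - 1 / 2 \<le> bern (\<lambda>_. t) I (\<lambda>S. 1 - of_bool (S \<inter> B = {}))"
        proof -
          have "(1 - t) ^ card (I \<inter> B) \<le> (1 - t) ^ n" using nB t by (intro power_decreasing) auto
          then show ?thesis unfolding bern_diff bern_avoid[OF finI] using N finI by simp
        qed
        also have "\<dots> \<le> bern (\<lambda>_. t) I (\<lambda>S. indicator (\<Union>J\<in>?J. big (\<Union>i\<in>S \<inter> J. Ec i) 1) w)"
        proof (rule bern_mono)
          fix S assume S: "S \<subseteq> I"
          have "w \<in> (\<Union>J\<in>?J. big (\<Union>i\<in>S \<inter> J. Ec i) 1)" if ne: "S \<inter> B \<noteq> {}"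
          proof -
            obtain j where j: "j \<in> S" "j \<in> I" "w \<in> big (Ec j) 1" using ne by (auto simp: B_def)
            then have "S \<inter> {j} = {j}" by auto
            then have "w \<in> big (\<Union>i\<in>S \<inter> {j}. Ec i) 1" using j by simp
            then show ?thesis using j(2) by blast
          qed
          then show "1 - of_bool (S \<inter> B = {}) \<le> (indicator (\<Union>J\<in>?J. big (\<Union>i\<in>S \<inter> J. Ec i) 1) w :: real)"
            by (auto simp: indicator_def)
        qed (use t in auto)
        finally show "1 / 128 \<le> bern (\<lambda>_. t) I (\<lambda>S. indicator (\<Union>J\<in>?J. big (\<Union>i\<in>S \<inter> J. Ec i) 1) w)" by simp
      qed
    qed (fact G'ev pG')+
  qed
qed

section \<open>Successive removal of large disjoint sets\<close>

text \<open>Two random quantities compete: the probability that the chosen leaves contain a large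
  set, at least P(V)/2048 on average, and the probability carried by their events, t P(V) on
  average. With \<open>t\<close> small compared to \<open>e\<close> the gain survives while the loss
  stays below \<open>e\<close>.\<close>

lemma remove_large_set:
  assumes E: "E \<in> R" and V: "unbounded_on E V" and e: "e > 0"
  obtains B U V' where "B \<in> R" "U \<in> R" "B \<subseteq> U" "U \<subseteq> E" "unbounded_on (E - U) V'" "prob V - e \<le> prob V'"
    "prob V / 8192 \<le> prob (big B (1 / 2))"
proof -
  \<comment> \<open>This \<open>t\<close> makes 4096 t at most \<open>e\<close>, the form in which
    the loss is bounded below.\<close>
  define t where "t = min 1 (e / 4096)"
  have t: "0 < t" "t \<le> 1" "4096 * t \<le> e" using e by (auto simp: t_def min_def)
  define L where "L = 2 / t"
  have L: "0 \<le> L" "2 / t \<le> L" using t by (auto simp: L_def)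
  obtain Ec Vc where tree: "Ec [] = E" "Vc [] = V" "dyadic_tree Ec" "dyadic_tree Vc"
    "\<And>u. Ec u \<in> R" "\<And>u. unbounded_on (Ec u) (Vc u)"
    "\<And>u. prob (Vc u) / 4 \<le> prob (Vc u \<inter> big (Ec (True # u)) L \<inter> big (Ec (False # u)) L)"
    apply (rule unbounded_tree[OF E V L(1)])
    subgoal premises p for Ec Vc by (rule p(1)[OF p(2-8)])
    done
  interpret E: dyadic_tree Ec by fact
  interpret V: dyadic_tree Vc by fact
  have Vev: "Vc u \<in> events" for u using tree(6) by (rule unbounded_on_events)
  have "(\<lambda>n. (1 - t) ^ n) \<longlonglongrightarrow> 0" using t by (intro LIMSEQ_realpow_zero) auto
  then have "eventually (\<lambda>n. (1 - t) ^ n < 1 / 2) sequentially" by (rule order_tendstoD) simp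
  then obtain n0 where "\<And>n. n \<ge> n0 \<Longrightarrow> (1 - t) ^ n < 1 / 2" by (auto simp: eventually_sequentially)
  then have half: "(1 - t) ^ Suc n0 < 1 / 2" using le_SucI[OF order_refl] by blast
  define n where "n = Suc n0"
  have n: "0 < n" "(1 - t) ^ n \<le> 1 / 2" using half by (auto simp: n_def simp del: power_Suc)
  define N where "N = 16 * n"
  define I where "I = {u :: bool list. length u = N}"
  have finI: "finite I" unfolding I_def by (rule finite_words)
  have dI: "disjoint_family_on Ec I" "disjoint_family_on Vc I"
    unfolding I_def by (rule E.disjoint_family_words V.disjoint_family_words)+
  obtain \<J> G where JG: "finite \<J>" "disjoint \<J>" "\<And>J. J \<in> \<J> \<Longrightarrow> J \<subseteq> I" "G \<in> events" "prob V / 16 \<le> prob G"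
    "AE w in M. w \<in> G \<longrightarrow> 1 / 128 \<le> bern (\<lambda>_. t) I (\<lambda>S. indicator (\<Union>J\<in>\<J>. big (\<Union>i\<in>S \<inter> J. Ec i) 1) w)"
    unfolding I_def
    apply (rule leaves_dichotomy[OF t(1,2) L(2) N_def n tree(3,4,5) Vev tree(7)])
    subgoal premises p for \<J> G by (rule p(1)[OF p(2-7)[unfolded tree(2)]])
    done
  have UR: "(\<Union>i\<in>S. Ec i) \<in> R" if "S \<subseteq> I" for S
    using that finI tree(5) by (intro finite_UN) (auto dest: finite_subset)
  let ?A = "\<lambda>S. \<Union>J\<in>\<J>. big (\<Union>i\<in>S \<inter> J. Ec i) 1"
  have Aev: "?A S \<in> events" if "S \<subseteq> I" for S
    using that JG(1) by (intro sets.finite_UN big_events UR) auto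
  have gain: "1 / 128 * prob G \<le> bern (\<lambda>_. t) I (\<lambda>S. prob (?A S))"
  proof (rule bern_prob_ge[where p="\<lambda>_. t" and A="?A", OF finI])
    show "0 \<le> t \<and> t \<le> 1" using t by simp
    show "AE w in M. w \<in> G \<longrightarrow> 1 / 128 \<le> bern (\<lambda>_. t) I (\<lambda>S. indicator (?A S) w)" by (rule JG(6))
    show "G \<in> events" by (rule JG(4))
    show "?A S \<in> events" if "S \<subseteq> I" for S by (rule Aev[OF that])
  qed simp
  have loss: "bern (\<lambda>_. t) I (\<lambda>S. \<Sum>i\<in>S. prob (Vc i)) = t * prob V"
  proof -
    have "(\<Sum>i\<in>I. prob (Vc i)) = prob (\<Union>i\<in>I. Vc i)"
      using Vev dI finI by (intro finite_measure_finite_Union[symmetric]) auto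
    also have "(\<Union>i\<in>I. Vc i) = V" using V.UN_words[where n=N and u="[]"] tree(2) by (simp add: I_def)
    finally show ?thesis by (simp add: bern_sum_mean[OF finI] sum_distrib_left[symmetric])
  qed
  \<comment> \<open>Gain minus penalized loss: the mean is at least P(V)/2048 - P(V)/4096. For a set
    attaining the mean, nonnegativity of the loss bounds the gain from below, and a gain of at most
    1 bounds the loss by 4096 t.\<close>
  let ?F = "\<lambda>S. prob (?A S) - (1 / (4096 * t)) * (\<Sum>i\<in>S. prob (Vc i))"
  have bF: "prob V / 4096 \<le> bern (\<lambda>_. t) I ?F"
  proof -
    have "bern (\<lambda>_. t) I ?F = bern (\<lambda>_. t) I (\<lambda>S. prob (?A S)) - (1 / (4096 * t)) * (t * prob V)"
      unfolding bern_diff bern_cmult loss ..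
    also have "(1 / (4096 * t)) * (t * prob V) = prob V / 4096" using t by simp
    finally show ?thesis using gain JG(5) by simp
  qed
  obtain S where S: "S \<subseteq> I" "bern (\<lambda>_. t) I ?F \<le> ?F S"
  proof (rule ex_ge_bern[of I "\<lambda>_. t" ?F, OF finI])
    show "0 \<le> t \<and> t \<le> 1" using t by simp
  qed
  define U where "U = (\<Union>i\<in>S. Ec i)"
  define V' where "V' = (\<Union>i\<in>I - S. Vc i)"
  have sum0: "0 \<le> (\<Sum>i\<in>S. prob (Vc i))" by (intro sum_nonneg) auto
  have A_large: "prob V / 4096 \<le> prob (?A S)"
  proof -
    have "0 \<le> (1 / (4096 * t)) * (\<Sum>i\<in>S. prob (Vc i))" using t sum0 by simp
    then show ?thesis using bF S(2) by linarith
  qed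
  have lossS: "(\<Sum>i\<in>S. prob (Vc i)) \<le> e"
  proof -
    have "(1 / (4096 * t)) * (\<Sum>i\<in>S. prob (Vc i)) \<le> 1"
      using bF S(2) prob_le_1[of "?A S"] measure_nonneg[of M V] by linarith
    then have "(\<Sum>i\<in>S. prob (Vc i)) \<le> 4096 * t" using t by (simp add: field_simps)
    then show ?thesis using t by linarith
  qed
  have dJ: "disjoint_family_on (\<lambda>J. \<Union>i\<in>S \<inter> J. Ec i) \<J>"
    unfolding disjoint_family_on_def
  proof (intro ballI impI)
    fix J J' assume J: "J \<in> \<J>" "J' \<in> \<J>" "J \<noteq> J'"
    then have "J \<inter> J' = {}" using JG(2) by (auto simp: disjoint_def)
    then have "Ec i \<inter> Ec j = {}" if "i \<in> S \<inter> J" "j \<in> S \<inter> J'" for i j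
      using that S(1) by (intro disjoint_family_onD[OF dI(1)]) auto
    then show "(\<Union>i\<in>S \<inter> J. Ec i) \<inter> (\<Union>i\<in>S \<inter> J'. Ec i) = {}" by blast
  qed
  have JR: "(\<Union>i\<in>S \<inter> J. Ec i) \<in> R" for J using S(1) by (intro UR) auto
  \<comment> \<open>The member \<open>J\<close> that yields a large set varies with the sample
    point. The members are disjoint, so one union of traces has charge 1/2 with half the
    probability, whence 8192.\<close>
  obtain T where T: "T \<subseteq> \<J>" "prob (space M \<inter> (\<Union>J\<in>\<J>. big (\<Union>i\<in>S \<inter> J. Ec i) (2 * (1 / 2))))
      \<le> 2 * prob (space M \<inter> big (\<Union>J\<in>T. \<Union>i\<in>S \<inter> J. Ec i) (1 / 2))"
    by (rule large_union[of \<J> "\<lambda>J. \<Union>i\<in>S \<inter> J. Ec i" "space M" "1 / 2", OF JG(1) JR dJ sets.top])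
  define B where "B = (\<Union>J\<in>T. \<Union>i\<in>S \<inter> J. Ec i)"
  have BR: "B \<in> R" unfolding B_def using finite_subset[OF T(1) JG(1)] by (rule finite_UN) (rule JR)
  have "space M \<inter> ?A S = ?A S" "space M \<inter> big B (1 / 2) = big B (1 / 2)" by (auto simp: big_def)
  then have B_large: "prob V / 8192 \<le> prob (big B (1 / 2))"
    using T(2) A_large unfolding B_def by simp
  show ?thesis
  proof (rule that[of B U V'])
    show "B \<subseteq> U" by (auto simp: B_def U_def)
    show "U \<in> R" unfolding U_def by (rule UR[OF S(1)])
    show "U \<subseteq> E" using E.append_subset[where u="[]"] tree(1) by (auto simp: U_def)
    show "unbounded_on (E - U) V'"
      unfolding V'_def
    proof (rule unbounded_on_UN)
      fix i assume i: "i \<in> I - S"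
      have "Ec i \<inter> Ec j = {}" if "j \<in> S" for j
        using that i S(1) by (intro disjoint_family_onD[OF dI(1)]) auto
      then have "Ec i \<inter> U = {}" unfolding U_def by blast
      then have "Ec i \<subseteq> E - U" using E.append_subset[where v=i and u="[]"] tree(1) by auto
      then show "unbounded_on (E - U) (Vc i)" by (rule unbounded_on_mono[OF tree(6) order_refl Vev])
    qed (use finI in auto)
    have V'ev: "V' \<in> events" unfolding V'_def using finI Vev by (intro sets.finite_UN) auto
    have Sev: "(\<Union>i\<in>S. Vc i) \<in> events" using S(1) finI Vev by (intro sets.finite_UN) (auto dest: finite_subset)
    have "V = (\<Union>i\<in>I. Vc i)" using V.UN_words[where n=N and u="[]"] tree(2) by (simp add: I_def)
    also have "\<dots> = V' \<union> (\<Union>i\<in>S. Vc i)" using S(1) by (auto simp: V'_def)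
    finally have "prob V \<le> prob V' + prob (\<Union>i\<in>S. Vc i)" using measure_Un_le[OF V'ev Sev] by simp
    also have "prob (\<Union>i\<in>S. Vc i) \<le> (\<Sum>i\<in>S. prob (Vc i))"
      using S(1) finI Vev by (intro measure_UNION_le) (auto dest: finite_subset)
    finally show "prob V - e \<le> prob V'" using lossS by linarith
  qed (fact BR B_large)+
qed

text \<open>If the range were unbounded on an event of positive probability, sets could be removed
  forever; those inside successive removed regions are disjoint and keep charge 1/2 with a fixed
  probability, contradicting exhaustivity.\<close>

lemma exhaustive_imp_bounded:
  assumes exh: "\<And>A e. (\<And>n::nat. A n \<in> R) \<Longrightarrow> disjoint_family A \<Longrightarrow> e > 0 \<Longrightarrow> (\<lambda>n. prob (big (A n) e)) \<longlonglongrightarrow> 0"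
  shows "bounded_on X (space M)"
proof (rule bounded_onI[OF sets.top], rule ccontr)
  fix V assume V: "unbounded_on X V" "prob V \<noteq> 0"
  define c where "c = prob V"
  have c: "c > 0" using V(2) measure_nonneg[of M V] by (simp add: c_def less_le)
  \<comment> \<open>Starting from probability \<open>c\<close> and losing c/2^(k+2) at step
    \<open>k\<close>, the event never falls below c/2, so each set is large with probability at
    least (c/2)/8192 = c/16384.\<close>
  let ?P = "\<lambda>k p. (fst p) \<in> R \<and> unbounded_on (fst p) (snd p) \<and> c / 2 + c / 2 ^ (k + 1) \<le> prob (snd p)"
  let ?Q = "\<lambda>k p q. fst q \<subseteq> fst p \<and> (\<exists>B\<in>R. B \<subseteq> fst p - fst q \<and> c / 16384 \<le> prob (big B (1 / 2)))"
  have "\<exists>f. \<forall>k. ?P k (f k) \<and> ?Q k (f k) (f (Suc k))"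
  proof (rule dependent_nat_choice)
    show "\<exists>p. ?P 0 p" using V(1) by (intro exI[of _ "(X, V)"]) (simp add: c_def)
  next
    fix p :: "'x set \<times> 'w set" and k assume p: "?P k p"
    have e: "c / 2 ^ (k + 2) > 0" using c by simp
    obtain B U V' where B: "B \<in> R" "U \<in> R" "B \<subseteq> U" "U \<subseteq> fst p" "unbounded_on (fst p - U) V'"
      "prob (snd p) - c / 2 ^ (k + 2) \<le> prob V'" "prob (snd p) / 8192 \<le> prob (big B (1 / 2))"
      using remove_large_set[OF conjunct1[OF p] conjunct1[OF conjunct2[OF p]] e] by blast
    have half: "c / 2 ^ (k + 1) = 2 * (c / 2 ^ (k + 2))" by simp
    have "c / 2 \<le> prob (snd p)" using p e half by linarith
    then have "c / 16384 \<le> prob (big B (1 / 2))" using B(7) by linarith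
    moreover have "c / 2 + c / 2 ^ (Suc k + 1) \<le> prob V'" using B(6) p half by simp
    ultimately show "\<exists>q. ?P (Suc k) q \<and> ?Q k p q"
      using B p by (intro exI[of _ "(fst p - U, V')"]) auto
  qed
  then obtain f where f: "\<And>k. ?P k (f k)" "\<And>k. ?Q k (f k) (f (Suc k))" by blast
  then obtain B where B: "\<And>k. B k \<in> R" "\<And>k. B k \<subseteq> fst (f k) - fst (f (Suc k))"
    "\<And>k. c / 16384 \<le> prob (big (B k) (1 / 2))" by metis
  have dec: "decseq (\<lambda>k. fst (f k))" using f(2) by (intro decseq_SucI) auto
  have disj: "B j \<inter> B k = {}" if "j < k" for j k
    using B(2)[of j] B(2)[of k] decseqD[OF dec, of "Suc j" k] that by auto
  have "disjoint_family B"
    unfolding disjoint_family_on_def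
  proof (intro ballI impI)
    fix j k :: nat assume "j \<noteq> k"
    then show "B j \<inter> B k = {}" using disj[of j k] disj[of k j] by (cases "j < k") auto
  qed
  then have "(\<lambda>k. prob (big (B k) (1 / 2))) \<longlonglongrightarrow> 0" using B(1) by (intro exh) auto
  then have "c / 16384 \<le> 0" by (rule LIMSEQ_le_const) (use B(3) in auto)
  then show False using c by simp
qed

end

section \<open>Integrals of simple functions\<close>

context L0_charge
begin

text \<open>Where the square function exceeds 16 K1^2, a fraction 1/128 of all unions has charge at
  least \<open>K1\<close>. Averaging over unions, all of which are covered by the bounded range,
  bounds the probability of that event.\<close>

lemma square_function_tight:
  assumes bdd: "bounded_on X (space M)" and e: "e > 0"
  obtains K where "0 < K" "\<And>(I :: 'i set) A. finite I \<Longrightarrow> (\<And>i. i \<in> I \<Longrightarrow> A i \<in> R) \<Longrightarrow> disjoint_family_on A I \<Longrightarrow>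
     prob {w \<in> space M. K \<le> (\<Sum>i\<in>I. (\<mu> (A i) w)\<^sup>2)} \<le> e"
proof -
  have "e / 128 > 0" using e by simp
  then obtain K0 where K0: "\<forall>B\<in>R. B \<subseteq> X \<longrightarrow> prob (space M \<inter> big B K0) \<le> e / 128"
    using bdd unfolding bounded_on_def by blast
  define K1 where "K1 = max K0 1"
  have K1: "0 < K1" by (simp add: K1_def)
  have bK1: "prob (big B K1) \<le> e / 128" if B: "B \<in> R" for B
  proof -
    have "big B K1 \<subseteq> space M \<inter> big B K0" by (auto simp: big_def K1_def)
    then have "prob (big B K1) \<le> prob (space M \<inter> big B K0)" using B by (intro finite_measure_mono) auto
    then show ?thesis using K0 B sets_into_space by fastforce
  qed
  show ?thesis
  proof (rule that[of "16 * K1\<^sup>2"])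
    show "0 < 16 * K1\<^sup>2" using K1 by simp
    fix I :: "'i set" and A assume A: "finite I" "\<And>i. i \<in> I \<Longrightarrow> A i \<in> R" "disjoint_family_on A I"
    let ?G = "{w \<in> space M. 16 * K1\<^sup>2 \<le> (\<Sum>i\<in>I. (\<mu> (A i) w)\<^sup>2)}"
    have m: "(\<lambda>w. \<Sum>i\<in>I. (\<mu> (A i) w)\<^sup>2) \<in> borel_measurable M"
      by (intro borel_measurable_sum borel_measurable_power measurable A)
    have Gev: "?G \<in> events" using m by measurable
    have UR: "(\<Union>i\<in>S. A i) \<in> R" if "S \<subseteq> I" for S
      using finite_subset[OF that A(1)] by (rule finite_UN) (use that A(2) in auto)
    have "(1 / 128) * prob ?G \<le> bern (\<lambda>_. 1/2) I (\<lambda>S. prob (big (\<Union>i\<in>S. A i) K1))"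
    proof (rule bern_prob_ge[where p="\<lambda>_. 1/2" and A="\<lambda>S. big (\<Union>i\<in>S. A i) K1", OF A(1)])
      show "AE w in M. w \<in> ?G \<longrightarrow> 1 / 128 \<le> bern (\<lambda>_. 1/2) I (\<lambda>S. indicator (big (\<Union>i\<in>S. A i) K1) w)"
        using additive_family[of I A, OF A(1,2,3), simplified]
      proof eventually_elim
        case (elim w)
        show ?case
        proof
          assume w: "w \<in> ?G"
          have "1 / 128 \<le> bern (\<lambda>_. 1/2) I (\<lambda>S. of_bool (K1 \<le> \<bar>\<Sum>i\<in>S. \<mu> (A i) w\<bar>))"
            by (rule bern_half_square_function[OF A(1) K1]) (use w in auto)
          also have "\<dots> = bern (\<lambda>_. 1/2) I (\<lambda>S. indicator (big (\<Union>i\<in>S. A i) K1) w)"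
          proof (rule bern_cong)
            fix S assume "S \<subseteq> I"
            then have "\<mu> (\<Union>i\<in>S. A i) w = (\<Sum>i\<in>S. \<mu> (A i) w)" using elim by auto
            then show "of_bool (K1 \<le> \<bar>\<Sum>i\<in>S. \<mu> (A i) w\<bar>) = (indicator (big (\<Union>i\<in>S. A i) K1) w :: real)"
              using w by (auto simp: big_def indicator_def)
          qed
          finally show "1 / 128 \<le> bern (\<lambda>_. 1/2) I (\<lambda>S. indicator (big (\<Union>i\<in>S. A i) K1) w)" .
        qed
      qed
    qed (use Gev UR in auto)
    also have "\<dots> \<le> e / 128"
      by (rule bern_le_const[OF A(1)]) (simp, rule bK1[OF UR])
    finally show "prob ?G \<le> e" by simp
  qed
qed

text \<open>A coefficient vector in \<open>[0,1]\<close> is the mean of a random subset (randomized rounding), and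
  the variance is dominated by the square function.\<close>
lemma convex_combination_tight_nonneg:
  assumes bdd: "bounded_on X (space M)" and e: "e > 0"
  obtains K where "0 < K" "\<And>(I :: 'i set) A a. finite I \<Longrightarrow> (\<And>i. i \<in> I \<Longrightarrow> A i \<in> R) \<Longrightarrow> disjoint_family_on A I \<Longrightarrow>
     (\<And>i. i \<in> I \<Longrightarrow> 0 \<le> a i \<and> a i \<le> 1) \<Longrightarrow>
     prob {w \<in> space M. K \<le> \<bar>\<Sum>i\<in>I. a i * \<mu> (A i) w\<bar>} \<le> e"
proof -
  have "e / 4 > 0" using e by simp
  then obtain K0 where K0: "\<forall>B\<in>R. B \<subseteq> X \<longrightarrow> prob (space M \<inter> big B K0) \<le> e / 4"
    using bdd unfolding bounded_on_def by blast
  have bK0: "prob (big B K0) \<le> e / 4" if B: "B \<in> R" for B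
  proof -
    have "space M \<inter> big B K0 = big B K0" by (auto simp: big_def)
    then show ?thesis using K0 B sets_into_space by fastforce
  qed
  have e2: "e / 2 > 0" using e by simp
  obtain q where q: "0 < q" "\<And>(I :: 'i set) A. finite I \<Longrightarrow> (\<And>i. i \<in> I \<Longrightarrow> A i \<in> R) \<Longrightarrow> disjoint_family_on A I \<Longrightarrow>
     prob {w \<in> space M. q \<le> (\<Sum>i\<in>I. (\<mu> (A i) w)\<^sup>2)} \<le> e / 2"
    apply (rule square_function_tight[OF bdd e2, where 'i='i])
    subgoal premises p for q by (rule p(1)[OF p(2,3)])
    done
  \<comment> \<open>Off the event where the square function exceeds \<open>q\<close>, the variance
    is at most \<open>q\<close>, so by Chebyshev the rounded sum is within sqrt(2 q) of its mean
    with chance at least 1/2 and then still exceeds \<open>K0\<close>.\<close>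
  define K where "K = \<bar>K0\<bar> + sqrt (2 * q)"
  have sq: "sqrt (2 * q) > 0" using q(1) by simp
  show ?thesis
  proof (rule that[of K])
    show "0 < K" using sq by (simp add: K_def add_nonneg_pos)
    fix I :: "'i set" and A and a :: "'i \<Rightarrow> real"
    assume A: "finite I" "\<And>i. i \<in> I \<Longrightarrow> A i \<in> R" "disjoint_family_on A I"
      and a: "\<And>i. i \<in> I \<Longrightarrow> 0 \<le> a i \<and> a i \<le> 1"
    let ?G = "{w \<in> space M. K \<le> \<bar>\<Sum>i\<in>I. a i * \<mu> (A i) w\<bar>}"
    let ?Q = "{w \<in> space M. q \<le> (\<Sum>i\<in>I. (\<mu> (A i) w)\<^sup>2)}"
    have "(\<lambda>w. \<Sum>i\<in>I. a i * \<mu> (A i) w) \<in> borel_measurable M"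
      by (intro borel_measurable_sum borel_measurable_times measurable A) auto
    then have Gev: "?G \<in> events" by measurable
    have "(\<lambda>w. \<Sum>i\<in>I. (\<mu> (A i) w)\<^sup>2) \<in> borel_measurable M"
      by (intro borel_measurable_sum borel_measurable_power measurable A)
    then have Qev: "?Q \<in> events" by measurable
    have UR: "(\<Union>i\<in>S. A i) \<in> R" if "S \<subseteq> I" for S
      using finite_subset[OF that A(1)] by (rule finite_UN) (use that A(2) in auto)
    have "(1 / 2) * prob (?G - ?Q) \<le> bern a I (\<lambda>S. prob (big (\<Union>i\<in>S. A i) K0))"
    proof (rule bern_prob_ge[where p=a and A="\<lambda>S. big (\<Union>i\<in>S. A i) K0", OF A(1)])
      show "AE w in M. w \<in> ?G - ?Q \<longrightarrow> 1 / 2 \<le> bern a I (\<lambda>S. indicator (big (\<Union>i\<in>S. A i) K0) w)"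
        using additive_family[of I A, OF A(1,2,3), simplified]
      proof eventually_elim
        case (elim w)
        show ?case
        proof
          assume w: "w \<in> ?G - ?Q"
          define x where "x i = \<mu> (A i) w" for i
          have m: "K \<le> \<bar>bmean a x I\<bar>" using w by (simp add: bmean_def x_def)
          have "bvar a x I \<le> (\<Sum>i\<in>I. (x i)\<^sup>2)"
            unfolding bvar_def
          proof (intro sum_mono)
            fix i assume "i \<in> I"
            then have "a i * (1 - a i) \<le> 1" using a[of i] mult_mono[of "a i" 1 "1 - a i" 1] by auto
            then show "a i * (1 - a i) * (x i)\<^sup>2 \<le> (x i)\<^sup>2" by (simp add: mult_left_le_one_le mult_right_mono[of "a i * (1 - a i)" 1, simplified])
          qed
          also have "\<dots> \<le> q" using w by (auto simp: x_def not_le)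
          finally have v: "bvar a x I / (sqrt (2 * q))\<^sup>2 \<le> 1 / 2" using q(1) by (simp add: field_simps)
          have "1 - 1 / 2 \<le> bern a I (\<lambda>S. 1 - of_bool (sqrt (2 * q) < \<bar>(\<Sum>i\<in>S. x i) - bmean a x I\<bar>))"
            unfolding bern_diff bern_const[OF A(1)]
            using order_trans[OF bern_chebyshev[of I a "sqrt (2 * q)" x, OF A(1) a sq] v] by (rule diff_left_mono)
          also have "\<dots> \<le> bern a I (\<lambda>S. indicator (big (\<Union>i\<in>S. A i) K0) w)"
          proof (rule bern_mono[OF a])
            fix S assume "S \<subseteq> I"
            then have "\<mu> (\<Union>i\<in>S. A i) w = (\<Sum>i\<in>S. x i)" using elim by (auto simp: x_def)
            moreover have "K0 \<le> \<bar>\<Sum>i\<in>S. x i\<bar>" if "\<not> sqrt (2 * q) < \<bar>(\<Sum>i\<in>S. x i) - bmean a x I\<bar>"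
              using that m unfolding K_def by linarith
            ultimately show "1 - of_bool (sqrt (2 * q) < \<bar>(\<Sum>i\<in>S. x i) - bmean a x I\<bar>)
               \<le> (indicator (big (\<Union>i\<in>S. A i) K0) w :: real)"
              using w by (auto simp: big_def indicator_def)
          qed
          finally show "1 / 2 \<le> bern a I (\<lambda>S. indicator (big (\<Union>i\<in>S. A i) K0) w)" by simp
        qed
      qed
    qed (use Gev Qev UR a in auto)
    also have "\<dots> \<le> e / 4"
      by (rule bern_le_const[OF A(1) a]) (assumption, rule bK0[OF UR])
    finally have 1: "prob (?G - ?Q) \<le> e / 2" by simp
    have "prob ?G \<le> prob ((?G - ?Q) \<union> ?Q)" using Gev Qev by (intro finite_measure_mono) auto
    also have "\<dots> \<le> prob (?G - ?Q) + prob ?Q" using Gev Qev by (intro measure_Un_le) auto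
    also have "prob ?Q \<le> e / 2" by (rule q(2)[OF A])
    finally show "prob ?G \<le> e" using 1 by simp
  qed
qed

text \<open>A coefficient in [-\<delta>, \<delta>] is \<delta> (2 b - 1) with b in [0, 1]. The part
  with 2 b costs 2 K, the constant part costs K, which gives 3 K. Homogeneity in \<delta> is what
  later makes uniformly small integrands have small integrals.\<close>

lemma convex_combination_tight:
  assumes bdd: "bounded_on X (space M)" and e: "e > 0"
  obtains K where "0 < K" "\<And>(I :: 'i set) A a \<delta>. finite I \<Longrightarrow> (\<And>i. i \<in> I \<Longrightarrow> A i \<in> R) \<Longrightarrow> disjoint_family_on A I \<Longrightarrow>
     (\<And>i. i \<in> I \<Longrightarrow> \<bar>a i\<bar> \<le> \<delta>) \<Longrightarrow> 0 < \<delta> \<Longrightarrow>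
     prob {w \<in> space M. \<delta> * K \<le> \<bar>\<Sum>i\<in>I. a i * \<mu> (A i) w\<bar>} \<le> e"
proof -
  have e2: "e / 2 > 0" using e by simp
  obtain K where K: "0 < K" "\<And>(I :: 'i set) A a. finite I \<Longrightarrow> (\<And>i. i \<in> I \<Longrightarrow> A i \<in> R) \<Longrightarrow> disjoint_family_on A I \<Longrightarrow>
     (\<And>i. i \<in> I \<Longrightarrow> 0 \<le> a i \<and> a i \<le> 1) \<Longrightarrow>
     prob {w \<in> space M. K \<le> \<bar>\<Sum>i\<in>I. a i * \<mu> (A i) w\<bar>} \<le> e / 2"
    apply (rule convex_combination_tight_nonneg[OF bdd e2, where 'i='i])
    subgoal premises p for K by (rule p(1)[OF p(2,3)])
    done
  show ?thesis
  proof (rule that[of "3 * K"])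
    show "0 < 3 * K" using K(1) by simp
    fix I :: "'i set" and A and a :: "'i \<Rightarrow> real" and \<delta> :: real
    assume A: "finite I" "\<And>i. i \<in> I \<Longrightarrow> A i \<in> R" "disjoint_family_on A I"
      and a: "\<And>i. i \<in> I \<Longrightarrow> \<bar>a i\<bar> \<le> \<delta>" and \<delta>: "0 < \<delta>"
    define b where "b i = (1 + a i / \<delta>) / 2" for i
    have b: "0 \<le> b i \<and> b i \<le> 1" if "i \<in> I" for i
    proof -
      have "- \<delta> \<le> a i" "a i \<le> \<delta>" using a[OF that] by (simp_all add: abs_le_iff)
      then show ?thesis unfolding b_def using \<delta> by (simp add: field_simps)
    qed
    let ?G1 = "{w \<in> space M. K \<le> \<bar>\<Sum>i\<in>I. b i * \<mu> (A i) w\<bar>}"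
    let ?G2 = "{w \<in> space M. K \<le> \<bar>\<Sum>i\<in>I. 1 * \<mu> (A i) w\<bar>}"
    have "(\<lambda>w. \<Sum>i\<in>I. b i * \<mu> (A i) w) \<in> borel_measurable M" "(\<lambda>w. \<Sum>i\<in>I. 1 * \<mu> (A i) w) \<in> borel_measurable M"
      by (intro borel_measurable_sum borel_measurable_times measurable A borel_measurable_const, assumption)+
    then have ev: "?G1 \<in> events" "?G2 \<in> events" by measurable
    have "{w \<in> space M. \<delta> * (3 * K) \<le> \<bar>\<Sum>i\<in>I. a i * \<mu> (A i) w\<bar>} \<subseteq> ?G1 \<union> ?G2"
    proof (rule subsetI, rule ccontr)
      fix w assume w: "w \<in> {w \<in> space M. \<delta> * (3 * K) \<le> \<bar>\<Sum>i\<in>I. a i * \<mu> (A i) w\<bar>}" "w \<notin> ?G1 \<union> ?G2"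
      define x y where "x = (\<Sum>i\<in>I. b i * \<mu> (A i) w)" and "y = (\<Sum>i\<in>I. 1 * \<mu> (A i) w)"
      have "(\<Sum>i\<in>I. a i * \<mu> (A i) w) = (\<Sum>i\<in>I. \<delta> * (2 * (b i * \<mu> (A i) w) - 1 * \<mu> (A i) w))"
        using \<delta> by (intro sum.cong) (auto simp: b_def field_simps)
      also have "\<dots> = \<delta> * (2 * x - y)" by (simp add: x_def y_def sum_distrib_left sum_subtractf right_diff_distrib)
      finally have "\<delta> * (3 * K) \<le> \<delta> * \<bar>2 * x - y\<bar>" using w(1) \<delta> by (simp add: abs_mult)
      then have "3 * K \<le> \<bar>2 * x - y\<bar>" using \<delta> by simp
      moreover have "\<bar>x\<bar> < K" "\<bar>y\<bar> < K" using w by (auto simp: x_def y_def)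
      ultimately show False by linarith
    qed
    then have "prob {w \<in> space M. \<delta> * (3 * K) \<le> \<bar>\<Sum>i\<in>I. a i * \<mu> (A i) w\<bar>} \<le> prob (?G1 \<union> ?G2)"
      using ev by (intro finite_measure_mono) auto
    also have "\<dots> \<le> prob ?G1 + prob ?G2" using ev by (intro measure_Un_le)
    also have "\<dots> \<le> e / 2 + e / 2"
      by (intro add_mono K(2)[OF A b] K(2)[OF A]) auto
    finally show "prob {w \<in> space M. \<delta> * (3 * K) \<le> \<bar>\<Sum>i\<in>I. a i * \<mu> (A i) w\<bar>} \<le> e" by simp
  qed
qed

end

section \<open>Stochastic measures on the cube and partitions into level sets\<close>

lemma algebra_cube_borel: "algebra unit_cube cube_borel"
  unfolding algebra_iff_Un cube_borel_def
  by (auto simp: unit_cube_def intro!: sets.Diff)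

locale SM = prob_space M for M :: "'w measure" +
  fixes \<mu> :: "(real^'n::finite) set \<Rightarrow> 'w \<Rightarrow> real"
  assumes SM: "stochastic_measure M \<mu>"

sublocale SM \<subseteq> L0_charge M unit_cube cube_borel \<mu>
proof -
  interpret algebra unit_cube "cube_borel :: (real^'n) set set" by (rule algebra_cube_borel)
  show "L0_charge M unit_cube cube_borel \<mu>"
    by unfold_locales (use SM in \<open>auto simp: stochastic_measure_def\<close>)
qed

text \<open>The nonempty common level sets of \<open>F\<close>, the atoms of the algebra it
  generates. Functions determined by \<open>F\<close> are all integrated over this one finite
  partition.\<close>

definition cells :: "(real^'n \<Rightarrow> real) set \<Rightarrow> (real^'n::finite) set set" where
  "cells F = (\<lambda>x. {y \<in> unit_cube. \<forall>\<phi>\<in>F. \<phi> y = \<phi> x}) ` unit_cube"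

text \<open>The sample point is arbitrary; the value is meaningful when \<open>g\<close> is constant
  on \<open>A\<close>.\<close>

definition cell_value :: "('a \<Rightarrow> real) \<Rightarrow> 'a set \<Rightarrow> real" where
  "cell_value g A = g (SOME x. x \<in> A)"

lemma cells_disjoint: "disjoint_family_on (\<lambda>A. A) (cells F)"
  unfolding disjoint_family_on_def
proof (intro ballI impI, rule ccontr)
  fix A B assume AB: "A \<in> cells F" "B \<in> cells F" "A \<noteq> B" "A \<inter> B \<noteq> {}"
  obtain x where x: "A = {y \<in> unit_cube. \<forall>\<phi>\<in>F. \<phi> y = \<phi> x}" using AB(1) by (auto simp: cells_def)
  obtain x' where x': "B = {y \<in> unit_cube. \<forall>\<phi>\<in>F. \<phi> y = \<phi> x'}" using AB(2) by (auto simp: cells_def)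
  obtain y where "y \<in> A" "y \<in> B" using AB(4) by blast
  then have y: "\<And>\<phi>. \<phi> \<in> F \<Longrightarrow> \<phi> y = \<phi> x" "\<And>\<phi>. \<phi> \<in> F \<Longrightarrow> \<phi> y = \<phi> x'" unfolding x x' by simp_all
  have "\<forall>\<phi>\<in>F. \<phi> x = \<phi> x'" using y by metis
  then have "A = B" unfolding x x' by auto
  then show False using AB(3) by simp
qed

lemma Union_cells: "\<Union>(cells F) = unit_cube"
  by (auto simp: cells_def)

lemma finite_cells:
  assumes "finite F" "\<And>\<phi>. \<phi> \<in> F \<Longrightarrow> cube_simple \<phi>"
  shows "finite (cells F)"
proof -
  let ?P = "Pi\<^sub>E F (\<lambda>\<phi>. \<phi> ` unit_cube)"
  have "finite ?P" using assms by (intro finite_PiE) (auto simp: cube_simple_def)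
  moreover have "cells F \<subseteq> (\<lambda>v. {y \<in> unit_cube. \<forall>\<phi>\<in>F. \<phi> y = v \<phi>}) ` ?P"
  proof
    fix A assume "A \<in> cells F"
    then obtain x where x: "x \<in> unit_cube" "A = {y \<in> unit_cube. \<forall>\<phi>\<in>F. \<phi> y = \<phi> x}" by (auto simp: cells_def)
    then show "A \<in> (\<lambda>v. {y \<in> unit_cube. \<forall>\<phi>\<in>F. \<phi> y = v \<phi>}) ` ?P"
      by (intro image_eqI[of _ _ "restrict (\<lambda>\<phi>. \<phi> x) F"]) auto
  qed
  ultimately show ?thesis by (meson finite_imageI finite_subset)
qed

lemma cells_cube_borel:
  assumes "finite F" "\<And>\<phi>. \<phi> \<in> F \<Longrightarrow> cube_simple \<phi>" "A \<in> cells F"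
  shows "A \<in> cube_borel"
proof -
  obtain x where x: "x \<in> unit_cube" "A = {y \<in> unit_cube. \<forall>\<phi>\<in>F. \<phi> y = \<phi> x}" using assms(3) by (auto simp: cells_def)
  have "A = unit_cube \<inter> (\<Inter>\<phi>\<in>F. if \<phi> \<in> F then \<phi> -` {\<phi> x} \<inter> unit_cube else UNIV)"
    using x by auto
  also have "\<dots> \<in> sets borel"
  proof (cases "F = {}")
    case False
    then show ?thesis using assms(1,2)
      by (intro sets.Int sets.finite_INT) (auto simp: cube_simple_def unit_cube_def)
  qed (simp add: unit_cube_def)
  finally show ?thesis using x by (auto simp: cube_borel_def)
qed

lemma cell_value_eq:
  assumes "A \<in> cells F" "x \<in> A" "\<And>x y. x \<in> unit_cube \<Longrightarrow> y \<in> unit_cube \<Longrightarrow> (\<And>\<phi>. \<phi> \<in> F \<Longrightarrow> \<phi> x = \<phi> y) \<Longrightarrow> g x = g y"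
  shows "g x = cell_value g A"
  unfolding cell_value_def
proof (rule someI2[of "\<lambda>x. x \<in> A" x], rule assms(2))
  fix y assume "y \<in> A"
  then show "g x = g y" using assms(1,2) by (intro assms(3)) (auto simp: cells_def)
qed

lemma level_set_cells:
  assumes "\<And>x y. x \<in> unit_cube \<Longrightarrow> y \<in> unit_cube \<Longrightarrow> (\<And>\<phi>. \<phi> \<in> F \<Longrightarrow> \<phi> x = \<phi> y) \<Longrightarrow> g x = g y"
  shows "g -` {c} \<inter> unit_cube = \<Union>{A \<in> cells F. cell_value g A = c}"
proof -
  have v: "g x = cell_value g A" if "A \<in> cells F" "x \<in> A" for A x
    using that assms by (rule cell_value_eq)
  show ?thesis
  proof (intro equalityI subsetI)
    fix x assume x: "x \<in> g -` {c} \<inter> unit_cube"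
    then obtain A where "A \<in> cells F" "x \<in> A" using Union_cells[of F] by auto
    then show "x \<in> \<Union>{A \<in> cells F. cell_value g A = c}" using v x by auto
  next
    fix x assume "x \<in> \<Union>{A \<in> cells F. cell_value g A = c}"
    then show "x \<in> g -` {c} \<inter> unit_cube" using v Union_cells[of F] by auto
  qed
qed

lemma image_unit_cube_cells:
  assumes "\<And>x y. x \<in> unit_cube \<Longrightarrow> y \<in> unit_cube \<Longrightarrow> (\<And>\<phi>. \<phi> \<in> F \<Longrightarrow> \<phi> x = \<phi> y) \<Longrightarrow> g x = g y"
  shows "g ` unit_cube = cell_value g ` cells F"
proof -
  have v: "g x = cell_value g A" if "A \<in> cells F" "x \<in> A" for A x
    using that assms by (rule cell_value_eq)
  have ne: "A \<noteq> {}" if "A \<in> cells F" for A using that by (auto simp: cells_def)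
  show ?thesis
  proof (intro equalityI subsetI)
    fix c assume "c \<in> g ` unit_cube"
    then obtain x where x: "x \<in> unit_cube" "c = g x" by blast
    then obtain A where "A \<in> cells F" "x \<in> A" using Union_cells[of F] by blast
    with x show "c \<in> cell_value g ` cells F" using v by auto
  next
    fix c assume "c \<in> cell_value g ` cells F"
    then obtain A where A: "A \<in> cells F" "c = cell_value g A" by auto
    then obtain x where x: "x \<in> A" using ne by auto
    then have "c = g x" "x \<in> unit_cube" using v[OF A(1) x] A Union_cells[of F] by auto
    then show "c \<in> g ` unit_cube" by auto
  qed
qed

lemma cube_simple_cells:
  assumes F: "finite F" "\<And>\<phi>. \<phi> \<in> F \<Longrightarrow> cube_simple \<phi>"
    and g: "\<And>x y. x \<in> unit_cube \<Longrightarrow> y \<in> unit_cube \<Longrightarrow> (\<And>\<phi>. \<phi> \<in> F \<Longrightarrow> \<phi> x = \<phi> y) \<Longrightarrow> g x = g y"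
  shows "cube_simple g"
  unfolding cube_simple_def
proof (intro conjI allI)
  have "g ` unit_cube = cell_value g ` cells F" by (rule image_unit_cube_cells) (rule g)
  then show "finite (g ` unit_cube)" using finite_cells[OF F] by (simp only: finite_imageI)
  fix c
  have "g -` {c} \<inter> unit_cube = \<Union>{A \<in> cells F. cell_value g A = c}" by (rule level_set_cells) (rule g)
  also have "\<dots> \<in> sets borel"
    using finite_cells[OF F] cells_cube_borel[OF F] by (intro sets.finite_Union) (auto simp: cube_borel_def)
  finally show "g -` {c} \<inter> unit_cube \<in> sets borel" .
qed

lemma cube_simple_linear:
  assumes "finite I" "\<And>i. i \<in> I \<Longrightarrow> cube_simple (\<phi> i)"
  shows "cube_simple (\<lambda>x. \<Sum>i\<in>I. a i * \<phi> i x)"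
  by (rule cube_simple_cells[of "\<phi> ` I"]) (use assms in \<open>auto intro!: sum.cong\<close>)

context SM
begin

text \<open>Continuity at the empty set gives exhaustivity: a disjoint sequence consists of
  differences of consecutive tails, and the tails decrease to the empty set.\<close>

lemma bounded_range: "bounded_on unit_cube (space M)"
proof (rule exhaustive_imp_bounded)
  fix A :: "nat \<Rightarrow> (real^'n) set" and e :: real
  assume A: "\<And>n. A n \<in> cube_borel" "disjoint_family A" and e: "e > 0"
  define T where "T n = (\<Union>m\<in>{n..}. A m)" for n
  have T: "T n \<in> cube_borel" for n
  proof -
    have "T n \<in> sets borel" unfolding T_def using A(1) by (intro sets.countable_UN') (auto simp: cube_borel_def)
    moreover have "T n \<subseteq> unit_cube" unfolding T_def using A(1) by (auto simp: cube_borel_def)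
    ultimately show ?thesis by (simp add: cube_borel_def)
  qed
  have TS: "T n = A n \<union> T (Suc n)" for n
  proof -
    have "{n..} = insert n {Suc n..}" by auto
    then show ?thesis unfolding T_def by simp
  qed
  have TA: "A n \<inter> T (Suc n) = {}" for n
  proof -
    have "A n \<inter> A m = {}" if "m \<in> {Suc n..}" for m
      using that by (intro disjoint_family_onD[OF A(2)]) auto
    then show ?thesis unfolding T_def by blast
  qed
  have dec: "decseq T" by (rule decseq_SucI) (subst (2) TS, blast)
  have emp: "(\<Inter>n. T n) = {}"
  proof (rule ccontr)
    assume "(\<Inter>n. T n) \<noteq> {}"
    then obtain y where y: "\<And>n. y \<in> T n" by blast
    from y[of 0] obtain m where m: "y \<in> A m" unfolding T_def by blast
    then show False using y[of "Suc m"] TA[of m] by blast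
  qed
  \<comment> \<open>If |A| is at least \<open>e\<close>, one of the two tails has modulus at least
    e/2. The smaller e/3 turns this into the strict inequality used by
    \<open>conv_in_prob\<close>.\<close>
  have e3: "e / 3 > 0" using e by simp
  have "conv_in_prob M (\<lambda>n. \<mu> (T n)) (\<lambda>w. 0)"
    using SM T dec emp unfolding stochastic_measure_def by blast
  then have lim: "(\<lambda>n. prob {w \<in> space M. \<bar>\<mu> (T n) w - 0\<bar> > e / 3}) \<longlonglongrightarrow> 0"
    using e3 unfolding conv_in_prob_def by blast
  let ?p = "\<lambda>n. prob {w \<in> space M. \<bar>\<mu> (T n) w - 0\<bar> > e / 3}"
  have ev: "{w \<in> space M. \<bar>\<mu> (T n) w - 0\<bar> > e / 3} \<in> events" for n
  proof -
    have "(\<lambda>w. \<bar>\<mu> (T n) w - 0\<bar>) \<in> borel_measurable M"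
      by (intro borel_measurable_abs borel_measurable_diff measurable T borel_measurable_const)
    then show ?thesis by measurable
  qed
  have le: "prob (big (A n) e) \<le> ?p n + ?p (Suc n)" for n
  proof -
    have "AE w in M. \<mu> (T n) w = \<mu> (A n) w + \<mu> (T (Suc n)) w"
      using additive[OF A(1)[of n] T[of "Suc n"] TA[of n]] unfolding TS[of n, symmetric] .
    then have "AE w in M. w \<in> big (A n) e \<longrightarrow>
      w \<in> {w \<in> space M. \<bar>\<mu> (T n) w - 0\<bar> > e / 3} \<union> {w \<in> space M. \<bar>\<mu> (T (Suc n)) w - 0\<bar> > e / 3}"
    proof eventually_elim
      case (elim w)
      have "e / 3 < \<bar>t\<bar> \<or> e / 3 < \<bar>s\<bar>" if "e \<le> \<bar>a\<bar>" "t = a + s" for a t s :: real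
        using that e by linarith
      from this[OF _ elim] show ?case by (simp add: big_def)
    qed
    then have "prob (big (A n) e) \<le> prob ({w \<in> space M. \<bar>\<mu> (T n) w - 0\<bar> > e / 3} \<union> {w \<in> space M. \<bar>\<mu> (T (Suc n)) w - 0\<bar> > e / 3})"
      using ev by (intro finite_measure_mono_AE sets.Un)
    also have "\<dots> \<le> ?p n + ?p (Suc n)" using ev by (intro measure_Un_le)
    finally show ?thesis .
  qed
  have "(\<lambda>n. ?p n + ?p (Suc n)) \<longlonglongrightarrow> 0 + 0"
    by (intro tendsto_add lim LIMSEQ_Suc[OF lim])
  then have upper: "(\<lambda>n. ?p n + ?p (Suc n)) \<longlonglongrightarrow> 0" by simp
  show "(\<lambda>n. prob (big (A n) e)) \<longlonglongrightarrow> 0"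
    by (rule tendsto_sandwich[OF _ _ tendsto_const upper]) (use le in \<open>simp_all\<close>)
qed

lemma sm_simple_int_measurable:
  assumes "cube_simple g"
  shows "sm_simple_int \<mu> g \<in> borel_measurable M"
proof -
  have "g -` {c} \<inter> unit_cube \<in> cube_borel" for c
    using assms by (auto simp: cube_simple_def cube_borel_def)
  then have "(\<lambda>w. \<Sum>c\<in>g ` unit_cube. c * \<mu> (g -` {c} \<inter> unit_cube) w) \<in> borel_measurable M"
    by (intro borel_measurable_sum borel_measurable_times measurable) auto
  then show ?thesis unfolding sm_simple_int_def[abs_def] .
qed

text \<open>The quantifier over \<open>g\<close> stands inside: the null set comes from the
  partition alone. Uncountably many integrands built from the same finite family can therefore be
  treated at one sample point, which the paths in \<open>z\<close> require.\<close>

lemma sm_simple_int_cells: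
  assumes F: "finite F" "\<And>\<phi>. \<phi> \<in> F \<Longrightarrow> cube_simple \<phi>"
  shows "AE w in M. \<forall>g. (\<forall>x\<in>unit_cube. \<forall>y\<in>unit_cube. (\<forall>\<phi>\<in>F. \<phi> x = \<phi> y) \<longrightarrow> g x = g y) \<longrightarrow>
     sm_simple_int \<mu> g w = (\<Sum>A\<in>cells F. cell_value g A * \<mu> A w)"
proof -
  have fin: "finite (cells F)" by (rule finite_cells[OF F])
  have "AE w in M. \<forall>S\<subseteq>cells F. \<mu> (\<Union>A\<in>S. A) w = (\<Sum>A\<in>S. \<mu> A w)"
    by (rule additive_family[OF fin cells_cube_borel[OF F] cells_disjoint])
  then show ?thesis
  proof eventually_elim
    case (elim w)
    show ?case
    proof (intro allI impI)
      fix g :: "real^'n \<Rightarrow> real"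
      assume g0: "\<forall>x\<in>unit_cube. \<forall>y\<in>unit_cube. (\<forall>\<phi>\<in>F. \<phi> x = \<phi> y) \<longrightarrow> g x = g y"
      then have g: "\<And>x y. x \<in> unit_cube \<Longrightarrow> y \<in> unit_cube \<Longrightarrow> (\<And>\<phi>. \<phi> \<in> F \<Longrightarrow> \<phi> x = \<phi> y) \<Longrightarrow> g x = g y" by blast
      have im: "g ` unit_cube = cell_value g ` cells F" by (rule image_unit_cube_cells) (rule g)
      have ls: "g -` {c} \<inter> unit_cube = \<Union>{A \<in> cells F. cell_value g A = c}" for c by (rule level_set_cells) (rule g)
      have "sm_simple_int \<mu> g w = (\<Sum>c\<in>cell_value g ` cells F. c * \<mu> (\<Union>{A \<in> cells F. cell_value g A = c}) w)"
        unfolding sm_simple_int_def im ls ..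
      also have "\<dots> = (\<Sum>c\<in>cell_value g ` cells F. \<Sum>A\<in>{A \<in> cells F. cell_value g A = c}. cell_value g A * \<mu> A w)"
      proof (intro sum.cong refl)
        fix c
        have "\<mu> (\<Union>A\<in>{A \<in> cells F. cell_value g A = c}. A) w = (\<Sum>A\<in>{A \<in> cells F. cell_value g A = c}. \<mu> A w)"
          by (rule elim[rule_format]) blast
        then show "c * \<mu> (\<Union>{A \<in> cells F. cell_value g A = c}) w
          = (\<Sum>A\<in>{A \<in> cells F. cell_value g A = c}. cell_value g A * \<mu> A w)"
          by (simp add: sum_distrib_left)
      qed
      also have "\<dots> = (\<Sum>A\<in>cells F. cell_value g A * \<mu> A w)"
        by (rule sum.group) (use fin in auto)
      finally show "sm_simple_int \<mu> g w = (\<Sum>A\<in>cells F. cell_value g A * \<mu> A w)" .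
    qed
  qed
qed

lemma sm_simple_int_linear:
  assumes I: "finite I" "\<And>i. i \<in> I \<Longrightarrow> cube_simple (\<phi> i)"
  shows "AE w in M. \<forall>a. sm_simple_int \<mu> (\<lambda>x. \<Sum>i\<in>I. a i * \<phi> i x) w = (\<Sum>i\<in>I. a i * sm_simple_int \<mu> (\<phi> i) w)"
proof -
  let ?F = "\<phi> ` I"
  have "AE w in M. \<forall>g. (\<forall>x\<in>unit_cube. \<forall>y\<in>unit_cube. (\<forall>\<phi>\<in>?F. \<phi> x = \<phi> y) \<longrightarrow> g x = g y) \<longrightarrow>
     sm_simple_int \<mu> g w = (\<Sum>A\<in>cells ?F. cell_value g A * \<mu> A w)"
    using I by (intro sm_simple_int_cells) auto
  then show ?thesis
  proof eventually_elim
    case (elim w)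
    show ?case
    proof
      fix a
      have "sm_simple_int \<mu> (\<lambda>x. \<Sum>i\<in>I. a i * \<phi> i x) w = (\<Sum>A\<in>cells ?F. cell_value (\<lambda>x. \<Sum>i\<in>I. a i * \<phi> i x) A * \<mu> A w)"
        by (rule elim[rule_format]) (auto intro!: sum.cong)
      also have "\<dots> = (\<Sum>A\<in>cells ?F. \<Sum>i\<in>I. a i * (cell_value (\<phi> i) A * \<mu> A w))"
        by (simp add: cell_value_def sum_distrib_right mult.assoc)
      also have "\<dots> = (\<Sum>i\<in>I. a i * (\<Sum>A\<in>cells ?F. cell_value (\<phi> i) A * \<mu> A w))"
        by (subst sum.swap) (simp add: sum_distrib_left)
      also have "\<dots> = (\<Sum>i\<in>I. a i * sm_simple_int \<mu> (\<phi> i) w)"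
      proof (intro sum.cong refl)
        fix i assume i: "i \<in> I"
        have "sm_simple_int \<mu> (\<phi> i) w = (\<Sum>A\<in>cells ?F. cell_value (\<phi> i) A * \<mu> A w)"
          by (rule elim[rule_format]) (use i in auto)
        then show "a i * (\<Sum>A\<in>cells ?F. cell_value (\<phi> i) A * \<mu> A w) = a i * sm_simple_int \<mu> (\<phi> i) w" by simp
      qed
      finally show "sm_simple_int \<mu> (\<lambda>x. \<Sum>i\<in>I. a i * \<phi> i x) w = (\<Sum>i\<in>I. a i * sm_simple_int \<mu> (\<phi> i) w)" .
    qed
  qed
qed

text \<open>Continuity of integration for the uniform norm: \<open>K\<close> depends on
  \<open>e\<close> only, neither on \<open>g\<close> nor on the number of its values.\<close>

lemma sm_simple_int_tight:
  assumes e: "e > 0"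
  obtains K where "0 < K" "\<And>g \<delta>. cube_simple g \<Longrightarrow> 0 < \<delta> \<Longrightarrow> (\<And>x. x \<in> unit_cube \<Longrightarrow> \<bar>g x\<bar> \<le> \<delta>) \<Longrightarrow>
    prob {w \<in> space M. \<delta> * K \<le> \<bar>sm_simple_int \<mu> g w\<bar>} \<le> e"
proof -
  obtain K where K: "0 < K" "\<And>(I :: (real^'n) set set) A a \<delta>. finite I \<Longrightarrow> (\<And>i. i \<in> I \<Longrightarrow> A i \<in> cube_borel) \<Longrightarrow> disjoint_family_on A I \<Longrightarrow>
     (\<And>i. i \<in> I \<Longrightarrow> \<bar>a i\<bar> \<le> \<delta>) \<Longrightarrow> 0 < \<delta> \<Longrightarrow>
     prob {w \<in> space M. \<delta> * K \<le> \<bar>\<Sum>i\<in>I. a i * \<mu> (A i) w\<bar>} \<le> e"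
    apply (rule convex_combination_tight[OF bounded_range e, where 'i="(real^'n) set"])
    subgoal premises p for K by (rule p(1)[OF p(2,3)])
    done
  show ?thesis
  proof (rule that[OF K(1)])
    fix g :: "real^'n \<Rightarrow> real" and \<delta> :: real
    assume g: "cube_simple g" "0 < \<delta>" "\<And>x. x \<in> unit_cube \<Longrightarrow> \<bar>g x\<bar> \<le> \<delta>"
    let ?C = "cells {g}"
    have F: "finite {g}" "\<And>\<phi>. \<phi> \<in> {g} \<Longrightarrow> cube_simple \<phi>" using g by auto
    let ?s = "\<lambda>w. \<Sum>A\<in>?C. cell_value g A * \<mu> A w"
    have "(\<lambda>w. ?s w) \<in> borel_measurable M"
      by (intro borel_measurable_sum borel_measurable_times measurable cells_cube_borel[OF F]) auto
    then have ev: "{w \<in> space M. \<delta> * K \<le> \<bar>?s w\<bar>} \<in> events" by measurable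
    have "AE w in M. w \<in> {w \<in> space M. \<delta> * K \<le> \<bar>sm_simple_int \<mu> g w\<bar>} \<longrightarrow> w \<in> {w \<in> space M. \<delta> * K \<le> \<bar>?s w\<bar>}"
      using sm_simple_int_cells[of "{g}", simplified, OF g(1)]
    proof eventually_elim
      case (elim w)
      then have "sm_simple_int \<mu> g w = ?s w" by auto
      then show ?case by simp
    qed
    then have "prob {w \<in> space M. \<delta> * K \<le> \<bar>sm_simple_int \<mu> g w\<bar>} \<le> prob {w \<in> space M. \<delta> * K \<le> \<bar>?s w\<bar>}"
      using ev by (rule finite_measure_mono_AE)
    also have "\<dots> \<le> e"
    proof (rule K(2)[of ?C "\<lambda>A. A" "cell_value g" \<delta>])
      show "finite ?C" by (rule finite_cells[OF F])
      show "disjoint_family_on (\<lambda>A. A) ?C" by (rule cells_disjoint)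
      show "\<bar>cell_value g A\<bar> \<le> \<delta>" if "A \<in> ?C" for A
      proof -
        have "cell_value g A \<in> g ` unit_cube"
          using image_unit_cube_cells[of "{g}" g] that by auto
        then show ?thesis using g(3) by auto
      qed
    qed (use g(2) cells_cube_borel[OF F] in auto)
    finally show "prob {w \<in> space M. \<delta> * K \<le> \<bar>sm_simple_int \<mu> g w\<bar>} \<le> e" .
  qed
qed

section \<open>Square functions of families of simple functions\<close>

text \<open>The bound on the sum of absolute values makes all subsums simple functions bounded by
  \<delta>, hence uniformly tight, and \<open>bern_half_square_function\<close> converts tight
  subsums into a tight square function. The functions may overlap, as Haar functions of different
  levels do.\<close>

lemma sm_square_function_tight:
  assumes e: "e > 0" and \<delta>: "0 < \<delta>"
  obtains K where "0 < K" "\<And>(I :: 'i set) \<phi>. finite I \<Longrightarrow> (\<And>i. i \<in> I \<Longrightarrow> cube_simple (\<phi> i)) \<Longrightarrow>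
     (\<And>x. x \<in> unit_cube \<Longrightarrow> (\<Sum>i\<in>I. \<bar>\<phi> i x\<bar>) \<le> \<delta>) \<Longrightarrow>
     prob {w \<in> space M. K \<le> (\<Sum>i\<in>I. (sm_simple_int \<mu> (\<phi> i) w)\<^sup>2)} \<le> e"
proof -
  have e2: "e / 128 > 0" using e by simp
  obtain K0 where K0: "0 < K0" "\<And>g \<delta>. cube_simple g \<Longrightarrow> 0 < \<delta> \<Longrightarrow> (\<And>x. x \<in> unit_cube \<Longrightarrow> \<bar>g x\<bar> \<le> \<delta>) \<Longrightarrow>
    prob {w \<in> space M. \<delta> * K0 \<le> \<bar>sm_simple_int \<mu> g w\<bar>} \<le> e / 128"
    apply (rule sm_simple_int_tight[OF e2])
    subgoal premises p for K0 by (rule p(1)[OF p(2,3)])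
    done
  have dK: "0 < \<delta> * K0" using \<delta> K0(1) by simp
  show ?thesis
  proof (rule that[of "16 * (\<delta> * K0)\<^sup>2"])
    show "0 < 16 * (\<delta> * K0)\<^sup>2" using \<delta> K0(1) by simp
    fix I :: "'i set" and \<phi> :: "'i \<Rightarrow> real^'n \<Rightarrow> real"
    assume I: "finite I" "\<And>i. i \<in> I \<Longrightarrow> cube_simple (\<phi> i)"
      and s: "\<And>x. x \<in> unit_cube \<Longrightarrow> (\<Sum>i\<in>I. \<bar>\<phi> i x\<bar>) \<le> \<delta>"
    define x where "x w i = sm_simple_int \<mu> (\<phi> i) w" for w i
    define g where "g S y = (\<Sum>i\<in>I. of_bool (i \<in> S) * \<phi> i y)" for S and y :: "real^'n"
    have gs: "cube_simple (g S)" for S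
      unfolding g_def[abs_def] by (rule cube_simple_linear[OF I])
    have gb: "\<bar>g S y\<bar> \<le> \<delta>" if "y \<in> unit_cube" for S y
    proof -
      have "\<bar>g S y\<bar> \<le> (\<Sum>i\<in>I. \<bar>of_bool (i \<in> S) * \<phi> i y\<bar>)" unfolding g_def by (rule sum_abs)
      also have "\<dots> \<le> (\<Sum>i\<in>I. \<bar>\<phi> i y\<bar>)" by (intro sum_mono) auto
      finally show ?thesis using s[OF that] by simp
    qed
    let ?G = "{w \<in> space M. 16 * (\<delta> * K0)\<^sup>2 \<le> (\<Sum>i\<in>I. (sm_simple_int \<mu> (\<phi> i) w)\<^sup>2)}"
    let ?A = "\<lambda>S. {w \<in> space M. \<delta> * K0 \<le> \<bar>sm_simple_int \<mu> (g S) w\<bar>}"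
    have "(\<lambda>w. \<Sum>i\<in>I. (sm_simple_int \<mu> (\<phi> i) w)\<^sup>2) \<in> borel_measurable M"
      by (intro borel_measurable_sum borel_measurable_power sm_simple_int_measurable I)
    then have Gev: "?G \<in> events" by measurable
    have Aev: "?A S \<in> events" for S using sm_simple_int_measurable[OF gs[of S]] by measurable
    have "(1 / 128) * prob ?G \<le> bern (\<lambda>_. 1/2) I (\<lambda>S. prob (?A S))"
    proof (rule bern_prob_ge[where p="\<lambda>_. 1/2" and A="?A", OF I(1)])
      show "AE w in M. w \<in> ?G \<longrightarrow> 1 / 128 \<le> bern (\<lambda>_. 1/2) I (\<lambda>S. indicator (?A S) w)"
        using sm_simple_int_linear[of I \<phi>, OF I, simplified]
      proof eventually_elim
        case (elim w)
        show ?case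
        proof
          assume w: "w \<in> ?G"
          have "1 / 128 \<le> bern (\<lambda>_. 1/2) I (\<lambda>S. of_bool (\<delta> * K0 \<le> \<bar>\<Sum>i\<in>S. x w i\<bar>))"
            by (rule bern_half_square_function[OF I(1) dK]) (use w in \<open>auto simp: x_def\<close>)
          also have "\<dots> = bern (\<lambda>_. 1/2) I (\<lambda>S. indicator (?A S) w)"
          proof (rule bern_cong)
            fix S assume S: "S \<subseteq> I"
            have "sm_simple_int \<mu> (g S) w = (\<Sum>i\<in>I. of_bool (i \<in> S) * x w i)"
              unfolding g_def[abs_def] x_def by (rule elim[rule_format])
            also have "\<dots> = (\<Sum>i\<in>S. x w i)"
              using S I(1) by (intro sum.mono_neutral_cong_right) auto
            finally show "of_bool (\<delta> * K0 \<le> \<bar>\<Sum>i\<in>S. x w i\<bar>) = (indicator (?A S) w :: real)"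
              using w by (auto simp: indicator_def)
          qed
          finally show "1 / 128 \<le> bern (\<lambda>_. 1/2) I (\<lambda>S. indicator (?A S) w)" .
        qed
      qed
    qed (use Gev Aev in auto)
    also have "\<dots> \<le> e / 128"
      by (rule bern_le_const[OF I(1)]) (simp, rule K0(2)[OF gs \<delta> gb])
    finally show "prob ?G \<le> e" by simp
  qed
qed

text \<open>The square sums increase with \<open>n\<close> and share one tightness constant, so the
  event that some sum exceeds it is still of probability at most \<open>e\<close>; unboundedness is
  contained in all these events.\<close>

lemma square_function_bounded_AE:
  fixes I :: "nat \<Rightarrow> 'i set"
  assumes I: "\<And>n. finite (I n)" "incseq I" "\<And>n i. i \<in> I n \<Longrightarrow> cube_simple (\<phi> i)"
    and \<delta>: "0 < \<delta>" "\<And>n x. x \<in> unit_cube \<Longrightarrow> (\<Sum>i\<in>I n. \<bar>\<phi> i x\<bar>) \<le> \<delta>"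
  shows "AE w in M. \<exists>K. \<forall>n. (\<Sum>i\<in>I n. (sm_simple_int \<mu> (\<phi> i) w)\<^sup>2) \<le> K"
proof -
  define Y where "Y n w = (\<Sum>i\<in>I n. (sm_simple_int \<mu> (\<phi> i) w)\<^sup>2)" for n w
  have Ym [measurable]: "Y n \<in> borel_measurable M" for n
    unfolding Y_def using I(3) by (intro borel_measurable_sum borel_measurable_power sm_simple_int_measurable)
  have mono: "Y m w \<le> Y n w" if "m \<le> n" for m n w
    unfolding Y_def using incseqD[OF I(2) that] I(1) by (intro sum_mono2) auto
  define N where "N = {w \<in> space M. \<forall>k::nat. \<exists>n. real k \<le> Y n w}"
  have Nev: "N \<in> events" unfolding N_def by measurable
  have "prob N \<le> e" if e: "e > 0" for e
  proof -
      obtain K where K: "0 < K" "\<And>(I :: 'i set) \<phi>. finite I \<Longrightarrow> (\<And>i. i \<in> I \<Longrightarrow> cube_simple (\<phi> i)) \<Longrightarrow>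
     (\<And>x. x \<in> unit_cube \<Longrightarrow> (\<Sum>i\<in>I. \<bar>\<phi> i x\<bar>) \<le> \<delta>) \<Longrightarrow>
     prob {w \<in> space M. K \<le> (\<Sum>i\<in>I. (sm_simple_int \<mu> (\<phi> i) w)\<^sup>2)} \<le> e"
    apply (rule sm_square_function_tight[OF e \<delta>(1), where 'i='i])
    subgoal premises p for K by (rule p(1)[OF p(2,3)])
    done
    let ?E = "\<lambda>n. {w \<in> space M. K \<le> Y n w}"
    have "prob (?E n) \<le> e" for n unfolding Y_def using I \<delta> by (intro K(2)) auto
    moreover have "(\<lambda>n. prob (?E n)) \<longlonglongrightarrow> prob (\<Union>n. ?E n)"
    proof (intro finite_Lim_measure_incseq)
      show "incseq ?E" unfolding incseq_def using mono by (auto intro: order_trans)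
    qed auto
    ultimately have "prob (\<Union>n. ?E n) \<le> e" by (intro LIMSEQ_le_const2) auto
    moreover have "N \<subseteq> (\<Union>n. ?E n)"
    proof
      fix w assume w: "w \<in> N"
      obtain k :: nat where "K \<le> real k" using real_arch_simple by blast
      moreover obtain n where "real k \<le> Y n w" using w by (auto simp: N_def)
      ultimately show "w \<in> (\<Union>n. ?E n)" using w by (auto simp: N_def intro: order_trans)
    qed
    then have "prob N \<le> prob (\<Union>n. ?E n)" by (intro finite_measure_mono) auto
    ultimately show ?thesis by simp
  qed
  then have "prob N \<le> 0" by (rule field_le_epsilon[where y=0, simplified])
  then have "prob N = 0" using measure_nonneg[of M N] by linarith
  then have "AE w in M. w \<notin> N" using Nev by (intro AE_not_in) (simp add: emeasure_eq_measure null_sets_def)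
  then show ?thesis
    using AE_space
  proof eventually_elim
    case (elim w)
    then obtain k :: nat where "\<And>n. Y n w < real k" by (auto simp: N_def not_le)
    then show ?case unfolding Y_def by (intro exI[of _ "real k"]) (auto intro: less_imp_le)
  qed
qed

end

section \<open>Haar functions in one variable\<close>

lemma haar_level_eq:
  assumes "1 \<le> i" "i \<le> 2 ^ k"
  shows "haar_level (2 ^ k + i) = k"
  unfolding haar_level_def
proof (rule Least_equality)
  show "2 ^ k + i \<le> 2 ^ (k + 1)" using assms by simp
  fix j assume j: "2 ^ k + i \<le> (2::nat) ^ (j + 1)"
  then have "(2::nat) ^ k < 2 ^ (j + 1)" using assms by linarith
  then have "k < j + 1" by (rule power_less_imp_less_exp[rotated]) simp
  then show "k \<le> j" by simp
qed

lemma haar_level_1 [simp]: "haar_level (Suc 0) = 0"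
  unfolding haar_level_def by (rule Least_equality) auto

text \<open>Positions are counted from 0 here, while the definition of the Haar functions counts
  them from 1; this is the source of the recurring \<open>+ 1\<close>.\<close>

lemma dyadic_index_cases:
  fixes n :: nat
  assumes "1 \<le> n"
  obtains "n = 1" | k i where "n = 2 ^ k + i + 1" "i < 2 ^ k"
proof (cases "n = 1")
  case False
  define k where "k = (GREATEST k. 2 ^ k < n)"
  have ex: "2 ^ (0::nat) < n" using assms False by (cases n) auto
  have bound: "\<forall>k. 2 ^ k < n \<longrightarrow> k \<le> n"
  proof (intro allI impI)
    fix k :: nat assume "2 ^ k < n"
    with less_exp[of k] show "k \<le> n" by linarith
  qed
  have k: "2 ^ k < n" unfolding k_def by (rule GreatestI_nat[where P="\<lambda>k. 2 ^ k < n", OF ex]) (use bound in auto)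
  have "\<not> 2 ^ (Suc k) < n"
    using Greatest_le_nat[where P="\<lambda>k. 2 ^ k < n" and k="Suc k" and b=n] bound unfolding k_def[symmetric] by auto
  then show ?thesis using that(2)[of k "n - 2 ^ k - 1"] k by simp
qed (use that in auto)

text \<open>The indicator of \<open>[a, b]\<close> with the value at the end points inside \<open>(0, 1)\<close> replaced by the average of the
  one-sided limits.\<close>
definition reg_indicator :: "real \<Rightarrow> real \<Rightarrow> real \<Rightarrow> real" where
  "reg_indicator a b x = (if a < x \<and> x < b then 1
     else if x = a then (if a = 0 then 1 else 1 / 2)
     else if x = b then (if b = 1 then 1 else 1 / 2) else 0)"

definition dyadic_indicator :: "nat \<Rightarrow> nat \<Rightarrow> real \<Rightarrow> real" where
  "dyadic_indicator k i = reg_indicator (real i / 2 ^ k) (real (i + 1) / 2 ^ k)"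

text \<open>At the inner point \<open>m\<close> both halves have value 1/2: the averaging convention
  makes the identity hold at every point, including the jumps, which a stochastic measure may
  charge.\<close>

lemma reg_indicator_split:
  assumes "a < m" "m < b" "0 \<le> a" "b \<le> 1"
  shows "reg_indicator a b x = reg_indicator a m x + reg_indicator m b x"
  using assms by (auto simp: reg_indicator_def)

lemma dyadic_indicator_split:
  assumes "i < 2 ^ k"
  shows "dyadic_indicator k i x = dyadic_indicator (Suc k) (2 * i) x + dyadic_indicator (Suc k) (2 * i + 1) x"
proof -
  have b: "real (i + 1) / 2 ^ k \<le> 1"
  proof -
    have "i + 1 \<le> 2 ^ k" using assms by simp
    then have "real (i + 1) \<le> 2 ^ k" by (metis of_nat_le_iff of_nat_numeral of_nat_power)
    then show ?thesis by simp
  qed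
  have "real (2 * i) / 2 ^ Suc k = real i / 2 ^ k" "real (2 * i + 1 + 1) / 2 ^ Suc k = real (i + 1) / 2 ^ k"
    by (simp_all add: field_simps)
  moreover have "real i / 2 ^ k < real (2 * i + 1) / 2 ^ Suc k" "real (2 * i + 1) / 2 ^ Suc k < real (i + 1) / 2 ^ k"
    by (simp_all add: field_simps)
  ultimately show ?thesis unfolding dyadic_indicator_def
    using reg_indicator_split[of "real i / 2 ^ k" "real (2 * i + 1) / 2 ^ Suc k" "real (i + 1) / 2 ^ k" x] b by simp
qed

lemma haar_dyadic:
  assumes "i < 2 ^ k"
  shows "haar (2 ^ k + i + 1) x =
     sqrt (2 ^ k) * (dyadic_indicator (Suc k) (2 * i) x - dyadic_indicator (Suc k) (2 * i + 1) x)"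
proof -
  define a m b where "a = real i / 2 ^ k" and "m = real (2 * i + 1) / 2 ^ Suc k" and "b = real (i + 1) / 2 ^ k"
  have am: "a < m" "m < b" by (simp_all add: a_def m_def b_def field_simps)
  have a0: "0 \<le> a" by (simp add: a_def)
  have b1: "b \<le> 1"
  proof -
    have "i + 1 \<le> 2 ^ k" using assms by simp
    then have "real (i + 1) \<le> 2 ^ k" by (metis of_nat_le_iff of_nat_numeral of_nat_power)
    then show ?thesis by (simp add: b_def)
  qed
  have lev: "haar_level (2 ^ k + i + 1) = k"
    using haar_level_eq[of "i + 1" k] assms by (simp add: add.assoc)
  have n: "2 ^ k + i + 1 \<noteq> (1::nat)" "2 ^ k + i + 1 \<noteq> (0::nat)" by simp_all
  have i: "2 ^ k + i + 1 - 2 ^ k = i + 1" by simp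
  have e: "(real (i + 1) - 1) / 2 ^ k = a" "(2 * real (i + 1) - 1) / 2 ^ (k + 1) = m" "real (i + 1) / 2 ^ k = b"
    by (simp_all add: a_def m_def b_def)
  have d: "dyadic_indicator (Suc k) (2 * i) = reg_indicator a m" "dyadic_indicator (Suc k) (2 * i + 1) = reg_indicator m b"
  proof -
    have "real (2 * i) / 2 ^ Suc k = a" "real (2 * i + 1) / 2 ^ Suc k = m" "real (2 * i + 1 + 1) / 2 ^ Suc k = b"
      by (simp_all add: a_def m_def b_def field_simps)
    then show "dyadic_indicator (Suc k) (2 * i) = reg_indicator a m" "dyadic_indicator (Suc k) (2 * i + 1) = reg_indicator m b"
      unfolding dyadic_indicator_def by simp_all
  qed
  show ?thesis
    unfolding haar_def Let_def lev i e d if_not_P[OF n(1)] if_not_P[OF n(2)]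
    using am a0 b1 unfolding reg_indicator_def by auto
qed

lemma dyadic_indicator_nonneg: "0 \<le> dyadic_indicator k i x"
  by (simp add: dyadic_indicator_def reg_indicator_def)

lemma dyadic_indicator_supp:
  "dyadic_indicator k i x \<noteq> 0 \<Longrightarrow> real i / 2 ^ k \<le> x \<and> x \<le> real (i + 1) / 2 ^ k"
  by (auto simp: dyadic_indicator_def reg_indicator_def split: if_splits intro: divide_right_mono)

lemma sum_double: "(\<Sum>i<2 * n. f i) = (\<Sum>i<n. f (2 * i) + f (2 * i + 1))" for f :: "nat \<Rightarrow> real"
  by (induction n) (auto simp: algebra_simps)

lemma sum_dyadic_indicator:
  assumes "0 \<le> x" "x \<le> 1"
  shows "(\<Sum>i<2 ^ k. dyadic_indicator k i x) = 1"
proof (induction k)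
  case 0
  then show ?case using assms by (auto simp: dyadic_indicator_def reg_indicator_def)
next
  case (Suc k)
  have "(\<Sum>i<2 ^ Suc k. dyadic_indicator (Suc k) i x)
    = (\<Sum>i<2 ^ k. dyadic_indicator (Suc k) (2 * i) x + dyadic_indicator (Suc k) (2 * i + 1) x)"
    using sum_double[of "\<lambda>i. dyadic_indicator (Suc k) i x" "2 ^ k"] by simp
  also have "\<dots> = (\<Sum>i<2 ^ k. dyadic_indicator k i x)"
    by (intro sum.cong refl) (simp only: lessThan_iff dyadic_indicator_split)
  finally show ?case using Suc by simp
qed

lemma sum_dyadic_index:
  fixes f :: "nat \<Rightarrow> real"
  shows "(\<Sum>n\<in>{1..2 ^ Suc k}. f n) = (\<Sum>n\<in>{1..2 ^ k}. f n) + (\<Sum>i<2 ^ k. f (2 ^ k + i + 1))"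
proof -
  have "(\<Sum>n\<in>{1..2 ^ k + 2 ^ k}. f n) = (\<Sum>n\<in>{1..2 ^ k}. f n) + (\<Sum>n\<in>{2 ^ k + 1..2 ^ k + 2 ^ k}. f n)"
    by (rule sum.ub_add_nat) simp
  also have "(\<Sum>n\<in>{2 ^ k + 1..2 ^ k + 2 ^ k}. f n) = (\<Sum>i<2 ^ k. f (2 ^ k + i + 1))"
    by (rule sum.reindex_bij_witness[of _ "\<lambda>i. 2 ^ k + i + 1" "\<lambda>n. n - 2 ^ k - 1"]) auto
  finally show ?thesis by (simp add: mult_2)
qed

text \<open>The Dirichlet kernel of the Haar system is the kernel of averaging over dyadic
  intervals. Each new level refines it by (a - b)(c - d) + (a + b)(c + d) = 2 (a c + b d).\<close>

lemma haar_kernel: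
  assumes "0 \<le> x" "x \<le> 1" "0 \<le> y" "y \<le> 1"
  shows "(\<Sum>n\<in>{1..2 ^ K}. haar n x * haar n y) = 2 ^ K * (\<Sum>i<2 ^ K. dyadic_indicator K i x * dyadic_indicator K i y)"
proof (induction K)
  case 0
  then show ?case using assms by (auto simp: haar_def dyadic_indicator_def reg_indicator_def)
next
  case (Suc k)
  let ?r = "\<lambda>i. dyadic_indicator (Suc k) (2 * i) x" and ?r' = "\<lambda>i. dyadic_indicator (Suc k) (2 * i + 1) x"
  let ?s = "\<lambda>i. dyadic_indicator (Suc k) (2 * i) y" and ?s' = "\<lambda>i. dyadic_indicator (Suc k) (2 * i + 1) y"
  have "haar (2 ^ k + i + 1) x * haar (2 ^ k + i + 1) y + 2 ^ k * (dyadic_indicator k i x * dyadic_indicator k i y)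
    = 2 ^ Suc k * (?r i * ?s i + ?r' i * ?s' i)" if i: "i < 2 ^ k" for i
  proof -
    have "sqrt a * u * (sqrt a * v) = a * (u * v)" if "0 \<le> a" for a u v :: real
    proof -
      have "sqrt a * u * (sqrt a * v) = (sqrt a * sqrt a) * (u * v)" by (simp only: mult_ac)
      then show ?thesis using that by simp
    qed
    note sq = this
    have "sqrt q * (a - b) * (sqrt q * (c - d)) + q * ((a + b) * (c + d)) = 2 * q * (a * c + b * d)"
      if "0 \<le> q" for q a b c d :: real
      unfolding sq[OF that] by (simp add: algebra_simps)
    then show ?thesis unfolding haar_dyadic[OF i] dyadic_indicator_split[OF i] power_Suc by simp
  qed
  then have "(\<Sum>i<2 ^ k. haar (2 ^ k + i + 1) x * haar (2 ^ k + i + 1) y + 2 ^ k * (dyadic_indicator k i x * dyadic_indicator k i y))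
    = (\<Sum>i<2 ^ k. 2 ^ Suc k * (?r i * ?s i + ?r' i * ?s' i))"
    by (intro sum.cong refl) simp
  also have "\<dots> = 2 ^ Suc k * (\<Sum>i<2 ^ Suc k. dyadic_indicator (Suc k) i x * dyadic_indicator (Suc k) i y)"
    using sum_double[of "\<lambda>i. dyadic_indicator (Suc k) i x * dyadic_indicator (Suc k) i y" "2 ^ k"]
    by (simp add: sum_distrib_left)
  finally show ?case unfolding sum_dyadic_index Suc by (simp add: sum.distrib sum_distrib_left)
qed

text \<open>Each function of level \<open>k\<close> is dominated by 2^(k/2) times the regularized
  indicator of its interval, and these indicators form a partition of unity.\<close>

lemma sum_abs_haar_level:
  assumes "0 \<le> x" "x \<le> 1"
  shows "(\<Sum>i<2 ^ k. \<bar>haar (2 ^ k + i + 1) x\<bar>) \<le> sqrt (2 ^ k)"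
proof -
  have "(\<Sum>i<2 ^ k. \<bar>haar (2 ^ k + i + 1) x\<bar>) \<le> (\<Sum>i<2 ^ k. sqrt (2 ^ k) * dyadic_indicator k i x)"
  proof (rule sum_mono)
    fix i :: nat assume "i \<in> {..<2 ^ k}"
    then have i: "i < 2 ^ k" by simp
    have "\<bar>u - v\<bar> \<le> u + v" if "0 \<le> u" "0 \<le> v" for u v :: real using that by auto
    from this[OF dyadic_indicator_nonneg dyadic_indicator_nonneg]
    show "\<bar>haar (2 ^ k + i + 1) x\<bar> \<le> sqrt (2 ^ k) * dyadic_indicator k i x"
      unfolding haar_dyadic[OF i] dyadic_indicator_split[OF i] abs_mult by (intro mult_mono) auto
  qed
  also have "\<dots> = sqrt (2 ^ k)" using sum_dyadic_indicator[OF assms] by (simp add: sum_distrib_left[symmetric])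
  finally show ?thesis .
qed

section \<open>Supports of Haar functions\<close>

text \<open>The constant function \<open>n = 1\<close> is given level 0 and support [0, 1], so that
  product formulas cover it without a case distinction.\<close>

definition haar_lo :: "nat \<Rightarrow> real" where
  "haar_lo n = (if n = 1 then 0 else real (n - 2 ^ haar_level n - 1) / 2 ^ haar_level n)"

definition haar_hi :: "nat \<Rightarrow> real" where
  "haar_hi n = haar_lo n + 1 / 2 ^ haar_level n"

text \<open>The Haar function with value 0 at its discontinuities. Unlike \<open>haar n\<close> it is exactly odd
  under the reflection of its support.\<close>
definition haar0 :: "nat \<Rightarrow> real \<Rightarrow> real" where
  "haar0 n x = (if n = 1 then 1
     else if haar_lo n < x \<and> x < (haar_lo n + haar_hi n) / 2 then sqrt (2 ^ haar_level n)
     else if (haar_lo n + haar_hi n) / 2 < x \<and> x < haar_hi n then - sqrt (2 ^ haar_level n) else 0)"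

lemma haar_lo_less_mid: "haar_lo n < (haar_lo n + haar_hi n) / 2" "(haar_lo n + haar_hi n) / 2 < haar_hi n"
  by (simp_all add: haar_hi_def divide_strict_right_mono)

lemma haar_lo_hi:
  assumes "1 \<le> n"
  shows "0 \<le> haar_lo n" "haar_lo n < haar_hi n" "haar_hi n \<le> 1"
proof -
  show "0 \<le> haar_lo n" "haar_lo n < haar_hi n" by (auto simp: haar_lo_def haar_hi_def)
  show "haar_hi n \<le> 1"
    using assms
  proof (cases rule: dyadic_index_cases)
    case (2 k i)
    have lev: "haar_level n = k" using haar_level_eq[of "i + 1" k] 2 by (simp add: add.assoc)
    have "i + 1 \<le> 2 ^ k" using 2 by simp
    then have "real (i + 1) \<le> 2 ^ k" by (metis of_nat_le_iff of_nat_numeral of_nat_power)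
    then show ?thesis unfolding haar_lo_def haar_hi_def lev using 2 by (simp add: field_simps)
  qed (simp add: haar_lo_def haar_hi_def)
qed

lemma haar_eq_haar0:
  assumes n: "1 \<le> n" and x: "x \<noteq> haar_lo n" "x \<noteq> (haar_lo n + haar_hi n) / 2" "x \<noteq> haar_hi n"
  shows "haar n x = haar0 n x"
  using n
proof (cases rule: dyadic_index_cases)
  case (2 k i)
  have lev: "haar_level n = k" using haar_level_eq[of "i + 1" k] 2 by (simp add: add.assoc)
  have lo: "haar_lo n = real i / 2 ^ k" unfolding haar_lo_def lev using 2 by simp
  have hi: "haar_hi n = real (i + 1) / 2 ^ k" by (simp add: haar_hi_def lo lev add_divide_distrib)
  have "real i / q + real (i + 1) / q = real (2 * i + 1) / q" for q :: real
    unfolding add_divide_distrib[symmetric] by simp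
  then have mid: "(haar_lo n + haar_hi n) / 2 = real (2 * i + 1) / 2 ^ Suc k"
    unfolding lo hi power_Suc by (simp only: divide_divide_eq_left mult.commute)
  have e: "(real (i + 1) - 1) / 2 ^ k = haar_lo n" "(2 * real (i + 1) - 1) / 2 ^ (k + 1) = (haar_lo n + haar_hi n) / 2"
     "real (i + 1) / 2 ^ k = haar_hi n"
    subgoal unfolding lo by simp
    subgoal unfolding mid by simp
    subgoal unfolding hi by simp
    done
  have ni: "n - 2 ^ k = i + 1" "n \<noteq> 1" "n \<noteq> 0" using 2 by auto
  show ?thesis
    unfolding haar_def Let_def lev haar0_def ni(1) e if_not_P[OF ni(2)] if_not_P[OF ni(3)] using x by simp
qed (simp add: haar_def haar0_def)

lemma haar0_reflect: "n \<noteq> 1 \<Longrightarrow> haar0 n (haar_lo n + haar_hi n - x) = - haar0 n x"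
  by (auto simp: haar0_def field_simps)

lemma haar0_bound:
  assumes "x \<in> {0..1}"
  shows "\<bar>haar0 n x\<bar> \<le> sqrt (2 ^ haar_level n) * indicator {haar_lo n..haar_hi n} x"
proof (cases "n = 1")
  case True
  then show ?thesis using assms by (simp add: haar0_def haar_lo_def haar_hi_def indicator_def)
next
  case False
  then show ?thesis using haar_lo_less_mid[of n] by (auto simp: haar0_def indicator_def)
qed

lemma haar0_supp: "n \<noteq> 1 \<Longrightarrow> haar0 n x \<noteq> 0 \<Longrightarrow> x \<in> {haar_lo n..haar_hi n}"
  using haar_lo_less_mid[of n] by (auto simp: haar0_def split: if_splits)

lemma haar0_measurable [measurable]: "haar0 n \<in> borel_measurable borel"
  unfolding haar0_def[abs_def] by measurable

lemma haar_measurable [measurable]: "haar n \<in> borel_measurable borel"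
  unfolding haar_def[abs_def] Let_def by measurable

lemma haar_range: "finite (range (haar n))"
proof -
  let ?h = "sqrt (2 ^ haar_level n)"
  have "range (haar n) \<subseteq> {0, 1, ?h, - ?h, ?h / 2, - ?h / 2}"
    by (auto simp: haar_def Let_def)
  then show ?thesis by (rule finite_subset) simp
qed

section \<open>Decay of Haar coefficients\<close>

lemma mem_unit_cube: "x \<in> unit_cube \<longleftrightarrow> (\<forall>s. 0 \<le> x $ s \<and> x $ s \<le> 1)"
  unfolding unit_cube_def mem_box_cart by (simp add: cart_eq_inner_axis)

lemma unit_cube_borel [measurable]: "unit_cube \<in> sets borel"
  by (simp add: unit_cube_def)

text \<open>\<open>haar_coeff\<close> uses the gauge integral. For bounded Borel integrands it
  equals the Lebesgue integral, where invariance under reflections and dominated convergence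
  apply.\<close>

lemma integrable_unit_cube:
  fixes f :: "real^'n::finite \<Rightarrow> real"
  assumes m: "(\<lambda>x. indicator unit_cube x * f x) \<in> borel_measurable borel"
    and B: "\<And>x. x \<in> unit_cube \<Longrightarrow> \<bar>f x\<bar> \<le> B"
  shows "integrable lborel (\<lambda>x. indicator unit_cube x * f x)"
    and "integral unit_cube f = (\<integral>x. indicator unit_cube x * f x \<partial>lborel)"
proof -
  have ind: "integrable lborel (indicator (unit_cube :: (real^'n) set) :: _ \<Rightarrow> real)"
    unfolding unit_cube_def by (intro integrable_real_indicator) (auto intro: emeasure_lborel_cbox_finite)
  have "integrable lborel (\<lambda>x. B * indicator (unit_cube :: (real^'n) set) x)"
    using ind by (rule integrable_mult_right)
  then show int: "integrable lborel (\<lambda>x. indicator unit_cube x * f x)"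
  proof (rule Bochner_Integration.integrable_bound)
    show "AE x in lborel. norm (indicator unit_cube x * f x) \<le> norm (B * indicator unit_cube x)"
    proof (rule AE_I2)
      fix x :: "real^'n"
      show "norm (indicator unit_cube x * f x) \<le> norm (B * indicator unit_cube x)"
        using B[of x] by (cases "x \<in> unit_cube") (auto simp: abs_le_iff)
    qed
  qed (use m in simp)
  then have "set_integrable lborel unit_cube f"
    by (simp add: set_integrable_def)
  from set_borel_integral_eq_integral(2)[OF this]
  show "integral unit_cube f = (\<integral>x. indicator unit_cube x * f x \<partial>lborel)"
    by (simp add: set_lebesgue_integral_def)
qed

section \<open>Reflections and iterated differences\<close>

text \<open>Reflection in the hyperplane where coordinate \<open>s\<close> equals c/2.\<close>

definition reflect :: "'n \<Rightarrow> real \<Rightarrow> real^'n::finite \<Rightarrow> real^'n" where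
  "reflect s c x = (\<chi> t. if t = s then c - x $ t else x $ t)"

lemma reflect_nth: "reflect s c x $ t = (if t = s then c - x $ t else x $ t)"
  by (simp add: reflect_def)

lemma reflect_measurable [measurable]: "reflect (s :: 'n::finite) c \<in> borel_measurable borel"
  unfolding reflect_def[abs_def]
proof (intro borel_measurable_continuous_onI continuous_on_vec_lambda)
  fix t
  show "continuous_on UNIV (\<lambda>x :: real^'n. if t = s then c - x $ t else x $ t)"
    by (cases "t = s") (auto intro!: continuous_intros)
qed

text \<open>The map is affine and diagonal with entries 1 and -1, so its Jacobian factor is
  1.\<close>

lemma distr_reflect: "distr lborel borel (reflect s c) = (lborel :: (real^'n::finite) measure)"
proof -
  let ?c = "\<lambda>j :: real^'n. if j = axis s 1 then -1 else 1 :: real"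
  let ?t = "axis s c :: real^'n"
  have "reflect s c = (\<lambda>x. ?t + (\<Sum>j\<in>Basis. (?c j * (x \<bullet> j)) *\<^sub>R j))"
  proof (rule ext, subst vec_eq_iff, rule allI)
    fix x :: "real^'n" and t
    have "(\<Sum>j\<in>Basis. (?c j * (x \<bullet> j)) *\<^sub>R j) $ t = (\<Sum>j\<in>Basis. (?c j * (x \<bullet> j)) *\<^sub>R j) \<bullet> axis t 1"
      by (simp add: cart_eq_inner_axis)
    also have "\<dots> = ?c (axis t 1) * (x \<bullet> axis t 1)" by (simp add: axis_in_Basis_iff)
    finally have e: "(\<Sum>j\<in>Basis. (?c j * (x \<bullet> j)) *\<^sub>R j) $ t = ?c (axis t 1) * x $ t"
      by (simp add: cart_eq_inner_axis)
    show "reflect s c x $ t = (?t + (\<Sum>j\<in>Basis. (?c j * (x \<bullet> j)) *\<^sub>R j)) $ t"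
    proof -
      have "axis s c $ t = (if t = s then c else 0)" by (simp add: axis_def)
      then show ?thesis unfolding vector_add_component e reflect_nth by (simp add: axis_eq_axis)
    qed
  qed
  moreover have "lborel = density (distr lborel borel (\<lambda>x :: real^'n. ?t + (\<Sum>j\<in>Basis. (?c j * (x \<bullet> j)) *\<^sub>R j))) (\<lambda>_. (\<Prod>j\<in>Basis. \<bar>?c j\<bar>))"
    by (rule lborel_affine_euclidean) auto
  moreover have "(\<Prod>j\<in>Basis. \<bar>?c j\<bar>) = 1" by (intro prod.neutral) auto
  ultimately have "lborel = density (distr lborel borel (reflect s c)) (\<lambda>_. 1)" by simp
  then show ?thesis by (simp add: density_1)
qed

text \<open>The product of the operators 1 - R_s over the list, where R_s composes with the
  reflection in coordinate \<open>s\<close>.\<close>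

fun iterated_diff :: "('n \<Rightarrow> real) \<Rightarrow> 'n list \<Rightarrow> (real^'n::finite \<Rightarrow> real) \<Rightarrow> real^'n \<Rightarrow> real" where
  "iterated_diff c [] g x = g x"
| "iterated_diff c (s # A) g x = iterated_diff c A g x - iterated_diff c A g (reflect s (c s) x)"

locale haar_box =
  fixes ns :: "'n::finite \<Rightarrow> nat"
  assumes ns: "1 \<le> ns s"
begin

text \<open>Twice the centre of the support, so that \<open>reflect s (center2 s)\<close>
  interchanges its two halves.\<close>

definition center2 :: "'n \<Rightarrow> real" where "center2 s = haar_lo (ns s) + haar_hi (ns s)"

definition support :: "(real^'n) set" where
  "support = {x. \<forall>s. haar_lo (ns s) \<le> x $ s \<and> x $ s \<le> haar_hi (ns s)}"

definition haar0_d :: "real^'n \<Rightarrow> real" where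
  "haar0_d x = (\<Prod>s\<in>UNIV. haar0 (ns s) (x $ s))"

text \<open>The integrand of a coefficient for the exactly odd version of the Haar function,
  extended by 0 to the whole space, where Lebesgue measure is invariant under reflections.\<close>

definition weighted :: "(real^'n \<Rightarrow> real) \<Rightarrow> real^'n \<Rightarrow> real" where
  "weighted g x = indicator unit_cube x * (g x * haar0_d x)"

lemma support_cube: "support \<subseteq> unit_cube"
proof
  fix x assume "x \<in> support"
  then show "x \<in> unit_cube"
    unfolding mem_unit_cube support_def using haar_lo_hi(1)[OF ns] haar_lo_hi(3)[OF ns]
    by (auto intro: order_trans)
qed

lemma reflect_support: "x \<in> support \<Longrightarrow> reflect s (center2 s) x \<in> support"
  by (auto simp: support_def reflect_nth center2_def)

lemma haar0_d_measurable [measurable]: "haar0_d \<in> borel_measurable borel"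
proof -
  have "(\<lambda>x. \<Prod>s\<in>UNIV. haar0 (ns s) (x $ s)) \<in> borel_measurable (borel :: (real^'n) measure)"
  proof (rule borel_measurable_prod)
    fix s :: 'n
    have "(\<lambda>x::real^'n. x $ s) \<in> borel_measurable borel"
      by (intro borel_measurable_continuous_onI continuous_intros)
    then show "(\<lambda>x. haar0 (ns s) (x $ s)) \<in> borel_measurable (borel :: (real^'n) measure)"
      by (rule measurable_compose[OF _ haar0_measurable])
  qed
  then show ?thesis unfolding haar0_d_def[abs_def] .
qed

lemma haar_d_measurable [measurable]: "haar_d ns \<in> borel_measurable (borel :: (real^'n) measure)"
proof -
  have "(\<lambda>x. \<Prod>s\<in>UNIV. haar (ns s) (x $ s)) \<in> borel_measurable (borel :: (real^'n) measure)"
  proof (rule borel_measurable_prod)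
    fix s :: 'n
    have "(\<lambda>x::real^'n. x $ s) \<in> borel_measurable borel"
      by (intro borel_measurable_continuous_onI continuous_intros)
    then show "(\<lambda>x. haar (ns s) (x $ s)) \<in> borel_measurable (borel :: (real^'n) measure)"
      by (rule measurable_compose[OF _ haar_measurable])
  qed
  then show ?thesis unfolding haar_d_def[abs_def] .
qed

lemma haar0_d_bound:
  assumes "x \<in> unit_cube"
  shows "\<bar>haar0_d x\<bar> \<le> (\<Prod>s\<in>UNIV. sqrt (2 ^ haar_level (ns s))) * indicator support x"
proof -
  have "\<bar>haar0_d x\<bar> = (\<Prod>s\<in>UNIV. \<bar>haar0 (ns s) (x $ s)\<bar>)" unfolding haar0_d_def by (rule abs_prod)
  also have "\<dots> \<le> (\<Prod>s\<in>UNIV. sqrt (2 ^ haar_level (ns s)) * indicator {haar_lo (ns s)..haar_hi (ns s)} (x $ s))"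
    using assms by (intro prod_mono conjI haar0_bound) (auto simp: mem_unit_cube)
  also have "\<dots> = (\<Prod>s\<in>UNIV. sqrt (2 ^ haar_level (ns s))) * (\<Prod>s\<in>UNIV. indicator {haar_lo (ns s)..haar_hi (ns s)} (x $ s))"
    by (rule prod.distrib)
  also have "(\<Prod>s\<in>UNIV. indicator {haar_lo (ns s)..haar_hi (ns s)} (x $ s)) = (indicator support x :: real)"
  proof (cases "x \<in> support")
    case True
    then show ?thesis by (auto simp: support_def indicator_def)
  next
    case False
    then obtain s where "x $ s \<notin> {haar_lo (ns s)..haar_hi (ns s)}" by (auto simp: support_def)
    then have "indicator {haar_lo (ns s)..haar_hi (ns s)} (x $ s) = (0 :: real)" by (rule indicator_simps(2))
    then have "(\<Prod>s\<in>UNIV. indicator {haar_lo (ns s)..haar_hi (ns s)} (x $ s)) = (0 :: real)"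
      by (intro prod_zero) auto
    then show ?thesis using False by simp
  qed
  finally show ?thesis .
qed

lemma support_cbox: "support = cbox (\<chi> s. haar_lo (ns s)) (\<chi> s. haar_hi (ns s))"
  by (auto simp: support_def mem_box_cart)

lemma measure_support: "measure lborel support = (\<Prod>s\<in>UNIV. 1 / 2 ^ haar_level (ns s))"
proof -
  have "cbox (\<chi> s. haar_lo (ns s)) (\<chi> s. haar_hi (ns s)) \<noteq> {}"
    using haar_lo_hi(2)[OF ns] by (auto simp: interval_ne_empty_cart intro: less_imp_le)
  from content_cbox_cart[OF this] show ?thesis unfolding support_cbox by (simp add: haar_hi_def)
qed

lemma integrable_support: "integrable lborel (indicator support :: _ \<Rightarrow> real)"
  unfolding support_cbox by (rule integrable_real_indicator, simp, rule emeasure_lborel_cbox_finite)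

text \<open>The factor is the height 2^(|j|/2) of the Haar function times the volume 2^(-|j|) of its
  support.\<close>

lemma integral_weighted_bound:
  assumes int: "integrable lborel (weighted h)" and B: "\<And>x. x \<in> support \<Longrightarrow> \<bar>h x\<bar> \<le> \<beta>"
  shows "\<bar>\<integral>x. weighted h x \<partial>lborel\<bar> \<le> \<beta> * (\<Prod>s\<in>UNIV. sqrt (2 ^ haar_level (ns s)) / 2 ^ haar_level (ns s))"
proof -
  let ?H = "\<Prod>s\<in>UNIV. sqrt (2 ^ haar_level (ns s)) :: real"
  have H: "0 \<le> ?H" by (intro prod_nonneg) auto
  have "\<bar>\<integral>x. weighted h x \<partial>lborel\<bar> \<le> (\<integral>x. \<bar>weighted h x\<bar> \<partial>lborel)" by (rule integral_abs_bound)
  also have "\<dots> \<le> (\<integral>x. (\<beta> * ?H) * indicator support x \<partial>lborel)"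
  proof (rule integral_mono)
    show "integrable lborel (\<lambda>x. \<bar>weighted h x\<bar>)" using int by (rule integrable_abs)
    show "integrable lborel (\<lambda>x. (\<beta> * ?H) * indicator support x)"
      using integrable_support by (rule integrable_mult_right)
    fix x
    show "\<bar>weighted h x\<bar> \<le> (\<beta> * ?H) * indicator support x"
    proof (cases "x \<in> support")
      case True
      then have x: "x \<in> unit_cube" using support_cube by auto
      have "\<bar>h x\<bar> * \<bar>haar0_d x\<bar> \<le> \<beta> * ?H"
      proof (rule mult_mono)
        show "\<bar>h x\<bar> \<le> \<beta>" by (rule B[OF True])
        then show "0 \<le> \<beta>" by linarith
        show "\<bar>haar0_d x\<bar> \<le> ?H" using haar0_d_bound[OF x] True by simp
      qed simp
      then show ?thesis using True x by (simp add: weighted_def abs_mult)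
    next
      case False
      then have "weighted h x = 0"
        using haar0_d_bound[of x] by (cases "x \<in> unit_cube") (auto simp: weighted_def)
      then show ?thesis using False by simp
    qed
  qed
  also have "\<dots> = \<beta> * ?H * (\<Prod>s\<in>UNIV. 1 / 2 ^ haar_level (ns s))"
    using measure_support by simp
  also have "\<dots> = \<beta> * (\<Prod>s\<in>UNIV. sqrt (2 ^ haar_level (ns s)) / 2 ^ haar_level (ns s))"
    by (simp add: prod_dividef)
  finally show ?thesis .
qed

lemma haar0_d_reflect:
  assumes "ns s \<noteq> 1"
  shows "haar0_d (reflect s (center2 s) x) = - haar0_d x"
proof -
  have split: "(\<Prod>t\<in>UNIV. f t) = f s * (\<Prod>t\<in>UNIV - {s}. f t)" for f :: "'n \<Rightarrow> real"
    by (rule prod.remove) auto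
  have "haar0_d (reflect s (center2 s) x) = haar0 (ns s) (center2 s - x $ s) * (\<Prod>t\<in>UNIV - {s}. haar0 (ns t) (x $ t))"
    unfolding haar0_d_def split by (simp add: reflect_nth cong: prod.cong_simp)
  also have "\<dots> = - haar0_d x"
    unfolding haar0_d_def split center2_def haar0_reflect[OF assms] by simp
  finally show ?thesis .
qed

text \<open>The sign is the oddness of the Haar factor. The reflection need not map the cube to
  itself, but where the Haar factor is nonzero, coordinate \<open>s\<close> lies in the support
  interval, and there membership in the cube is preserved.\<close>

lemma weighted_reflect:
  assumes s: "ns s \<noteq> 1"
  shows "weighted (\<lambda>x. h (reflect s (center2 s) x)) x = - weighted h (reflect s (center2 s) x)"
proof (cases "haar0_d x = 0")
  case True
  then show ?thesis using haar0_d_reflect[OF s] by (simp add: weighted_def)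
next
  case False
  then have "haar0 (ns s) (x $ s) \<noteq> 0" by (auto simp: haar0_d_def)
  then have "x $ s \<in> {haar_lo (ns s)..haar_hi (ns s)}" by (rule haar0_supp[OF s])
  then have "0 \<le> x $ s \<and> x $ s \<le> 1" "0 \<le> center2 s - x $ s \<and> center2 s - x $ s \<le> 1"
    using haar_lo_hi[OF ns[of s]] by (auto simp: center2_def)
  then have "(0 \<le> x $ t \<and> x $ t \<le> 1) \<longleftrightarrow> (0 \<le> reflect s (center2 s) x $ t \<and> reflect s (center2 s) x $ t \<le> 1)" for t
    unfolding reflect_nth by (cases "t = s") simp_all
  then have "x \<in> unit_cube \<longleftrightarrow> reflect s (center2 s) x \<in> unit_cube"
    unfolding mem_unit_cube by simp
  then show ?thesis unfolding weighted_def haar0_d_reflect[OF s] by (simp add: indicator_def)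
qed

lemma integral_weighted_reflect:
  assumes s: "ns s \<noteq> 1" and int: "integrable lborel (weighted h)"
  shows "integrable lborel (weighted (\<lambda>x. h x - h (reflect s (center2 s) x)))"
    and "(\<integral>x. weighted (\<lambda>x. h x - h (reflect s (center2 s) x)) x \<partial>lborel) = 2 * (\<integral>x. weighted h x \<partial>lborel)"
proof -
  let ?R = "reflect s (center2 s)"
  have m: "weighted h \<in> borel_measurable borel" using int by auto
  have "integrable (distr lborel borel ?R) (weighted h)" unfolding distr_reflect using int .
  then have intR: "integrable lborel (\<lambda>x. weighted h (?R x))"
    by (subst (asm) integrable_distr_eq) (use m in auto)
  have "(\<integral>x. weighted h x \<partial>lborel) = (\<integral>x. weighted h x \<partial>distr lborel borel ?R)" unfolding distr_reflect ..
  also have "\<dots> = (\<integral>x. weighted h (?R x) \<partial>lborel)" by (rule integral_distr) (use m in auto)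
  finally have eq: "(\<integral>x. weighted h (?R x) \<partial>lborel) = (\<integral>x. weighted h x \<partial>lborel)" ..
  have "weighted (\<lambda>x. h x - h (?R x)) = (\<lambda>x. weighted h x + weighted h (?R x))"
  proof
    fix x
    have "weighted (\<lambda>x. h x - h (?R x)) x = weighted h x - weighted (\<lambda>x. h (?R x)) x"
      by (simp add: weighted_def algebra_simps)
    then show "weighted (\<lambda>x. h x - h (?R x)) x = weighted h x + weighted h (?R x)"
      unfolding weighted_reflect[OF s] by simp
  qed
  then show "integrable lborel (weighted (\<lambda>x. h x - h (?R x)))"
    and "(\<integral>x. weighted (\<lambda>x. h x - h (?R x)) x \<partial>lborel) = 2 * (\<integral>x. weighted h x \<partial>lborel)"
    using int intR eq by simp_all
qed

text \<open>Against an odd weight, subtracting the reflected function doubles the integral. A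
  coefficient of \<open>h\<close> is thus, up to a power of 2, a coefficient of its iterated
  difference, which smoothness makes small.\<close>

lemma integral_iterated_diff:
  assumes "\<And>s. s \<in> set A \<Longrightarrow> ns s \<noteq> 1" "integrable lborel (weighted h)"
  shows "integrable lborel (weighted (iterated_diff center2 A h)) \<and>
    (\<integral>x. weighted (iterated_diff center2 A h) x \<partial>lborel) = 2 ^ length A * (\<integral>x. weighted h x \<partial>lborel)"
  using assms(1)
proof (induction A)
  case Nil
  have "iterated_diff center2 [] h = h" by (rule ext) simp
  then show ?case using assms(2) by simp
next
  case (Cons s A)
  have "iterated_diff center2 (s # A) h = (\<lambda>x. iterated_diff center2 A h x - iterated_diff center2 A h (reflect s (center2 s) x))"
    by (rule ext) simp
  then show ?case
    using integral_weighted_reflect[of s "iterated_diff center2 A h"] Cons by simp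
qed

lemma haar_coeff_weighted:
  assumes g: "continuous_on unit_cube g"
  shows "integrable lborel (weighted g)" and "haar_coeff ns g = (\<integral>x. weighted g x \<partial>lborel)"
    and "integrable lborel (\<lambda>x. indicator unit_cube x * (g x * haar_d ns x))"
    and "haar_coeff ns g = (\<integral>x. indicator unit_cube x * (g x * haar_d ns x) \<partial>lborel)"
proof -
  have "compact (g ` unit_cube)" using g by (intro compact_continuous_image) (auto simp: unit_cube_def)
  then obtain B where B: "\<And>x. x \<in> unit_cube \<Longrightarrow> \<bar>g x\<bar> \<le> B"
    using compact_imp_bounded bounded_real by (metis imageI)
  have gm: "(\<lambda>x. indicator unit_cube x * g x) \<in> borel_measurable borel"
    using borel_measurable_continuous_on_indicator[OF unit_cube_borel g] by simp
  have B0: "0 \<le> B" using B[of 0] by (fastforce simp: mem_unit_cube)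
  have "(\<lambda>x. (indicator unit_cube x * g x) * haar0_d x) \<in> borel_measurable borel"
    using gm by measurable
  then have m0: "(\<lambda>x. indicator unit_cube x * (g x * haar0_d x)) \<in> borel_measurable borel"
    by (simp add: mult.assoc)
  have "(\<lambda>x. (indicator unit_cube x * g x) * haar_d ns x) \<in> borel_measurable borel"
    using gm by measurable
  then have m1: "(\<lambda>x. indicator unit_cube x * (g x * haar_d ns x)) \<in> borel_measurable borel"
    by (simp add: mult.assoc)
  let ?H = "\<Prod>s\<in>UNIV. sqrt (2 ^ haar_level (ns s)) :: real"
  have "\<bar>g x * haar0_d x\<bar> \<le> B * ?H" if x: "x \<in> unit_cube" for x
  proof -
    have "\<bar>haar0_d x\<bar> \<le> ?H" using haar0_d_bound[OF x]
      by (rule order_trans) (auto simp: indicator_def intro!: prod_nonneg)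
    then show ?thesis unfolding abs_mult using B[OF x] B0 by (intro mult_mono) auto
  qed
  note i0 = integrable_unit_cube[OF m0 this]
  have "\<exists>H. \<forall>x. \<bar>haar_d ns x\<bar> \<le> H"
  proof -
    have "\<exists>h. \<forall>t. \<bar>haar (ns s) t\<bar> \<le> h" for s
      using finite_imp_bounded[OF haar_range[of "ns s"]] unfolding bounded_real by auto
    then obtain h where h: "\<And>s t. \<bar>haar (ns s) t\<bar> \<le> h s" by metis
    have "\<bar>haar_d ns x\<bar> \<le> (\<Prod>s\<in>UNIV. h s)" for x :: "real^'n"
      unfolding haar_d_def abs_prod by (intro prod_mono) (auto intro: h)
    then show ?thesis by blast
  qed
  then obtain H where H: "\<And>x. \<bar>haar_d ns x\<bar> \<le> H" by blast
  have "\<bar>g x * haar_d ns x\<bar> \<le> B * H" if x: "x \<in> unit_cube" for x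
    unfolding abs_mult using B[OF x] B0 H by (intro mult_mono) auto
  note i1 = integrable_unit_cube[OF m1 this]
  show "integrable lborel (\<lambda>x. indicator unit_cube x * (g x * haar_d ns x))"
    and c: "haar_coeff ns g = (\<integral>x. indicator unit_cube x * (g x * haar_d ns x) \<partial>lborel)"
    using i1 by (auto simp: haar_coeff_def)
  show "integrable lborel (weighted g)" using i0(1) by (simp add: weighted_def[abs_def])
  \<comment> \<open>The pointwise Haar functions and their odd versions differ only on finitely many
    hyperplanes, which are Lebesgue null.\<close>
  have ae: "AE x in lborel. x $ s \<noteq> c" for s :: 'n and c :: real
  proof -
    have "negligible {x :: real^'n. x \<bullet> axis s 1 = c}"
      by (rule negligible_standard_hyperplane) (simp add: axis_in_Basis_iff)
    moreover have "{x :: real^'n. x \<bullet> axis s 1 = c} \<in> sets lborel"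
      by (simp add: borel_closed closed_hyperplane[where a="axis s 1", simplified inner_commute])
    ultimately have "{x :: real^'n. x \<bullet> axis s 1 = c} \<in> null_sets lborel"
      by (simp add: negligible_iff_null_sets null_sets_completion_iff)
    then show ?thesis by (rule AE_I') (auto simp: cart_eq_inner_axis)
  qed
  have "AE x in lborel. \<forall>s. x $ s \<noteq> haar_lo (ns s) \<and> x $ s \<noteq> (haar_lo (ns s) + haar_hi (ns s)) / 2 \<and> x $ s \<noteq> haar_hi (ns s)"
    by (subst AE_all_countable) (intro allI AE_conjI ae)
  then have "AE x in lborel. haar_d ns x = haar0_d x"
  proof eventually_elim
    case (elim x)
    then show ?case unfolding haar_d_def haar0_d_def by (intro prod.cong refl haar_eq_haar0 ns) auto
  qed
  then have "(\<integral>x. indicator unit_cube x * (g x * haar_d ns x) \<partial>lborel) = (\<integral>x. weighted g x \<partial>lborel)"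
    using m0 m1 by (intro integral_cong_AE) (auto simp: weighted_def[abs_def])
  then show "haar_coeff ns g = (\<integral>x. weighted g x \<partial>lborel)" using c by simp
qed

lemma haar_coeff_bound:
  assumes g: "continuous_on unit_cube g" and A: "\<And>s. s \<in> set A \<Longrightarrow> ns s \<noteq> 1"
    and B: "\<And>x. x \<in> support \<Longrightarrow> \<bar>iterated_diff center2 A g x\<bar> \<le> \<beta>"
  shows "\<bar>haar_coeff ns g\<bar> \<le> \<beta> * (\<Prod>s\<in>UNIV. sqrt (2 ^ haar_level (ns s)) / 2 ^ haar_level (ns s))"
proof -
  have I: "integrable lborel (weighted (iterated_diff center2 A g))"
    "(\<integral>x. weighted (iterated_diff center2 A g) x \<partial>lborel) = 2 ^ length A * haar_coeff ns g"
    using integral_iterated_diff[OF A haar_coeff_weighted(1)[OF g]] haar_coeff_weighted(2)[OF g] by auto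
  have "\<bar>haar_coeff ns g\<bar> = 1 * \<bar>haar_coeff ns g\<bar>" by simp
  also have "\<dots> \<le> 2 ^ length A * \<bar>haar_coeff ns g\<bar>" by (rule mult_right_mono) auto
  also have "\<dots> = \<bar>2 ^ length A * haar_coeff ns g\<bar>" by (simp add: abs_mult)
  also have "\<dots> \<le> \<beta> * (\<Prod>s\<in>UNIV. sqrt (2 ^ haar_level (ns s)) / 2 ^ haar_level (ns s))"
    using integral_weighted_bound[OF I(1) B] unfolding I(2) .
  finally show ?thesis .
qed

end

context haar_box
begin

lemma reflect_support_iff: "reflect s (center2 s) x \<in> support \<longleftrightarrow> x \<in> support"
proof -
  have "reflect s (center2 s) (reflect s (center2 s) x) = x"
    by (simp add: vec_eq_iff reflect_nth)
  then show ?thesis using reflect_support by metis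
qed

text \<open>Reflections in coordinates other than \<open>s\<close> commute with moving in direction
  \<open>s\<close>. The support replaces the cube as domain because it is invariant under all these
  reflections.\<close>

lemma iterated_diff_derivative:
  assumes g: "partial_on_cube g s g'" and s: "s \<notin> set A" and x: "x \<in> support"
  shows "((\<lambda>t. iterated_diff center2 A g (x + t *\<^sub>R axis s 1)) has_real_derivative iterated_diff center2 A g' x)
     (at 0 within {t. x + t *\<^sub>R axis s 1 \<in> support})"
  using s x
proof (induction A arbitrary: x)
  case Nil
  have "((\<lambda>t. g (x + t *\<^sub>R axis s 1)) has_real_derivative g' x) (at 0 within {t. x + t *\<^sub>R axis s 1 \<in> unit_cube})"
    using g Nil support_cube unfolding partial_on_cube_def by auto
  then have "((\<lambda>t. g (x + t *\<^sub>R axis s 1)) has_real_derivative g' x) (at 0 within {t. x + t *\<^sub>R axis s 1 \<in> support})"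
    by (rule has_field_derivative_subset) (use support_cube in auto)
  then show ?case by simp
next
  case (Cons u A)
  let ?R = "reflect u (center2 u)"
  have us: "u \<noteq> s" "s \<notin> set A" using Cons.prems by auto
  have comm: "?R (x + t *\<^sub>R axis s 1) = ?R x + t *\<^sub>R axis s 1" for t
    using us(1) by (auto simp: vec_eq_iff reflect_nth axis_def)
  have set_eq: "{t. ?R x + t *\<^sub>R axis s 1 \<in> support} = {t. x + t *\<^sub>R axis s 1 \<in> support}"
    unfolding comm[symmetric] reflect_support_iff ..
  have Rx: "?R x \<in> support" using Cons.prems(2) by (rule reflect_support)
  have "((\<lambda>t. iterated_diff center2 A g (x + t *\<^sub>R axis s 1) - iterated_diff center2 A g (?R x + t *\<^sub>R axis s 1))
    has_real_derivative iterated_diff center2 A g' x - iterated_diff center2 A g' (?R x))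
     (at 0 within {t. x + t *\<^sub>R axis s 1 \<in> support})"
    using Cons.IH[OF us(2) Cons.prems(2)] Cons.IH[OF us(2) Rx] unfolding set_eq by (rule DERIV_diff)
  then show ?case by (simp add: comm)
qed

lemma support_axis_iff:
  assumes "x \<in> support"
  shows "x + t *\<^sub>R axis s 1 \<in> support \<longleftrightarrow> t \<in> {haar_lo (ns s) - x $ s..haar_hi (ns s) - x $ s}"
proof -
  have "(x + t *\<^sub>R axis s 1) $ u = (if u = s then x $ u + t else x $ u)" for u by (simp add: axis_def)
  then show ?thesis using assms unfolding support_def by auto
qed

lemma reflect_axis: "reflect s (center2 s) x = x + (center2 s - 2 * x $ s) *\<^sub>R axis s 1"
  by (auto simp: vec_eq_iff reflect_nth axis_def)

lemma center2_dist: "x \<in> support \<Longrightarrow> \<bar>center2 s - 2 * x $ s\<bar> \<le> 1 / 2 ^ haar_level (ns s)"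
  unfolding support_def center2_def haar_hi_def by (auto simp: abs_le_iff dest!: spec[of _ s])

text \<open>The mean value bound between \<open>x\<close> and its reflection, whose distance is at
  most the side 2^(-j) of the support: one difference is traded for one derivative and a factor
  2^(-j).\<close>

lemma iterated_diff_step:
  assumes g: "partial_on_cube g s g'" and s: "s \<notin> set A" and x: "x \<in> support"
    and B: "\<And>y. y \<in> support \<Longrightarrow> \<bar>iterated_diff center2 A g' y\<bar> \<le> \<beta>"
  shows "\<bar>iterated_diff center2 (s # A) g x\<bar> \<le> \<beta> * (1 / 2 ^ haar_level (ns s))"
proof -
  let ?e = "axis s 1 :: real^'n"
  let ?\<phi> = "\<lambda>t. iterated_diff center2 A g (x + t *\<^sub>R ?e)"
  let ?T = "{haar_lo (ns s) - x $ s..haar_hi (ns s) - x $ s}"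
  let ?\<tau> = "center2 s - 2 * x $ s"
  have T: "t \<in> ?T \<longleftrightarrow> x + t *\<^sub>R ?e \<in> support" for t using support_axis_iff[OF x] by simp
  \<comment> \<open>Derivatives are available only at parameter 0 from each base point, so the base
    point is moved to parameter \<open>t\<close> and the chain rule shifts back.\<close>
  have der: "(?\<phi> has_field_derivative iterated_diff center2 A g' (x + t *\<^sub>R ?e)) (at t within ?T)" if t: "t \<in> ?T" for t
  proof -
    let ?y = "x + t *\<^sub>R ?e"
    have y: "?y \<in> support" using t T by blast
    have img: "(\<lambda>u. u - t) ` ?T \<subseteq> {u. ?y + u *\<^sub>R ?e \<in> support}"
    proof
      fix u assume "u \<in> (\<lambda>u. u - t) ` ?T"
      then have "x + (u + t) *\<^sub>R ?e \<in> support" using T[of "u + t"] by auto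
      then show "u \<in> {u. ?y + u *\<^sub>R ?e \<in> support}" by (simp add: scaleR_add_left add_ac)
    qed
    have "((\<lambda>u. iterated_diff center2 A g (?y + u *\<^sub>R ?e)) has_field_derivative iterated_diff center2 A g' ?y)
       (at (t - t) within (\<lambda>u. u - t) ` ?T)"
      using has_field_derivative_subset[OF iterated_diff_derivative[OF g s y] img] by simp
    moreover have "((\<lambda>u. u - t) has_field_derivative 1) (at t within ?T)"
      by (auto intro!: derivative_eq_intros)
    ultimately have "((\<lambda>u. iterated_diff center2 A g (?y + u *\<^sub>R ?e)) \<circ> (\<lambda>u. u - t) has_field_derivative
       iterated_diff center2 A g' ?y * 1) (at t within ?T)"
      by (rule DERIV_image_chain)
    moreover have "?y + (u - t) *\<^sub>R ?e = x + u *\<^sub>R ?e" for u by (simp add: scaleR_diff_left)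
    ultimately show ?thesis by (simp add: comp_def)
  qed
  have bound: "norm (iterated_diff center2 A g' (x + t *\<^sub>R ?e)) \<le> \<beta>" if "t \<in> ?T" for t
    using B T that by simp
  have "x + 0 *\<^sub>R ?e \<in> support" using x by simp
  then have 0: "0 \<in> ?T" using T by blast
  have R: "x + ?\<tau> *\<^sub>R ?e \<in> support" using reflect_support[OF x, of s] unfolding reflect_axis .
  then have 1: "?\<tau> \<in> ?T" using T by blast
  have \<beta>: "0 \<le> \<beta>" using B[OF x] by linarith
  have "norm (?\<phi> 0 - ?\<phi> ?\<tau>) \<le> \<beta> * norm (0 - ?\<tau>)"
    by (rule field_differentiable_bound[OF convex_real_interval(5) der bound 0 1])
  also have "\<dots> \<le> \<beta> * (1 / 2 ^ haar_level (ns s))"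
    using center2_dist[OF x, of s] \<beta> by (intro mult_left_mono) auto
  finally show ?thesis unfolding iterated_diff.simps reflect_axis by simp
qed

text \<open>All differences in \<open>A\<close> are traded for derivatives, while those in
  \<open>B\<close> are left for the base estimate on derivatives of order \<open>N\<close>. The
  length of \<open>ts\<close> plus that of \<open>A\<close> is invariant.\<close>

lemma iterated_diff_bound:
  assumes D: "\<And>ts s. length ts < l \<Longrightarrow> partial_on_cube (D ts) s (D (s # ts))" and N: "N \<le> l"
    and base: "\<And>ts y. length ts = N \<Longrightarrow> y \<in> support \<Longrightarrow> \<bar>iterated_diff center2 B (D ts) y\<bar> \<le> \<beta>"
  shows "distinct (A @ B) \<Longrightarrow> length ts + length A = N \<Longrightarrow> y \<in> support \<Longrightarrow>
    \<bar>iterated_diff center2 (A @ B) (D ts) y\<bar> \<le> \<beta> * (\<Prod>s\<in>set A. 1 / 2 ^ haar_level (ns s))"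
proof (induction A arbitrary: ts y)
  case Nil
  then show ?case using base by simp
next
  case (Cons s A)
  have "\<bar>iterated_diff center2 (s # (A @ B)) (D ts) y\<bar> \<le>
     (\<beta> * (\<Prod>s\<in>set A. 1 / 2 ^ haar_level (ns s))) * (1 / 2 ^ haar_level (ns s))"
  proof (rule iterated_diff_step)
    show "partial_on_cube (D ts) s (D (s # ts))" using Cons.prems N by (intro D) auto
    show "s \<notin> set (A @ B)" using Cons.prems by auto
    show "\<bar>iterated_diff center2 (A @ B) (D (s # ts)) y\<bar> \<le> \<beta> * (\<Prod>s\<in>set A. 1 / 2 ^ haar_level (ns s))"
      if "y \<in> support" for y using Cons.prems that by (intro Cons.IH) auto
  qed (use Cons.prems in auto)
  then show ?case using Cons.prems by (simp add: mult_ac)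
qed

end

text \<open>Choosing the coordinates in decreasing order, the \<open>l\<close> largest values and the fraction \<open>\<alpha>\<close> of the next
  one are at least the average.\<close>
lemma ex_large_subset:
  fixes J :: "'a \<Rightarrow> real"
  assumes \<alpha>: "0 < \<alpha>" "\<alpha> \<le> 1"
  shows "finite P \<Longrightarrow> l < card P \<Longrightarrow>
    \<exists>A s. A \<subseteq> P \<and> card A = l \<and> s \<in> P - A \<and> (l + \<alpha>) * (\<Sum>t\<in>P. J t) \<le> card P * ((\<Sum>t\<in>A. J t) + \<alpha> * J s)"
proof (induction l arbitrary: P)
  case 0
  then have "Max (J ` P) \<in> J ` P" by (intro Max_in) auto
  then obtain s where s: "s \<in> P" "J s = Max (J ` P)" by auto
  have "(\<Sum>t\<in>P. J t) \<le> card P * J s" using 0 s by (intro sum_bounded_above) auto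
  then have "\<alpha> * (\<Sum>t\<in>P. J t) \<le> \<alpha> * (card P * J s)" using \<alpha> by (intro mult_left_mono) auto
  then show ?case using s by (intro exI[of _ "{}"] exI[of _ s]) (auto simp: mult_ac)
next
  case (Suc l)
  then have "Max (J ` P) \<in> J ` P" by (intro Max_in) auto
  then obtain s where s: "s \<in> P" "J s = Max (J ` P)" by auto
  have S: "(\<Sum>t\<in>P. J t) \<le> card P * J s" using Suc.prems s by (intro sum_bounded_above) auto
  let ?P = "P - {s}"
  have cP: "card P = Suc (card ?P)" by (rule card.remove[OF Suc.prems(1) s(1)])
  then obtain A' s' where A': "A' \<subseteq> ?P" "card A' = l" "s' \<in> ?P - A'"
    "(l + \<alpha>) * (\<Sum>t\<in>?P. J t) \<le> card ?P * ((\<Sum>t\<in>A'. J t) + \<alpha> * J s')"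
  proof -
    have "finite ?P" "l < card ?P" using Suc.prems cP by simp_all
    from Suc.IH[OF this] show ?thesis using that by blast
  qed
  define q \<Sigma> m X where "q = real (card ?P)" and "\<Sigma> = (\<Sum>t\<in>P. J t)" and "m = J s" and "X = (\<Sum>t\<in>A'. J t) + \<alpha> * J s'"
  have \<Sigma>: "(\<Sum>t\<in>?P. J t) = \<Sigma> - m" using s Suc.prems by (simp add: \<Sigma>_def m_def sum_diff1)
  have IH: "(l + \<alpha>) * (\<Sigma> - m) \<le> q * X" using A'(4) unfolding \<Sigma> by (simp add: q_def X_def)
  have q: "l + 1 \<le> q" using Suc.prems cP by (simp add: q_def)
  have Sm: "\<Sigma> \<le> (q + 1) * m" using S cP by (simp add: \<Sigma>_def m_def q_def algebra_simps)
  have n1: "0 \<le> (q - l - \<alpha>) * ((q + 1) * m - \<Sigma>)"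
  proof (rule mult_nonneg_nonneg)
    show "0 \<le> q - l - \<alpha>" using q \<alpha>(2) by linarith
  qed (use Sm in simp)
  have n2: "0 \<le> (q + 1) * (q * X - (l + \<alpha>) * (\<Sigma> - m))"
  proof (rule mult_nonneg_nonneg)
    show "0 \<le> q + 1" using q by linarith
  qed (use IH in simp)
  \<comment> \<open>The goal times \<open>q\<close> is a nonnegative combination of the induction
    hypothesis, with weight q + 1, and of the bound by the maximum, with weight q - l - \<alpha>.
    The latter is nonnegative because \<alpha> is at most 1.\<close>
  have "q * ((q + 1) * (m + X)) - q * ((l + 1 + \<alpha>) * \<Sigma>)
    = (q + 1) * (q * X - (l + \<alpha>) * (\<Sigma> - m)) + (q - l - \<alpha>) * ((q + 1) * m - \<Sigma>)"
    by (simp add: algebra_simps)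
  then have "q * ((l + 1 + \<alpha>) * \<Sigma>) \<le> q * ((q + 1) * (m + X))" using n1 n2 by linarith
  moreover have "0 < q" using q by linarith
  ultimately have main: "(l + 1 + \<alpha>) * \<Sigma> \<le> (q + 1) * (m + X)" by (simp only: mult_le_cancel_left_pos)
  have fin: "finite A'" using A'(1) Suc.prems(1) by (meson finite_Diff finite_subset)
  have sA: "s \<notin> A'" using A'(1) by auto
  have sum: "(\<Sum>t\<in>insert s A'. J t) + \<alpha> * J s' = m + X"
    unfolding sum.insert[OF fin sA] by (simp add: m_def X_def)
  have "real (Suc l) + \<alpha> = l + 1 + \<alpha>" "real (card P) = q + 1" using cP by (simp_all add: q_def)
  then have "(real (Suc l) + \<alpha>) * (\<Sum>t\<in>P. J t) \<le> real (card P) * ((\<Sum>t\<in>insert s A'. J t) + \<alpha> * J s')"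
    using main unfolding sum \<Sigma>_def by simp
  moreover have "card (insert s A') = Suc l" using fin sA A'(2) by simp
  moreover have "insert s A' \<subseteq> P" "s' \<in> P - insert s A'" using A' s by auto
  ultimately show ?case by blast
qed

text \<open>Cutting the segment into N parts bounds the increment by N times a constant over
  N^\<alpha>, which tends to 0. Exponents above 1 are thereby reduced to a vanishing
  difference.\<close>

lemma hoelder_gt_1_constant:
  fixes h :: "'a::real_normed_vector \<Rightarrow> real"
  assumes \<alpha>: "\<alpha> > 1" and S: "convex S" "x \<in> S" "y \<in> S"
    and H: "\<And>x y. x \<in> S \<Longrightarrow> y \<in> S \<Longrightarrow> \<bar>h x - h y\<bar> \<le> C * norm (x - y) powr \<alpha>"
  shows "h x = h y"
proof -
  have bound: "\<bar>h x - h y\<bar> \<le> C * norm (x - y) powr \<alpha> * real (Suc n) powr (1 - \<alpha>)" for n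
  proof -
    let ?N = "real (Suc n)"
    define p where "p k = x + (real k / ?N) *\<^sub>R (y - x)" for k
    have p: "p k \<in> S" if "k \<le> Suc n" for k
    proof -
      have "p k = (1 - real k / ?N) *\<^sub>R x + (real k / ?N) *\<^sub>R y" by (simp add: p_def algebra_simps)
      also have "\<dots> \<in> S" using that by (intro convexD[OF S(1,2,3)]) (simp_all add: divide_le_eq_1)
      finally show ?thesis .
    qed
    have step: "\<bar>h (p k) - h (p (Suc k))\<bar> \<le> C * (norm (x - y) / ?N) powr \<alpha>" if k: "k < Suc n" for k
    proof -
      have "p k - p (Suc k) = (1 / ?N) *\<^sub>R (x - y)"
      proof -
        have "p k - p (Suc k) = (real k / ?N - real (Suc k) / ?N) *\<^sub>R (y - x)" by (simp add: p_def algebra_simps)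
        also have "real k / ?N - real (Suc k) / ?N = - (1 / ?N)" by (simp add: diff_divide_distrib[symmetric])
        finally show ?thesis by (simp add: algebra_simps)
      qed
      then have "norm (p k - p (Suc k)) = norm (x - y) / ?N" by simp
      then show ?thesis using H[OF p p, of k "Suc k"] k by simp
    qed
    have "h x - h y = (\<Sum>k<Suc n. h (p k) - h (p (Suc k)))"
    proof -
      have "p 0 = x" "p (Suc n) = y" by (simp_all add: p_def del: of_nat_Suc)
      then show ?thesis using sum_lessThan_telescope'[of "\<lambda>k. h (p k)" "Suc n"] by (simp only:)
    qed
    then have "\<bar>h x - h y\<bar> \<le> (\<Sum>k<Suc n. \<bar>h (p k) - h (p (Suc k))\<bar>)" by (metis sum_abs)
    also have "\<dots> \<le> (\<Sum>k<Suc n. C * (norm (x - y) / ?N) powr \<alpha>)" using step by (intro sum_mono) simp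
    also have "\<dots> = ?N * (C * (norm (x - y) / ?N) powr \<alpha>)" by (simp only: sum_constant card_lessThan)
    also have "(norm (x - y) / ?N) powr \<alpha> = norm (x - y) powr \<alpha> / ?N powr \<alpha>" by (rule powr_divide)
    also have "?N * (C * (norm (x - y) powr \<alpha> / ?N powr \<alpha>)) = C * norm (x - y) powr \<alpha> * (?N / ?N powr \<alpha>)" by simp
    also have "?N / ?N powr \<alpha> = ?N powr (1 - \<alpha>)" by (simp add: powr_diff)
    finally show ?thesis .
  qed
  have "(\<lambda>n. real (Suc n) powr (1 - \<alpha>)) \<longlonglongrightarrow> 0"
    using \<alpha> by (intro LIMSEQ_Suc[of "\<lambda>n. real n powr (1 - \<alpha>)"] tendsto_neg_powr filterlim_real_sequentially) auto
  then have "(\<lambda>n. C * norm (x - y) powr \<alpha> * real (Suc n) powr (1 - \<alpha>)) \<longlonglongrightarrow> C * norm (x - y) powr \<alpha> * 0"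
    by (rule tendsto_mult_left)
  then have "\<bar>h x - h y\<bar> \<le> C * norm (x - y) powr \<alpha> * 0"
    by (rule LIMSEQ_le_const) (use bound in blast)
  then show ?thesis by simp
qed

section \<open>Decay rate of the coefficients\<close>

text \<open>The guaranteed gain per unit of level beyond the factor 1/2. It is capped at 1 because
  each coordinate supplies one difference only. For \<alpha> > 1 derivatives of order
  \<open>l\<close> are constant, and the cap is attained.\<close>

definition decay_exponent :: "nat \<Rightarrow> real \<Rightarrow> nat \<Rightarrow> real" where
  "decay_exponent l \<alpha> d = (if \<alpha> \<le> 1 then min 1 ((real l + \<alpha>) / real d) else 1)"

context haar_box
begin

text \<open>Only coordinates with index different from 1 have cancellation. If there are at most
  \<open>l\<close> of them, each is differentiated once. Otherwise \<open>l\<close> coordinates are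
  differentiated and one more is estimated by the Hoelder condition; taking coordinates of large
  level makes the exponent gained at least the fraction (l + \<alpha>)/card P, hence (l +
  \<alpha>)/d, of the total level.\<close>

lemma haar_coeff_decay:
  fixes D :: "'n list \<Rightarrow> real^'n \<Rightarrow> real"
  assumes D: "\<And>ts s. length ts < l \<Longrightarrow> partial_on_cube (D ts) s (D (s # ts))"
    and f: "\<And>x. x \<in> unit_cube \<Longrightarrow> D [] x = f x" and cont: "continuous_on unit_cube (D [])"
    and C: "0 < C" "\<And>ts x. length ts \<le> l \<Longrightarrow> x \<in> unit_cube \<Longrightarrow> \<bar>D ts x\<bar> \<le> C"
    and H: "\<And>ts x y. length ts = l \<Longrightarrow> x \<in> unit_cube \<Longrightarrow> y \<in> unit_cube \<Longrightarrow>
           \<bar>D ts x - D ts y\<bar> \<le> C * norm (x - y) powr \<alpha>" and \<alpha>: "0 < \<alpha>"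
  shows "\<bar>haar_coeff ns f\<bar> \<le> C * (\<Prod>s\<in>UNIV. 2 powr (- (1 / 2 + decay_exponent l \<alpha> CARD('n)) * real (haar_level (ns s))))"
proof -
  let ?\<theta> = "decay_exponent l \<alpha> CARD('n)"
  define J where "J s = real (haar_level (ns s))" for s
  define P where "P = {s. ns s \<noteq> 1}"
  have finP: "finite P" by simp
  have J0: "0 \<le> J s" for s by (simp add: J_def)
  have JP: "J s = 0" if "s \<notin> P" for s using that by (simp add: J_def P_def)
  have sumP: "(\<Sum>s\<in>UNIV. J s) = (\<Sum>s\<in>P. J s)" by (rule sum.mono_neutral_right) (auto simp: JP)
  have lev: "1 / 2 ^ haar_level (ns s) = 2 powr (- J s)" for s
    unfolding J_def powr_minus_divide by (subst powr_realpow) simp_all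
  have half: "sqrt (2 ^ haar_level (ns s)) / 2 ^ haar_level (ns s) = 2 powr (- (1 / 2) * J s)" for s
  proof -
    have "sqrt a / a = 1 / sqrt a" if "0 < a" for a :: real using that by (simp add: frac_eq_eq)
    then have e1: "sqrt (2 ^ haar_level (ns s)) / 2 ^ haar_level (ns s) = 1 / sqrt (2 ^ haar_level (ns s))" by simp
    have e2: "(2 :: real) ^ haar_level (ns s) = 2 powr J s" unfolding J_def by (rule powr_realpow[symmetric]) simp
    have e3: "sqrt (2 powr J s) = (2 powr J s) powr (1 / 2)" by (rule powr_half_sqrt[symmetric]) simp
    have "1 / (2 powr J s) powr (1 / 2) = 2 powr (- (1 / 2) * J s)"
      unfolding powr_powr powr_minus_divide[symmetric] by (simp add: mult.commute)
    then show ?thesis unfolding e1 unfolding e2 e3 .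
  qed
  have prod_powr: "(\<Prod>s\<in>S. 2 powr (c * J s)) = 2 powr (c * (\<Sum>s\<in>S. J s))" if "finite S" for S c
    using that by (induction S rule: finite_induct) (simp_all add: powr_add distrib_left)
  have cf: "haar_coeff ns f = haar_coeff ns (D [])"
    unfolding haar_coeff_def by (intro integral_cong) (simp add: f)
  \<comment> \<open>A bound 2^(-E) for the iterated difference suffices as soon as \<open>E\<close>
    is at least \<theta> times the total level; the remaining 2^(-|j|/2) is height times volume of
    the support.\<close>
  have conclude: ?thesis if A: "set A \<subseteq> P" and E: "?\<theta> * (\<Sum>s\<in>P. J s) \<le> E"
    and b: "\<And>x. x \<in> support \<Longrightarrow> \<bar>iterated_diff center2 A (D []) x\<bar> \<le> C * 2 powr (- E)" for A E
  proof -
    have "\<bar>haar_coeff ns (D [])\<bar> \<le> C * 2 powr (- E) * (\<Prod>s\<in>UNIV. sqrt (2 ^ haar_level (ns s)) / 2 ^ haar_level (ns s))"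
      using A by (intro haar_coeff_bound[OF cont _ b]) (auto simp: P_def)
    also have "\<dots> = C * 2 powr (- E) * 2 powr (- (1 / 2) * (\<Sum>s\<in>UNIV. J s))"
      unfolding half prod_powr[OF finite] ..
    also have "\<dots> = C * 2 powr (- E - (1 / 2) * (\<Sum>s\<in>UNIV. J s))" by (simp add: powr_add[symmetric])
    also have "\<dots> \<le> C * 2 powr (- (1 / 2 + ?\<theta>) * (\<Sum>s\<in>UNIV. J s))"
      using E C(1) unfolding sumP by (intro mult_left_mono powr_mono) (auto simp: algebra_simps)
    also have "\<dots> = C * (\<Prod>s\<in>UNIV. 2 powr (- (1 / 2 + ?\<theta>) * J s))" unfolding prod_powr[OF finite] ..
    finally show ?thesis unfolding cf J_def .
  qed
  have \<theta>1: "?\<theta> \<le> 1" by (simp add: decay_exponent_def)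
  have prodA: "(\<Prod>s\<in>A. 1 / 2 ^ haar_level (ns s)) = 2 powr (- (\<Sum>s\<in>A. J s))" if "finite A" for A
    unfolding lev using prod_powr[OF that, of "-1"] by simp
  show ?thesis
  proof (cases "card P \<le> l")
    case True
    obtain A where A: "set A = P" "distinct A" using finite_distinct_list[OF finP] by auto
    have lA: "length A = card P" using A distinct_card by metis
    show ?thesis
    proof (rule conclude[of A "\<Sum>s\<in>P. J s"])
      show "?\<theta> * (\<Sum>s\<in>P. J s) \<le> (\<Sum>s\<in>P. J s)"
        using \<theta>1 by (intro mult_left_le_one_le sum_nonneg J0) (use \<alpha> in \<open>auto simp: decay_exponent_def\<close>)
      fix x assume x: "x \<in> support"
      have "\<bar>iterated_diff center2 (A @ []) (D []) x\<bar> \<le> C * (\<Prod>s\<in>set A. 1 / 2 ^ haar_level (ns s))"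
      proof (rule iterated_diff_bound[where D=D and l=l and N="card P", OF D True])
        show "\<bar>iterated_diff center2 [] (D ts) y\<bar> \<le> C" if "length ts = card P" "y \<in> support" for ts y
          using that True support_cube C(2)[of ts y] by auto
      qed (use A lA x in auto)
      then show "\<bar>iterated_diff center2 A (D []) x\<bar> \<le> C * 2 powr - (\<Sum>s\<in>P. J s)"
        using A(1) prodA[OF finP] by simp
    qed (use A in auto)
  next
    case False
    then have lP: "l < card P" by simp
    show ?thesis
    proof (cases "\<alpha> \<le> 1")
      case True
      obtain A0 s where A0: "A0 \<subseteq> P" "card A0 = l" "s \<in> P - A0"
        "(l + \<alpha>) * (\<Sum>t\<in>P. J t) \<le> card P * ((\<Sum>t\<in>A0. J t) + \<alpha> * J s)"
        using ex_large_subset[OF \<alpha> True finP lP, of J] by blast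
      have finA0: "finite A0" using A0(1) finP by (rule finite_subset)
      obtain A where A: "set A = A0" "distinct A" using finite_distinct_list[OF finA0] by auto
      have lA: "length A = l" using A distinct_card A0(2) by metis
      define E where "E = (\<Sum>t\<in>A0. J t) + \<alpha> * J s"
      show ?thesis
      proof (rule conclude[of "A @ [s]" E])
        show "set (A @ [s]) \<subseteq> P" using A A0 by auto
        have cP: "0 < card P" using lP by simp
        have "?\<theta> \<le> (real l + \<alpha>) / CARD('n)" using True by (simp add: decay_exponent_def)
        also have "\<dots> \<le> (real l + \<alpha>) / card P"
          using cP \<alpha> by (intro divide_left_mono) (auto intro!: card_mono)
        finally have "?\<theta> * (\<Sum>s\<in>P. J s) \<le> (real l + \<alpha>) / card P * (\<Sum>s\<in>P. J s)"
          by (intro mult_right_mono sum_nonneg J0)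
        also have "\<dots> \<le> E" using A0(4) cP by (simp add: E_def field_simps)
        finally show "?\<theta> * (\<Sum>s\<in>P. J s) \<le> E" .
        fix x assume x: "x \<in> support"
        \<comment> \<open>The reflection in \<open>s\<close> comes last in the list, so it acts
          directly on a derivative of order \<open>l\<close>, where the Hoelder condition
          applies.\<close>
        have "\<bar>iterated_diff center2 (A @ [s]) (D []) x\<bar> \<le> (C * 2 powr (- \<alpha> * J s)) * (\<Prod>s\<in>set A. 1 / 2 ^ haar_level (ns s))"
        proof (rule iterated_diff_bound[where D=D and l=l and N=l, OF D order_refl])
          fix ts :: "'n list" and y assume ts: "length ts = l" and y: "y \<in> support"
          let ?R = "reflect s (center2 s) y"
          have "y - ?R = - ((center2 s - 2 * y $ s) *\<^sub>R axis s 1)" unfolding reflect_axis by simp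
          then have "norm (y - ?R) = \<bar>center2 s - 2 * y $ s\<bar>" by simp
          then have n: "norm (y - ?R) \<le> 2 powr (- J s)" using center2_dist[OF y, of s] unfolding lev by simp
          have "\<bar>D ts y - D ts ?R\<bar> \<le> C * norm (y - ?R) powr \<alpha>"
            using ts y reflect_support[OF y] support_cube by (intro H) auto
          also have "\<dots> \<le> C * (2 powr (- J s)) powr \<alpha>"
            using n C(1) \<alpha> by (intro mult_left_mono powr_mono2) auto
          also have "\<dots> = C * 2 powr (- \<alpha> * J s)" by (simp add: powr_powr mult.commute)
          finally show "\<bar>iterated_diff center2 [s] (D ts) y\<bar> \<le> C * 2 powr (- \<alpha> * J s)" by simp
        qed (use A A0 lA x in auto)
        also have "\<dots> = C * 2 powr (- E)"
        proof -
          have "- E = - \<alpha> * J s + - (\<Sum>s\<in>A0. J s)" by (simp add: E_def)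
          then show ?thesis unfolding A(1) prodA[OF finA0] by (simp only: powr_add mult.assoc)
        qed
        finally show "\<bar>iterated_diff center2 (A @ [s]) (D []) x\<bar> \<le> C * 2 powr - E" .
      qed
    next
      case False
      obtain A0 where A0: "A0 \<subseteq> P" "card A0 = l" "finite A0"
        using obtain_subset_with_card_n[of l P] lP by auto
      obtain A where A: "set A = A0" "distinct A" using finite_distinct_list[OF A0(3)] by auto
      have lA: "length A = l" using A distinct_card A0(2) by metis
      have "\<exists>s. s \<in> P - A0" using A0 lP by (metis card_mono Diff_eq_empty_iff finP ex_in_conv not_le A0(3))
      then obtain s where s: "s \<in> P - A0" by blast
      show ?thesis
      proof (rule conclude[of "A @ [s]" "?\<theta> * (\<Sum>s\<in>P. J s)"])
        show "set (A @ [s]) \<subseteq> P" using A A0 s by auto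
        fix x assume x: "x \<in> support"
        have "\<bar>iterated_diff center2 (A @ [s]) (D []) x\<bar> \<le> 0 * (\<Prod>s\<in>set A. 1 / 2 ^ haar_level (ns s))"
        proof (rule iterated_diff_bound[where D=D and l=l and N=l, OF D order_refl])
          fix ts :: "'n list" and y assume ts: "length ts = l" and y: "y \<in> support"
          have "D ts y = D ts (reflect s (center2 s) y)"
          proof (rule hoelder_gt_1_constant[of \<alpha> unit_cube])
            show "convex (unit_cube :: (real^'n) set)" by (simp add: unit_cube_def)
          qed (use False y reflect_support[OF y] support_cube H[OF ts] in auto)
          then show "\<bar>iterated_diff center2 [s] (D ts) y\<bar> \<le> 0" by simp
        qed (use A s lA x in auto)
        also have "\<dots> \<le> C * 2 powr - (?\<theta> * (\<Sum>s\<in>P. J s))" using C(1) by simp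
        finally show "\<bar>iterated_diff center2 (A @ [s]) (D []) x\<bar> \<le> C * 2 powr - (?\<theta> * (\<Sum>s\<in>P. J s))" .
      qed simp
    qed
  qed
qed

end

section \<open>Convergence of the partial sums\<close>

definition haar_box_indices :: "nat \<Rightarrow> ('n::finite \<Rightarrow> nat) set" where
  "haar_box_indices k = Pi\<^sub>E UNIV (\<lambda>_. {1..2 ^ k})"

lemma finite_haar_box_indices [simp]: "finite (haar_box_indices k)"
  unfolding haar_box_indices_def by (rule finite_PiE) auto

lemma haar_box_of_indices: "ns \<in> haar_box_indices k \<Longrightarrow> haar_box ns"
  unfolding haar_box_indices_def haar_box_def by (auto simp: PiE_iff)

lemma haar_box_indices_mono: "k \<le> k' \<Longrightarrow> haar_box_indices k \<subseteq> haar_box_indices k'"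
  unfolding haar_box_indices_def by (intro PiE_mono) (auto intro: order_trans power_increasing)

lemma haar_partial_indices: "haar_partial g k x = (\<Sum>ns\<in>haar_box_indices k. haar_coeff ns g * haar_d ns x)"
  by (simp add: haar_partial_def haar_box_indices_def)

section \<open>The partial sums as an approximate identity\<close>

definition haar_kernel_d :: "nat \<Rightarrow> real^'n::finite \<Rightarrow> real^'n \<Rightarrow> real" where
  "haar_kernel_d k x y = (\<Sum>ns\<in>haar_box_indices k. haar_d ns x * haar_d ns y)"

lemma haar_kernel_d_prod:
  fixes x y :: "real^'n::finite"
  assumes "x \<in> unit_cube" "y \<in> unit_cube"
  shows "haar_kernel_d k x y =
    (\<Prod>s\<in>UNIV. 2 ^ k * (\<Sum>i<2 ^ k. dyadic_indicator k i (x $ s) * dyadic_indicator k i (y $ s)))"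
proof -
  have "haar_kernel_d k x y = (\<Sum>ns\<in>Pi\<^sub>E UNIV (\<lambda>_. {1..2 ^ k}). \<Prod>s\<in>UNIV. haar (ns s) (x $ s) * haar (ns s) (y $ s))"
    unfolding haar_kernel_d_def haar_box_indices_def haar_d_def prod.distrib ..
  also have "\<dots> = (\<Prod>s\<in>UNIV. \<Sum>n\<in>{1..2 ^ k}. haar n (x $ s) * haar n (y $ s))"
    by (rule prod_sum_PiE[symmetric]) auto
  also have "\<dots> = (\<Prod>s\<in>UNIV. 2 ^ k * (\<Sum>i<2 ^ k. dyadic_indicator k i (x $ s) * dyadic_indicator k i (y $ s)))"
    using assms by (intro prod.cong refl haar_kernel) (auto simp: mem_unit_cube)
  finally show ?thesis .
qed

lemma haar_kernel_d_nonneg: "x \<in> unit_cube \<Longrightarrow> y \<in> unit_cube \<Longrightarrow> 0 \<le> haar_kernel_d k x y"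
  unfolding haar_kernel_d_prod
  by (intro prod_nonneg mult_nonneg_nonneg sum_nonneg ballI) (auto intro: dyadic_indicator_nonneg mult_nonneg_nonneg)

text \<open>In every coordinate both points lie in a common closed dyadic interval of length 2^(-k);
  the norm is at most the sum of the coordinate distances.\<close>

lemma haar_kernel_d_supp:
  fixes x y :: "real^'n::finite"
  assumes "x \<in> unit_cube" "y \<in> unit_cube" "haar_kernel_d k x y \<noteq> 0"
  shows "norm (y - x) \<le> CARD('n) / 2 ^ k"
proof -
  have "\<bar>(y - x) $ s\<bar> \<le> 1 / 2 ^ k" for s
  proof -
    have "(\<Sum>i<2 ^ k. dyadic_indicator k i (x $ s) * dyadic_indicator k i (y $ s)) \<noteq> 0"
    proof
      assume "(\<Sum>i<2 ^ k. dyadic_indicator k i (x $ s) * dyadic_indicator k i (y $ s)) = 0"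
      then have "haar_kernel_d k x y = 0" unfolding haar_kernel_d_prod[OF assms(1,2)] by (intro prod_zero) auto
      then show False using assms(3) by simp
    qed
    then obtain i where "dyadic_indicator k i (x $ s) * dyadic_indicator k i (y $ s) \<noteq> 0"
      by (meson sum.neutral)
    then have i: "real i / 2 ^ k \<le> x $ s \<and> x $ s \<le> real (i + 1) / 2 ^ k" "real i / 2 ^ k \<le> y $ s \<and> y $ s \<le> real (i + 1) / 2 ^ k"
      using dyadic_indicator_supp by auto
    have "real (i + 1) / 2 ^ k = real i / 2 ^ k + 1 / 2 ^ k" by (simp add: add_divide_distrib)
    then show ?thesis using i unfolding vector_minus_component by linarith
  qed
  then have "(\<Sum>s\<in>UNIV. \<bar>(y - x) $ s\<bar>) \<le> (\<Sum>s\<in>(UNIV :: 'n set). 1 / 2 ^ k)" by (intro sum_mono)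
  then show ?thesis using norm_le_l1_cart[of "y - x"] by simp
qed

lemma haar_partial_kernel:
  fixes g :: "real^'n::finite \<Rightarrow> real"
  assumes g: "continuous_on unit_cube g"
  shows "integrable lborel (\<lambda>y. indicator unit_cube y * (g y * haar_kernel_d k x y))"
    and "haar_partial g k x = (\<integral>y. indicator unit_cube y * (g y * haar_kernel_d k x y) \<partial>lborel)"
proof -
  have e: "indicator unit_cube y * (g y * haar_kernel_d k x y)
    = (\<Sum>ns\<in>haar_box_indices k. haar_d ns x * (indicator unit_cube y * (g y * haar_d ns y)))" for y
    unfolding haar_kernel_d_def sum_distrib_left by (intro sum.cong refl) (simp add: mult_ac)
  have i: "integrable lborel (\<lambda>y. haar_d ns x * (indicator unit_cube y * (g y * haar_d ns y)))"
    if "ns \<in> haar_box_indices k" for ns :: "'n \<Rightarrow> nat"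
    by (intro integrable_mult_right haar_box.haar_coeff_weighted(3)[OF haar_box_of_indices[OF that] g])
  show "integrable lborel (\<lambda>y. indicator unit_cube y * (g y * haar_kernel_d k x y))"
    unfolding e by (rule Bochner_Integration.integrable_sum) (rule i)
  have "(\<integral>y. indicator unit_cube y * (g y * haar_kernel_d k x y) \<partial>lborel)
    = (\<Sum>ns\<in>haar_box_indices k. \<integral>y. haar_d ns x * (indicator unit_cube y * (g y * haar_d ns y)) \<partial>lborel)"
    unfolding e by (rule Bochner_Integration.integral_sum) (rule i)
  also have "\<dots> = (\<Sum>ns\<in>haar_box_indices k. haar_coeff ns g * haar_d ns x)"
  proof (intro sum.cong refl)
    fix ns :: "'n \<Rightarrow> nat" assume "ns \<in> haar_box_indices k"
    from haar_box.haar_coeff_weighted(4)[OF haar_box_of_indices[OF this] g]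
    show "(\<integral>y. haar_d ns x * (indicator unit_cube y * (g y * haar_d ns y)) \<partial>lborel) = haar_coeff ns g * haar_d ns x"
      by simp
  qed
  finally show "haar_partial g k x = (\<integral>y. indicator unit_cube y * (g y * haar_kernel_d k x y) \<partial>lborel)"
    unfolding haar_partial_indices ..
qed

text \<open>A coefficient of the constant with some index different from 1 vanishes, since a single
  difference of a constant is 0. Consequently the kernel has total mass 1.\<close>

lemma haar_partial_const: "haar_partial (\<lambda>_. 1) k (x :: real^'n::finite) = 1"
proof -
  let ?one = "\<lambda>_::'n. 1 :: nat"
  have one: "?one \<in> haar_box_indices k" unfolding haar_box_indices_def by (rule PiE_I) auto
  have zero: "haar_coeff ns (\<lambda>_. 1) = 0" if nsk: "ns \<in> haar_box_indices k" "ns \<noteq> ?one" for ns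
  proof -
    interpret haar_box ns by (rule haar_box_of_indices[OF nsk(1)])
    obtain s where s: "ns s \<noteq> 1" using nsk(2) by blast
    have "\<bar>haar_coeff ns (\<lambda>_. 1)\<bar> \<le> 0 * (\<Prod>s\<in>UNIV. sqrt (2 ^ haar_level (ns s)) / 2 ^ haar_level (ns s))"
      by (rule haar_coeff_bound[of _ "[s]"]) (use s in auto)
    then show ?thesis by simp
  qed
  have "haar_partial (\<lambda>_. 1) k x = (\<Sum>ns\<in>{?one}. haar_coeff ns (\<lambda>_. 1) * haar_d ns x)"
    unfolding haar_partial_indices using one zero by (intro sum.mono_neutral_right) auto
  also have "\<dots> = haar_coeff ?one (\<lambda>_. 1)" by (simp add: haar_d_def haar_def)
  also have "\<dots> = 1"
  proof -
    have "haar_d ?one y = 1" for y :: "real^'n" by (simp add: haar_d_def haar_def)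
    then show ?thesis by (simp add: haar_coeff_def unit_cube_def)
  qed
  finally show ?thesis .
qed

text \<open>The kernel is nonnegative, has mass 1 and is concentrated within distance d 2^(-k), so
  uniform continuity of \<open>g\<close> suffices. Convergence is uniform over the whole cube,
  dyadic hyperplanes included.\<close>

lemma haar_partial_uniform_limit:
  fixes g :: "real^'n::finite \<Rightarrow> real"
  assumes g: "continuous_on unit_cube g" and e: "e > 0"
  shows "\<exists>N. \<forall>k\<ge>N. \<forall>x\<in>unit_cube. \<bar>haar_partial g k x - g x\<bar> < e"
proof -
  have "uniformly_continuous_on unit_cube g"
    using g by (rule compact_uniformly_continuous) (simp add: unit_cube_def)
  then obtain \<delta> where \<delta>: "0 < \<delta>" "\<And>x y. x \<in> unit_cube \<Longrightarrow> y \<in> unit_cube \<Longrightarrow> dist y x < \<delta> \<Longrightarrow> dist (g y) (g x) < e / 2"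
    unfolding uniformly_continuous_on_def using e by (metis half_gt_zero)
  have "(\<lambda>k. CARD('n) * (1 / 2) ^ k) \<longlonglongrightarrow> real CARD('n) * 0"
    by (intro tendsto_mult_left LIMSEQ_realpow_zero) auto
  then have "eventually (\<lambda>k. CARD('n) * (1 / 2) ^ k < \<delta>) sequentially"
    using \<delta>(1) by (intro order_tendstoD) auto
  then obtain N where N: "\<And>k. k \<ge> N \<Longrightarrow> CARD('n) * (1 / 2) ^ k < \<delta>" by (auto simp: eventually_sequentially)
  show ?thesis
  proof (intro exI[of _ N] allI impI ballI)
    fix k and x :: "real^'n" assume k: "N \<le> k" and x: "x \<in> unit_cube"
    let ?K = "\<lambda>y. haar_kernel_d k x y"
    have i1: "integrable lborel (\<lambda>y. indicator unit_cube y * (1 * ?K y))"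
      and p1: "1 = (\<integral>y. indicator unit_cube y * (1 * ?K y) \<partial>lborel)"
      using haar_partial_kernel[of "\<lambda>_. 1" k x] haar_partial_const[of k x] by simp_all
    note ig = haar_partial_kernel[OF g, of k x]
    have "haar_partial g k x - g x = haar_partial g k x - g x * (\<integral>y. indicator unit_cube y * (1 * ?K y) \<partial>lborel)"
      unfolding p1[symmetric] by simp
    also have "\<dots> = (\<integral>y. indicator unit_cube y * (g y * ?K y) - g x * (indicator unit_cube y * (1 * ?K y)) \<partial>lborel)"
      unfolding ig(2) integral_mult_right_zero[symmetric]
      by (rule Bochner_Integration.integral_diff[symmetric]) (intro ig(1) integrable_mult_right i1)+
    finally have eq: "haar_partial g k x - g x
      = (\<integral>y. indicator unit_cube y * (g y * ?K y) - g x * (indicator unit_cube y * (1 * ?K y)) \<partial>lborel)" .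
    have int: "integrable lborel (\<lambda>y. indicator unit_cube y * (g y * ?K y) - g x * (indicator unit_cube y * (1 * ?K y)))"
      by (intro Bochner_Integration.integrable_diff ig(1) integrable_mult_right i1)
    have "\<bar>haar_partial g k x - g x\<bar>
      \<le> (\<integral>y. \<bar>indicator unit_cube y * (g y * ?K y) - g x * (indicator unit_cube y * (1 * ?K y))\<bar> \<partial>lborel)"
      unfolding eq by (rule integral_abs_bound)
    also have "\<dots> \<le> (\<integral>y. (e / 2) * (indicator unit_cube y * (1 * ?K y)) \<partial>lborel)"
    proof (rule integral_mono)
      fix y
      show "\<bar>indicator unit_cube y * (g y * ?K y) - g x * (indicator unit_cube y * (1 * ?K y))\<bar>
        \<le> (e / 2) * (indicator unit_cube y * (1 * ?K y))"
      proof (cases "y \<in> unit_cube \<and> ?K y \<noteq> 0")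
        case True
        then have "norm (y - x) \<le> CARD('n) / 2 ^ k" using x by (intro haar_kernel_d_supp) auto
        also have "\<dots> = CARD('n) * (1 / 2) ^ k" by (simp add: power_divide)
        also have "\<dots> < \<delta>" by (rule N[OF k])
        finally have "\<bar>g y - g x\<bar> < e / 2" using \<delta>(2)[OF x, of y] True by (simp add: dist_norm)
        then have "\<bar>g y - g x\<bar> * ?K y \<le> e / 2 * ?K y"
          using haar_kernel_d_nonneg[OF x, of y k] True by (intro mult_right_mono) auto
        moreover have "\<bar>(g y - g x) * ?K y\<bar> = \<bar>g y - g x\<bar> * ?K y"
          using haar_kernel_d_nonneg[OF x, of y k] True by (simp add: abs_mult)
        ultimately show ?thesis using True by (simp add: left_diff_distrib)
      next
        case False
        then show ?thesis by (auto simp: indicator_def)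
      qed
    qed (intro integrable_abs int integrable_mult_right i1)+
    also have "\<dots> = (e / 2) * (\<integral>y. indicator unit_cube y * (1 * ?K y) \<partial>lborel)" by (rule integral_mult_right_zero)
    also have "\<dots> = e / 2" unfolding p1[symmetric] by simp
    finally show "\<bar>haar_partial g k x - g x\<bar> < e" using e by simp
  qed
qed

section \<open>The continuous version\<close>

lemma cube_simple_haar_d: "cube_simple (haar_d ns)"
proof (rule cube_simple_cells[of "range (\<lambda>s x. haar (ns s) (x $ s))"])
  fix \<phi> assume "\<phi> \<in> range (\<lambda>s (x :: real^'a). haar (ns s) (x $ s))"
  then obtain s where \<phi>: "\<phi> = (\<lambda>x. haar (ns s) (x $ s))" by blast
  have m: "\<phi> \<in> borel_measurable borel"
    unfolding \<phi> by (rule measurable_compose[OF _ haar_measurable]) (intro borel_measurable_continuous_onI continuous_intros)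
  have "\<phi> ` unit_cube \<subseteq> range (haar (ns s))" unfolding \<phi> by auto
  then have "finite (\<phi> ` unit_cube)" using haar_range by (rule finite_subset)
  moreover have "\<phi> -` {c} \<inter> unit_cube \<in> sets borel" for c
    using measurable_sets[OF m, of "{c}"] by (intro sets.Int) auto
  ultimately show "cube_simple \<phi>" by (simp add: cube_simple_def)
next
  fix x y :: "real^'a"
  assume "\<And>\<phi>. \<phi> \<in> range (\<lambda>s x. haar (ns s) (x $ s)) \<Longrightarrow> \<phi> x = \<phi> y"
  then have "haar (ns s) (x $ s) = haar (ns s) (y $ s)" for s by blast
  then show "haar_d ns x = haar_d ns y" unfolding haar_d_def by simp
qed simp

section \<open>Summability of weights over the Haar indices\<close>

text \<open>The index \<open>n = 1\<close> lies outside the dyadic blocks and accounts for the extra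
  1.\<close>

lemma sum_levels_bound:
  fixes F :: "nat \<Rightarrow> real"
  assumes r: "0 \<le> r" "r < 1" and F1: "F 1 \<le> 1" and F: "\<And>k. (\<Sum>i<2 ^ k. F (2 ^ k + i + 1)) \<le> r ^ k"
  shows "(\<Sum>n\<in>{1..2 ^ K}. F n) \<le> 1 + 1 / (1 - r)"
proof -
  have "(\<Sum>n\<in>{1..2 ^ K}. F n) \<le> 1 + (\<Sum>k<K. r ^ k)"
  proof (induction K)
    case (Suc K)
    have "(\<Sum>n\<in>{1..2 ^ Suc K}. F n) = (\<Sum>n\<in>{1..2 ^ K}. F n) + (\<Sum>i<2 ^ K. F (2 ^ K + i + 1))"
      by (rule sum_dyadic_index)
    then show ?case using Suc F[of K] by simp
  qed (use F1 in simp)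
  also have "(\<Sum>k<K. r ^ k) \<le> (\<Sum>k. r ^ k)"
    using r by (intro sum_le_suminf summable_geometric) auto
  also have "(\<Sum>k. r ^ k) = 1 / (1 - r)" using r by (intro suminf_geometric) auto
  finally show ?thesis by simp
qed

text \<open>The index set is a full product, so sums of products factorize and everything reduces to
  one variable.\<close>

lemma sum_haar_box_indices_prod:
  fixes F :: "'n::finite \<Rightarrow> nat \<Rightarrow> real"
  assumes "\<And>s n. 0 \<le> F s n" "\<And>s. (\<Sum>n\<in>{1..2 ^ K}. F s n) \<le> B"
  shows "(\<Sum>ns\<in>haar_box_indices K. \<Prod>s\<in>UNIV. F s (ns s)) \<le> B ^ CARD('n)"
proof -
  have "(\<Sum>ns\<in>haar_box_indices K. \<Prod>s\<in>UNIV. F s (ns s)) = (\<Prod>s\<in>UNIV. \<Sum>n\<in>{1..2 ^ K}. F s n)"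
    unfolding haar_box_indices_def by (rule prod_sum_PiE[symmetric]) auto
  also have "\<dots> \<le> (\<Prod>s\<in>(UNIV :: 'n set). B)" using assms by (intro prod_mono conjI sum_nonneg) auto
  finally show ?thesis by simp
qed

lemma haar_level_dyadic: "i < 2 ^ k \<Longrightarrow> haar_level (2 ^ k + i + 1) = k"
  using haar_level_eq[of "i + 1" k] by (simp add: add.assoc)

lemma sum_haar_level_powr:
  assumes c: "1 < c"
  shows "(\<Sum>n\<in>{1..2 ^ K}. 2 powr (- c * real (haar_level n))) \<le> 1 + 1 / (1 - 2 powr (1 - c))"
proof (rule sum_levels_bound)
  show "2 powr (1 - c) < 1" using c powr_less_mono[of "1 - c" 0 2] by simp
  fix k
  have "(\<Sum>i<2 ^ k. 2 powr (- c * real (haar_level (2 ^ k + i + 1)))) = (\<Sum>i<2 ^ k::nat. 2 powr (- c * real k))"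
    by (intro sum.cong refl) (simp only: lessThan_iff haar_level_dyadic)
  also have "\<dots> = 2 ^ k * 2 powr (- c * real k)" by simp
  also have "\<dots> = 2 powr real k * 2 powr (- c * real k)" by (simp add: powr_realpow)
  also have "\<dots> = 2 powr ((1 - c) * real k)" unfolding powr_add[symmetric] by (simp add: algebra_simps)
  also have "\<dots> = (2 powr (1 - c)) ^ k" by (simp add: powr_powr[symmetric] powr_realpow)
  finally show "(\<Sum>i<2 ^ k. 2 powr (- c * real (haar_level (2 ^ k + i + 1)))) \<le> (2 powr (1 - c)) ^ k" by simp
qed simp_all

text \<open>Level \<open>k\<close> contributes at most 2^(k/2) before weighting, so the exponent 1/2
  + \<epsilon> leaves a geometric series of ratio 2^(-\<epsilon>).\<close>

lemma sum_haar_abs_powr: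
  assumes \<epsilon>: "0 < \<epsilon>" and x: "0 \<le> x" "x \<le> 1"
  shows "(\<Sum>n\<in>{1..2 ^ K}. 2 powr (- (1 / 2 + \<epsilon>) * real (haar_level n)) * \<bar>haar n x\<bar>) \<le> 1 + 1 / (1 - 2 powr (- \<epsilon>))"
proof (rule sum_levels_bound)
  show "2 powr (- \<epsilon>) < 1" using \<epsilon> powr_less_mono[of "- \<epsilon>" 0 2] by simp
  show "2 powr (- (1 / 2 + \<epsilon>) * real (haar_level 1)) * \<bar>haar 1 x\<bar> \<le> 1" by (simp add: haar_def)
  fix k
  have "(\<Sum>i<2 ^ k. 2 powr (- (1 / 2 + \<epsilon>) * real (haar_level (2 ^ k + i + 1))) * \<bar>haar (2 ^ k + i + 1) x\<bar>)
    = (\<Sum>i<2 ^ k. 2 powr (- (1 / 2 + \<epsilon>) * real k) * \<bar>haar (2 ^ k + i + 1) x\<bar>)"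
    by (intro sum.cong refl) (simp only: lessThan_iff haar_level_dyadic)
  also have "\<dots> = 2 powr (- (1 / 2 + \<epsilon>) * real k) * (\<Sum>i<2 ^ k. \<bar>haar (2 ^ k + i + 1) x\<bar>)"
    by (simp only: sum_distrib_left)
  also have "\<dots> \<le> 2 powr (- (1 / 2 + \<epsilon>) * real k) * sqrt (2 ^ k)"
    using sum_abs_haar_level[OF x] by (intro mult_left_mono) auto
  also have "sqrt (2 ^ k) = 2 powr (real k * (1 / 2))"
  proof -
    have "sqrt (2 ^ k) = (2 powr real k) powr (1 / 2)" by (simp add: powr_half_sqrt powr_realpow)
    then show ?thesis by (simp only: powr_powr)
  qed
  also have "2 powr (- (1 / 2 + \<epsilon>) * real k) * 2 powr (real k * (1 / 2)) = 2 powr (- \<epsilon> * real k)"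
    unfolding powr_add[symmetric] by (simp add: algebra_simps)
  also have "\<dots> = (2 powr (- \<epsilon>)) ^ k" by (simp only: powr_powr[symmetric] powr_realpow) (simp add: powr_realpow)
  finally show "(\<Sum>i<2 ^ k. 2 powr (- (1 / 2 + \<epsilon>) * real (haar_level (2 ^ k + i + 1))) * \<bar>haar (2 ^ k + i + 1) x\<bar>)
    \<le> (2 powr (- \<epsilon>)) ^ k" .
qed simp

definition haar_weight :: "real \<Rightarrow> ('n::finite \<Rightarrow> nat) \<Rightarrow> real" where
  "haar_weight c ns = (\<Prod>s\<in>UNIV. 2 powr (- c * real (haar_level (ns s))))"

lemma haar_weight_pos: "0 < haar_weight c ns"
  unfolding haar_weight_def by (intro prod_pos) auto

lemma haar_weight_mult: "haar_weight c ns * haar_weight c' ns = haar_weight (c + c') ns"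
  unfolding haar_weight_def prod.distrib[symmetric] powr_add[symmetric] by (simp add: algebra_simps)

lemma sum_haar_weight:
  assumes "1 < c"
  shows "(\<Sum>ns\<in>haar_box_indices K. haar_weight c (ns :: 'n::finite \<Rightarrow> nat)) \<le> (1 + 1 / (1 - 2 powr (1 - c))) ^ CARD('n)"
  unfolding haar_weight_def
  using sum_haar_box_indices_prod[of "\<lambda>s n. 2 powr (- c * real (haar_level n))"] sum_haar_level_powr[OF assms] by auto

lemma sum_haar_weight_haar_d:
  fixes x :: "real^'n::finite"
  assumes "0 < \<epsilon>" "x \<in> unit_cube"
  shows "(\<Sum>ns\<in>haar_box_indices K. \<bar>haar_weight (1 / 2 + \<epsilon>) ns * haar_d ns x\<bar>) \<le> (1 + 1 / (1 - 2 powr (- \<epsilon>))) ^ CARD('n)"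
proof -
  have "\<bar>haar_weight (1 / 2 + \<epsilon>) ns * haar_d ns x\<bar>
    = (\<Prod>s\<in>UNIV. 2 powr (- (1 / 2 + \<epsilon>) * real (haar_level (ns s))) * \<bar>haar (ns s) (x $ s)\<bar>)" for ns
    unfolding abs_mult haar_d_def abs_prod prod.distrib using haar_weight_pos[of "1 / 2 + \<epsilon>" ns]
    by (simp add: haar_weight_def)
  then have e: "(\<Sum>ns\<in>haar_box_indices K. \<bar>haar_weight (1 / 2 + \<epsilon>) ns * haar_d ns x\<bar>)
    = (\<Sum>ns\<in>haar_box_indices K. \<Prod>s\<in>UNIV. 2 powr (- (1 / 2 + \<epsilon>) * real (haar_level (ns s))) * \<bar>haar (ns s) (x $ s)\<bar>)"
    by simp
  show ?thesis unfolding e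
    by (rule sum_haar_box_indices_prod[where F="\<lambda>s n. 2 powr (- (1 / 2 + \<epsilon>) * real (haar_level n)) * \<bar>haar n (x $ s)\<bar>"])
      (use assms in \<open>auto intro!: sum_haar_abs_powr simp only: mem_unit_cube\<close>, simp)
qed

lemma sum_haar_box_increments:
  fixes h :: "('n::finite \<Rightarrow> nat) \<Rightarrow> real"
  shows "(\<Sum>ns\<in>haar_box_indices 0. h ns) + (\<Sum>k<K. \<Sum>ns\<in>haar_box_indices (Suc k) - haar_box_indices k. h ns)
    = (\<Sum>ns\<in>haar_box_indices K. h ns)"
proof (induction K)
  case (Suc K)
  have "(\<Sum>ns\<in>haar_box_indices (Suc K). h ns)
    = (\<Sum>ns\<in>haar_box_indices K. h ns) + (\<Sum>ns\<in>haar_box_indices (Suc K) - haar_box_indices K. h ns)"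
    using sum.subset_diff[OF haar_box_indices_mono[of K "Suc K"], of h] by (simp add: add.commute)
  then show ?case using Suc by simp
qed simp

section \<open>Integrals of uniform limits\<close>

context SM
begin

lemma sm_simple_int_diff:
  assumes "cube_simple g" "cube_simple h"
  shows "AE w in M. sm_simple_int \<mu> (\<lambda>x. g x - h x) w = sm_simple_int \<mu> g w - sm_simple_int \<mu> h w"
proof -
  let ?\<phi> = "\<lambda>b. if b then g else h"
  have "AE w in M. \<forall>a. sm_simple_int \<mu> (\<lambda>x. \<Sum>i\<in>UNIV. a i * ?\<phi> i x) w = (\<Sum>i\<in>UNIV. a i * sm_simple_int \<mu> (?\<phi> i) w)"
    by (rule sm_simple_int_linear) (use assms in auto)
  then show ?thesis
  proof eventually_elim
    case (elim w)
    from elim[rule_format, of "\<lambda>b. if b then 1 else - 1"] show ?case by (simp add: UNIV_bool)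
  qed
qed

lemma prob_tendsto_0_of_AE:
  fixes Z :: "nat \<Rightarrow> 'w \<Rightarrow> real"
  assumes Z: "\<And>k. Z k \<in> borel_measurable M" "\<xi> \<in> borel_measurable M"
    and lim: "AE w in M. (\<lambda>k. Z k w) \<longlonglongrightarrow> \<xi> w" and c: "0 < c"
  shows "(\<lambda>k. prob {w \<in> space M. c \<le> \<bar>Z k w - \<xi> w\<bar>}) \<longlonglongrightarrow> 0"
proof -
  let ?A = "\<lambda>k. {w \<in> space M. c \<le> \<bar>Z k w - \<xi> w\<bar>}"
  have "(\<lambda>w. \<bar>Z k w - \<xi> w\<bar>) \<in> borel_measurable M" for k
    by (intro borel_measurable_abs borel_measurable_diff Z)
  then have ev: "?A k \<in> events" for k by measurable
  have "(\<lambda>k. \<integral>w. indicator (?A k) w \<partial>M) \<longlonglongrightarrow> (\<integral>w. 0 \<partial>M :: real)"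
  proof (rule integral_dominated_convergence[where w="\<lambda>_. 1"])
    show "AE w in M. (\<lambda>k. indicator (?A k) w) \<longlonglongrightarrow> (0 :: real)"
      using lim
    proof eventually_elim
      case (elim w)
      then have "eventually (\<lambda>k. dist (Z k w) (\<xi> w) < c) sequentially" using c by (rule tendstoD)
      then have "eventually (\<lambda>k. indicator (?A k) w = (0 :: real)) sequentially"
        by eventually_elim (auto simp: dist_real_def)
      then show ?case by (rule tendsto_eventually)
    qed
  qed (use ev in auto)
  then show ?thesis using ev by simp
qed

text \<open>\<open>sm_integral\<close> demands the same limit along every uniformly approximating
  sequence. Differences between two such sequences are uniformly small, so
  \<open>sm_simple_int_tight\<close> makes their integrals small in probability.\<close>

lemma sm_integral_of_uniform_limit:
  assumes S: "\<And>k. cube_simple (S k)" and unif: "\<And>e. e > 0 \<Longrightarrow> \<exists>N. \<forall>k\<ge>N. \<forall>x\<in>unit_cube. \<bar>S k x - g x\<bar> < e"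
    and \<xi>: "\<xi> \<in> borel_measurable M" and lim: "AE w in M. (\<lambda>k. sm_simple_int \<mu> (S k) w) \<longlonglongrightarrow> \<xi> w"
  shows "sm_integral M \<mu> g \<xi>"
  unfolding sm_integral_def
proof (intro conjI allI impI \<xi>)
  fix gs :: "nat \<Rightarrow> real^'n \<Rightarrow> real"
  assume gs: "\<forall>n. cube_simple (gs n)" and gl: "\<forall>e>0. \<exists>N. \<forall>n\<ge>N. \<forall>x\<in>unit_cube. \<bar>gs n x - g x\<bar> < e"
  show "conv_in_prob M (\<lambda>n. sm_simple_int \<mu> (gs n)) \<xi>"
    unfolding conv_in_prob_def
  proof (intro allI impI)
    fix e0 :: real assume e0: "e0 > 0"
    then have e02: "0 < e0 / 2" by simp
    show "(\<lambda>n. measure M {w \<in> space M. \<bar>sm_simple_int \<mu> (gs n) w - \<xi> w\<bar> > e0}) \<longlonglongrightarrow> 0"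
    proof (rule LIMSEQ_I)
      fix e :: real assume "e > 0"
      then have e4: "e / 4 > 0" by simp
      obtain K where K: "0 < K" "\<And>g \<delta>. cube_simple g \<Longrightarrow> 0 < \<delta> \<Longrightarrow> (\<And>x. x \<in> unit_cube \<Longrightarrow> \<bar>g x\<bar> \<le> \<delta>) \<Longrightarrow>
        prob {w \<in> space M. \<delta> * K \<le> \<bar>sm_simple_int \<mu> g w\<bar>} \<le> e / 4"
        apply (rule sm_simple_int_tight[OF e4])
        subgoal premises p for K by (rule p(1)[OF p(2,3)])
        done
      define \<delta> where "\<delta> = e0 / 2 / K"
      have \<delta>: "0 < \<delta>" "0 < \<delta> / 2" "\<delta> * K = e0 / 2" using e0 K(1) by (auto simp: \<delta>_def)
      obtain N1 where N1: "\<And>k x. k \<ge> N1 \<Longrightarrow> x \<in> unit_cube \<Longrightarrow> \<bar>S k x - g x\<bar> < \<delta> / 2"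
        using unif[OF \<delta>(2)] by blast
      have Sm: "sm_simple_int \<mu> (S k) \<in> borel_measurable M" for k by (rule sm_simple_int_measurable[OF S])
      have "eventually (\<lambda>k. prob {w \<in> space M. e0 / 2 \<le> \<bar>sm_simple_int \<mu> (S k) w - \<xi> w\<bar>} < e / 4) sequentially"
        using prob_tendsto_0_of_AE[OF Sm \<xi> lim e02] e4 by (rule order_tendstoD)
      then obtain N2 where N2: "\<And>k. k \<ge> N2 \<Longrightarrow> prob {w \<in> space M. e0 / 2 \<le> \<bar>sm_simple_int \<mu> (S k) w - \<xi> w\<bar>} < e / 4"
        by (auto simp: eventually_sequentially)
      obtain N3 where N3: "\<And>n x. n \<ge> N3 \<Longrightarrow> x \<in> unit_cube \<Longrightarrow> \<bar>gs n x - g x\<bar> < \<delta> / 2"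
        using gl \<delta>(2) by blast
      define k where "k = max N1 N2"
      have k: "N1 \<le> k" "N2 \<le> k" by (auto simp: k_def)
      let ?E2 = "{w \<in> space M. e0 / 2 \<le> \<bar>sm_simple_int \<mu> (S k) w - \<xi> w\<bar>}"
      show "\<exists>N. \<forall>n\<ge>N. norm (measure M {w \<in> space M. \<bar>sm_simple_int \<mu> (gs n) w - \<xi> w\<bar> > e0} - 0) < e"
      proof (intro exI[of _ N3] allI impI)
        fix n assume n: "n \<ge> N3"
        let ?E = "{w \<in> space M. \<bar>sm_simple_int \<mu> (gs n) w - \<xi> w\<bar> > e0}"
        let ?d = "\<lambda>x. gs n x - S k x"
        let ?E1 = "{w \<in> space M. \<delta> * K \<le> \<bar>sm_simple_int \<mu> ?d w\<bar>}"
        have gsn: "cube_simple (gs n)" using gs by blast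
        have ds: "cube_simple ?d" 
        proof (rule cube_simple_cells[of "{gs n, S k}"])
          fix x y assume eq: "\<And>\<phi>. \<phi> \<in> {gs n, S k} \<Longrightarrow> \<phi> x = \<phi> y"
          from eq[of "gs n"] eq[of "S k"] show "?d x = ?d y" by simp
        qed (use gsn S in auto)
        have "(\<lambda>w. \<bar>sm_simple_int \<mu> ?d w\<bar>) \<in> borel_measurable M" using sm_simple_int_measurable[OF ds] by measurable
        then have E1: "?E1 \<in> events" by measurable
        have "(\<lambda>w. \<bar>sm_simple_int \<mu> (S k) w - \<xi> w\<bar>) \<in> borel_measurable M" using Sm[of k] \<xi> by measurable
        then have E2: "?E2 \<in> events" by measurable
        have p1: "prob ?E1 \<le> e / 4"
        proof (rule K(2)[OF ds \<delta>(1)])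
          fix x :: "real^'n" assume x: "x \<in> unit_cube"
          show "\<bar>?d x\<bar> \<le> \<delta>" using N1[OF k(1) x] N3[OF n x] by linarith
        qed
        have "AE w in M. w \<in> ?E \<longrightarrow> w \<in> ?E1 \<union> ?E2"
          using sm_simple_int_diff[OF gsn S[of k]]
        proof eventually_elim
          case (elim w)
          have "e0 / 2 \<le> \<bar>a - b\<bar> \<or> e0 / 2 \<le> \<bar>b - c\<bar>" if "e0 < \<bar>a - c\<bar>" for a b c :: real
            using that by linarith
          then show ?case unfolding \<delta>(3) using elim by auto
        qed
        then have "prob ?E \<le> prob (?E1 \<union> ?E2)" using E1 E2 by (intro finite_measure_mono_AE sets.Un)
        also have "\<dots> \<le> prob ?E1 + prob ?E2" using E1 E2 by (intro measure_Un_le)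
        finally have "prob ?E < e" using p1 N2[OF k(2)] \<open>e > 0\<close> by linarith
        then show "norm (measure M ?E - 0) < e" by simp
      qed
    qed
  qed
qed

end

text \<open>Dominated convergence along sequences, which determine continuity on a metric space; the
  bound \<open>C\<close> is uniform in \<open>z\<close>.\<close>

lemma haar_coeff_continuous:
  fixes f :: "'z::metric_space \<Rightarrow> real^'n::finite \<Rightarrow> real"
  assumes ns: "haar_box ns" and fx: "\<And>x. x \<in> unit_cube \<Longrightarrow> continuous_on UNIV (\<lambda>z. f z x)"
    and fz: "\<And>z. continuous_on unit_cube (f z)" and C: "\<And>z x. x \<in> unit_cube \<Longrightarrow> \<bar>f z x\<bar> \<le> C"
  shows "continuous_on UNIV (\<lambda>z. haar_coeff ns (f z))"
proof (rule continuous_on_sequentiallyI)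
  interpret haar_box ns by fact
  fix u :: "nat \<Rightarrow> 'z" and a assume u: "u \<longlonglongrightarrow> a"
  note hw = haar_coeff_weighted[OF fz]
  have one: "integrable lborel (weighted (\<lambda>_. 1))" by (rule haar_coeff_weighted) simp
  have "(\<lambda>n. \<integral>x. weighted (f (u n)) x \<partial>lborel) \<longlonglongrightarrow> (\<integral>x. weighted (f a) x \<partial>lborel)"
  proof (rule integral_dominated_convergence[where w="\<lambda>x. C * \<bar>weighted (\<lambda>_. 1) x\<bar>"])
    show "integrable lborel (\<lambda>x. C * \<bar>weighted (\<lambda>_. 1) x\<bar>)"
      by (intro integrable_mult_right integrable_abs one)
    show "AE x in lborel. (\<lambda>n. weighted (f (u n)) x) \<longlonglongrightarrow> weighted (f a) x"
    proof (rule AE_I2)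
      fix x :: "real^'n"
      show "(\<lambda>n. weighted (f (u n)) x) \<longlonglongrightarrow> weighted (f a) x"
      proof (cases "x \<in> unit_cube")
        case True
        have "isCont (\<lambda>z. f z x) a" using fx[OF True] by (simp add: continuous_on_eq_continuous_at)
        then have "(\<lambda>n. f (u n) x) \<longlonglongrightarrow> f a x" using u by (rule isCont_tendsto_compose)
        then show ?thesis unfolding weighted_def by (intro tendsto_mult tendsto_const)
      qed (simp add: weighted_def)
    qed
    show "AE x in lborel. norm (weighted (f (u n)) x) \<le> C * \<bar>weighted (\<lambda>_. 1) x\<bar>" for n
    proof (rule AE_I2)
      fix x :: "real^'n"
      show "norm (weighted (f (u n)) x) \<le> C * \<bar>weighted (\<lambda>_. 1) x\<bar>"
        using C[of x "u n"] by (cases "x \<in> unit_cube") (auto simp: weighted_def abs_mult intro: mult_right_mono)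
    qed
  qed (use hw(1) in auto)
  then show "(\<lambda>n. haar_coeff ns (f (u n))) \<longlonglongrightarrow> haar_coeff ns (f a)" unfolding hw(2) .
qed

lemma decay_exponent_gt_half: "real l + \<alpha> > real d / 2 \<Longrightarrow> 0 < d \<Longrightarrow> 1 / 2 < decay_exponent l \<alpha> d"
  by (auto simp: decay_exponent_def min_def field_simps)

text \<open>Being a version is a statement for each \<open>z\<close> separately, expressed by
  \<open>sm_integral\<close>, while summability and continuity hold outside one null set common to
  all \<open>z\<close>.\<close>

theorem theorem2:
  fixes M :: "'w measure"
    and \<mu> :: "(real^'n::finite) set \<Rightarrow> 'w \<Rightarrow> real"
    and f :: "'z::metric_space \<Rightarrow> real^'n \<Rightarrow> real"
    and D :: "'z \<Rightarrow> 'n list \<Rightarrow> real^'n \<Rightarrow> real"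
    and l :: nat and \<alpha> C :: real
  assumes "prob_space M" and "complete_measure M"
    and "stochastic_measure M \<mu>"
    and "\<alpha> > 0" and "C > 0"
    and "\<And>x. x \<in> unit_cube \<Longrightarrow> continuous_on UNIV (\<lambda>z. f z x)"
    and "\<And>z x. x \<in> unit_cube \<Longrightarrow> D z [] x = f z x"
    and "\<And>z ss s. length ss < l \<Longrightarrow> partial_on_cube (D z ss) s (D z (s # ss))"
    and "\<And>z ss. length ss \<le> l \<Longrightarrow> continuous_on unit_cube (D z ss)"
    and "\<And>z ss x. length ss \<le> l \<Longrightarrow> x \<in> unit_cube \<Longrightarrow> \<bar>D z ss x\<bar> \<le> C"
    and "\<And>z ss x1 x2. length ss = l \<Longrightarrow> x1 \<in> unit_cube \<Longrightarrow> x2 \<in> unit_cube \<Longrightarrow>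
           \<bar>D z ss x1 - D z ss x2\<bar> \<le> C * norm (x1 - x2) powr \<alpha>"
    and "real l + \<alpha> > real CARD('n) / 2"
  shows "(\<forall>z. sm_integral M \<mu> (f z) (haar_version \<mu> (f z))) \<and>
         (AE w in M. (\<forall>z. summable (\<lambda>k. haar_series_term \<mu> (f z) k w)) \<and>
                     continuous_on UNIV (\<lambda>z. haar_version \<mu> (f z) w))"
proof -
  note asm = assms
  interpret prob_space M by fact
  interpret SM M \<mu> by unfold_locales fact
  define \<theta> where "\<theta> = decay_exponent l \<alpha> CARD('n)"
  have \<theta>: "1 / 2 < \<theta>" unfolding \<theta>_def using asm(12) by (intro decay_exponent_gt_half) auto
  \<comment> \<open>Half of the surplus of \<theta> over 1/2: the exponent 1/2 + \<epsilon> serves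
    the Haar integrals, and \<theta> - \<epsilon> still exceeds 1/2 for the squares of the
    coefficients.\<close>
  define \<epsilon> where "\<epsilon> = (\<theta> - 1 / 2) / 2"
  have \<epsilon>: "0 < \<epsilon>" and \<theta>\<epsilon>: "1 < 2 * (\<theta> - \<epsilon>)" using \<theta> by (simp_all add: \<epsilon>_def field_simps)
  let ?\<I> = "haar_box_indices :: nat \<Rightarrow> ('n \<Rightarrow> nat) set"
  define u where "u = (haar_weight (1 / 2 + \<epsilon>) :: ('n \<Rightarrow> nat) \<Rightarrow> real)"
  define b where "b ns = C * haar_weight (\<theta> - \<epsilon>) ns" for ns :: "'n \<Rightarrow> nat"
  define \<phi> where "\<phi> ns x = u ns * haar_d ns x" for ns and x :: "real^'n"
  define Y where "Y ns = sm_simple_int \<mu> (\<phi> ns)" for ns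
  define a where "a z ns = haar_coeff ns (f z) / u ns" for z ns
  have u0: "0 < u ns" for ns unfolding u_def by (rule haar_weight_pos)

  have fcont: "continuous_on unit_cube (f z)" for z
  proof -
    have "continuous_on unit_cube (D z [])" by (rule asm(9)) simp
    then show ?thesis by (rule continuous_on_eq) (rule asm(7))
  qed
  have fC: "\<bar>f z x\<bar> \<le> C" if "x \<in> unit_cube" for z x
    using asm(10)[of "[]" x z] asm(7)[of x z] that by simp
  have a_bound: "\<bar>a z ns\<bar> \<le> b ns" if ns: "ns \<in> ?\<I> k" for z ns k
  proof -
    have "\<bar>haar_coeff ns (f z)\<bar> \<le> C * haar_weight (1 / 2 + \<theta>) ns"
      unfolding haar_weight_def \<theta>_def
      by (rule haar_box.haar_coeff_decay[OF haar_box_of_indices[OF ns], of l "D z"]) (use asm fcont in auto)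
    also have "\<dots> = b ns * u ns"
      unfolding b_def u_def mult.assoc haar_weight_mult by (simp add: algebra_simps)
    finally show ?thesis unfolding a_def using u0[of ns] by (simp add: divide_le_eq)
  qed
  have a_cont: "continuous_on UNIV (\<lambda>z. a z ns)" if ns: "ns \<in> ?\<I> k" for ns k
    unfolding a_def using u0[of ns]
    by (intro continuous_on_divide continuous_on_const haar_coeff_continuous[OF haar_box_of_indices[OF ns] asm(6) fcont fC]) auto

  have \<phi>s: "cube_simple (\<phi> ns)" for ns
    by (rule cube_simple_cells[of "{haar_d ns}"]) (auto simp: cube_simple_haar_d \<phi>_def)
  have partial_eq: "haar_partial (f z) k = (\<lambda>x. \<Sum>ns\<in>?\<I> k. a z ns * \<phi> ns x)" for z k
    unfolding haar_partial_indices a_def \<phi>_def using u0 by (intro ext sum.cong refl) (simp add: less_imp_neq[symmetric])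
  have diff_eq: "(\<lambda>x. haar_partial (f z) (Suc k) x - haar_partial (f z) k x)
     = (\<lambda>x. \<Sum>ns\<in>?\<I> (Suc k) - ?\<I> k. a z ns * \<phi> ns x)" for z k
    unfolding partial_eq by (intro ext sum_diff[symmetric] finite_haar_box_indices haar_box_indices_mono) auto
  have partial_simple: "cube_simple (haar_partial (f z) k)" for z k
    unfolding partial_eq by (rule cube_simple_linear) (auto simp: \<phi>s)
  have diff_simple: "cube_simple (\<lambda>x. haar_partial (f z) (Suc k) x - haar_partial (f z) k x)" for z k
    unfolding diff_eq by (rule cube_simple_linear) (auto simp: \<phi>s)

  obtain B where B: "\<And>K. (\<Sum>ns\<in>?\<I> K. (b ns)\<^sup>2) \<le> B"
  proof -
    have "(b ns)\<^sup>2 = C\<^sup>2 * haar_weight (2 * (\<theta> - \<epsilon>)) ns" for ns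
      unfolding b_def power_mult_distrib power2_eq_square[of "haar_weight (\<theta> - \<epsilon>) ns"] haar_weight_mult mult_2 ..
    then have "(\<Sum>ns\<in>?\<I> K. (b ns)\<^sup>2) = C\<^sup>2 * (\<Sum>ns\<in>?\<I> K. haar_weight (2 * (\<theta> - \<epsilon>)) ns)" for K
      by (simp add: sum_distrib_left)
    then have "(\<Sum>ns\<in>?\<I> K. (b ns)\<^sup>2) \<le> C\<^sup>2 * (1 + 1 / (1 - 2 powr (1 - 2 * (\<theta> - \<epsilon>)))) ^ CARD('n)" for K
      using mult_left_mono[OF sum_haar_weight[OF \<theta>\<epsilon>, of K], of "C\<^sup>2"] by simp
    then show ?thesis by (rule that)
  qed

  \<comment> \<open>The coefficients \<open>a\<close> are quantified inside the null set. For each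
    \<open>k\<close> only finitely many functions \<phi> occur, so a countable union of null sets
    covers all \<open>z\<close> at once.\<close>
  have "AE w in M. \<forall>k a. sm_simple_int \<mu> (\<lambda>x. \<Sum>ns\<in>?\<I> k. a ns * \<phi> ns x) w = (\<Sum>ns\<in>?\<I> k. a ns * Y ns w)"
    unfolding Y_def by (subst AE_all_countable) (intro allI sm_simple_int_linear finite_haar_box_indices \<phi>s)
  moreover have "AE w in M. \<forall>k a. sm_simple_int \<mu> (\<lambda>x. \<Sum>ns\<in>?\<I> (Suc k) - ?\<I> k. a ns * \<phi> ns x) w
      = (\<Sum>ns\<in>?\<I> (Suc k) - ?\<I> k. a ns * Y ns w)"
    unfolding Y_def by (subst AE_all_countable) (intro allI sm_simple_int_linear finite_Diff finite_haar_box_indices \<phi>s)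
  moreover have "AE w in M. \<exists>K. \<forall>n. (\<Sum>ns\<in>?\<I> n. (Y ns w)\<^sup>2) \<le> K"
    unfolding Y_def
  proof (rule square_function_bounded_AE)
    show "incseq ?\<I>" by (simp add: incseq_def haar_box_indices_mono)
    have "2 powr (- \<epsilon>) < 1" using \<epsilon> powr_less_mono[of "- \<epsilon>" 0 2] by simp
    then show "0 < (1 + 1 / (1 - 2 powr (- \<epsilon>))) ^ CARD('n)" by (intro zero_less_power add_pos_pos) auto
    show "(\<Sum>ns\<in>?\<I> n. \<bar>\<phi> ns x\<bar>) \<le> (1 + 1 / (1 - 2 powr (- \<epsilon>))) ^ CARD('n)" if "x \<in> unit_cube" for n x
      unfolding \<phi>_def u_def by (rule sum_haar_weight_haar_d[OF \<epsilon> that])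
  qed (auto simp: \<phi>s)
  ultimately have main: "AE w in M. (\<forall>z. summable (\<lambda>k. haar_series_term \<mu> (f z) k w)) \<and>
      (\<forall>z. (\<lambda>k. sm_simple_int \<mu> (haar_partial (f z) k) w) \<longlonglongrightarrow> haar_version \<mu> (f z) w) \<and>
      continuous_on UNIV (\<lambda>z. haar_version \<mu> (f z) w)"
  proof eventually_elim
    case (elim w)
    have partial: "sm_simple_int \<mu> (haar_partial (f z) k) w = (\<Sum>ns\<in>?\<I> k. a z ns * Y ns w)" for z k
      unfolding partial_eq by (rule elim(1)[rule_format])
    have trm: "haar_series_term \<mu> (f z) k w = (\<Sum>ns\<in>?\<I> (Suc k) - ?\<I> k. a z ns * Y ns w)" for z k
      unfolding haar_series_term_def diff_eq by (rule elim(2)[rule_format])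
    obtain K where K: "\<And>n. (\<Sum>ns\<in>?\<I> n. (Y ns w)\<^sup>2) \<le> K" using elim(3) by blast
    \<comment> \<open>The elementary bound |a Y| \<le> (b^2 + Y^2)/2 gives a majorant independent of
      \<open>z\<close>. Its blocks are disjoint index sets, so its partial sums are bounded by those
      of the two square sums.\<close>
    define m where "m k = (\<Sum>ns\<in>?\<I> (Suc k) - ?\<I> k. ((b ns)\<^sup>2 + (Y ns w)\<^sup>2) / 2)" for k
    have m_sum: "summable m"
    proof (rule summableI_nonneg_bounded)
      show "0 \<le> m k" for k unfolding m_def by (intro sum_nonneg) auto
      fix n
      have "(\<Sum>k<n. m k) \<le> (\<Sum>ns\<in>?\<I> 0. ((b ns)\<^sup>2 + (Y ns w)\<^sup>2) / 2) + (\<Sum>k<n. m k)"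
        by (simp add: sum_nonneg)
      also have "\<dots> = (\<Sum>ns\<in>?\<I> n. ((b ns)\<^sup>2 + (Y ns w)\<^sup>2) / 2)"
        unfolding m_def by (rule sum_haar_box_increments)
      also have "\<dots> = ((\<Sum>ns\<in>?\<I> n. (b ns)\<^sup>2) + (\<Sum>ns\<in>?\<I> n. (Y ns w)\<^sup>2)) / 2"
        unfolding sum.distrib[symmetric] by (rule sum_divide_distrib[symmetric])
      also have "\<dots> \<le> (B + K) / 2" by (intro divide_right_mono add_mono B K) simp
      finally show "(\<Sum>k<n. m k) \<le> (B + K) / 2" .
    qed
    have trm_bound: "norm (haar_series_term \<mu> (f z) k w) \<le> m k" for z k
    proof -
      have "\<bar>a z ns * Y ns w\<bar> \<le> ((b ns)\<^sup>2 + (Y ns w)\<^sup>2) / 2" if "ns \<in> ?\<I> (Suc k)" for ns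
      proof -
        have "\<bar>a z ns * Y ns w\<bar> \<le> b ns * \<bar>Y ns w\<bar>"
          unfolding abs_mult by (intro mult_right_mono a_bound[OF that]) simp
        also have "\<dots> \<le> ((b ns)\<^sup>2 + (Y ns w)\<^sup>2) / 2"
          using sum_squares_bound[of "b ns" "\<bar>Y ns w\<bar>"] by simp
        finally show ?thesis .
      qed
      then have "(\<Sum>ns\<in>?\<I> (Suc k) - ?\<I> k. \<bar>a z ns * Y ns w\<bar>) \<le> m k" unfolding m_def by (intro sum_mono) auto
      then show ?thesis unfolding trm real_norm_def by (rule order_trans[OF sum_abs])
    qed
    have summ: "summable (\<lambda>k. haar_series_term \<mu> (f z) k w)" for z
      by (rule summable_comparison_test[OF _ m_sum]) (use trm_bound in blast)
    have lim: "(\<lambda>k. sm_simple_int \<mu> (haar_partial (f z) k) w) \<longlonglongrightarrow> haar_version \<mu> (f z) w" for z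
    proof -
      \<comment> \<open>The blocks telescope at this sample point, so the series converges to the
        limit of the integrals of the full partial sums.\<close>
      have eq: "(\<lambda>n. sm_simple_int \<mu> (haar_partial (f z) n) w)
        = (\<lambda>n. sm_simple_int \<mu> (haar_partial (f z) 0) w + (\<Sum>k<n. haar_series_term \<mu> (f z) k w))"
        unfolding partial trm by (rule ext) (rule sum_haar_box_increments[symmetric])
      have lim0: "(\<lambda>n. sm_simple_int \<mu> (haar_partial (f z) 0) w + (\<Sum>k<n. haar_series_term \<mu> (f z) k w))
         \<longlonglongrightarrow> haar_version \<mu> (f z) w"
        unfolding haar_version_def by (intro tendsto_add tendsto_const summable_LIMSEQ summ)
      show ?thesis
        by (rule ssubst[where P="\<lambda>F. F \<longlonglongrightarrow> haar_version \<mu> (f z) w", OF eq lim0])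
    qed
    have trm_cont: "continuous_on UNIV (\<lambda>z. haar_series_term \<mu> (f z) k w)" for k
      unfolding trm by (intro continuous_on_sum continuous_on_mult continuous_on_const a_cont[of _ "Suc k"]) auto
    have "uniform_limit UNIV (\<lambda>n z. \<Sum>k<n. haar_series_term \<mu> (f z) k w) (\<lambda>z. \<Sum>k. haar_series_term \<mu> (f z) k w) sequentially"
      by (rule Weierstrass_m_test[OF trm_bound m_sum])
    then have "continuous_on UNIV (\<lambda>z. \<Sum>k. haar_series_term \<mu> (f z) k w)"
      by (rule uniform_limit_theorem[rotated]) (simp, intro always_eventually allI continuous_on_sum trm_cont)
    moreover have "continuous_on UNIV (\<lambda>z. sm_simple_int \<mu> (haar_partial (f z) 0) w)"
      unfolding partial by (intro continuous_on_sum continuous_on_mult continuous_on_const a_cont[of _ 0])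
    ultimately have "continuous_on UNIV (\<lambda>z. haar_version \<mu> (f z) w)"
      unfolding haar_version_def by (intro continuous_on_add)
    then show ?case using summ lim by blast
  qed
  have "sm_integral M \<mu> (f z) (haar_version \<mu> (f z))" for z
  proof (rule sm_integral_of_uniform_limit[OF partial_simple])
    show "\<exists>N. \<forall>k\<ge>N. \<forall>x\<in>unit_cube. \<bar>haar_partial (f z) k x - f z x\<bar> < e" if "0 < e" for e
      by (rule haar_partial_uniform_limit[OF fcont that])
    have "haar_series_term \<mu> (f z) k \<in> borel_measurable M" for k
      unfolding haar_series_term_def[abs_def] by (rule sm_simple_int_measurable[OF diff_simple])
    then show "haar_version \<mu> (f z) \<in> borel_measurable M"
      unfolding haar_version_def[abs_def]
      by (intro borel_measurable_add borel_measurable_suminf sm_simple_int_measurable[OF partial_simple])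
    show "AE w in M. (\<lambda>k. sm_simple_int \<mu> (haar_partial (f z) k) w) \<longlonglongrightarrow> haar_version \<mu> (f z) w"
      using main by eventually_elim blast
  qed
  moreover have "AE w in M. (\<forall>z. summable (\<lambda>k. haar_series_term \<mu> (f z) k w)) \<and>
      continuous_on UNIV (\<lambda>z. haar_version \<mu> (f z) w)"
    using main by eventually_elim blast
  ultimately show ?thesis by blast
qed

end
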